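(* Let $M$ and $N$ be oriented connected topological manifolds of dimension $n\geq 1$ and let $f:M\to N$ be a continuous map. Suppose that there exist $x_0$ and $x_1$ in $M$ such that $\deg(f,x_0)<0$ and $\deg(f,x_1)>0$. Then there exists $x_2$ in $M$ such that $\deg(f,x_2)=0$.
   Context: All homology is singular homology with coefficients in $\mathbb{Z}$. Let $f:M\to N$ be a continuous map between oriented connected topological manifolds of dimension $n\geq 1$. The map $f$ is discrete at a point $x\in M$ if there is a neighborhood $V$ of $x$ such that $f(x')\neq f(x)$ for every $x'\in V\setminus\{x\}$. The local degree $\deg(f,x)\in\mathbb{Z}$ is defined for every $x\in M$ as follows. If $f$ is not discrete at $x$, then $\deg(f,x)=0$. If $f$ is discrete at $x$, with $V$ a neighborhood of $x$ such that $f(x')\neq f(x)$ for every $x'\in V\setminus\{x\}$, and $y=f(x)$, let $\alpha_x\in H_n(V,V\setminus\{x\})$ and $\beta_y\in H_n(N,N\setminus\{y\})$ be the orientation classes at $x$ and $y$; then $\deg(f,x)$ is the integer with $f_*(\alpha_x)=\deg(f,x)\cdot\beta_y$, where $f_*:H_n(V,V\setminus\{x\})\to H_n(N,N\setminus\{y\})$ is induced by $f$. *)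

theory Defs
  imports "HOL-Homology.Homology" "HOL-Analysis.Analysis"
begin

definition locally_Euclidean_space :: "nat \<Rightarrow> 'a topology \<Rightarrow> bool" where
  "locally_Euclidean_space n X \<longleftrightarrow>
     (\<forall>x\<in>topspace X. \<exists>U W. openin X U \<and> x \<in> U \<and> openin (Euclidean_space n) W \<and>
        subtopology X U homeomorphic_space subtopology (Euclidean_space n) W)"

definition topological_manifold :: "nat \<Rightarrow> 'a topology \<Rightarrow> bool" where
  "topological_manifold n X \<longleftrightarrow>
     Hausdorff_space X \<and> second_countable X \<and> locally_Euclidean_space n X"

text \<open>The groups of HOL-Homology are singular homology groups with integer coefficients, written
  multiplicatively in the style of HOL-Algebra: the multiple \<open>d \<cdot> a\<close> of a class is \<open>a [^] d\<close>.\<close>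

abbreviation local_homology_group :: "nat \<Rightarrow> 'a topology \<Rightarrow> 'a \<Rightarrow> 'a chain set monoid" where
  "local_homology_group n X x \<equiv> relative_homology_group (int n) X (topspace X - {x})"

text \<open>An orientation picks a generator of each local homology group; the picked generators near a
  point must be the images of a single class of \<open>H\<^sub>n(X, X - U)\<close>, with \<open>U\<close> an open neighbourhood
  of that point. Values of \<open>\<omega>\<close> outside \<open>topspace X\<close> are irrelevant.\<close>

definition orientation :: "nat \<Rightarrow> 'a topology \<Rightarrow> ('a \<Rightarrow> 'a chain set) \<Rightarrow> bool" where
  "orientation n X \<omega> \<longleftrightarrow>
     (\<forall>x\<in>topspace X. \<omega> x \<in> carrier (local_homology_group n X x) \<and>
        generate (local_homology_group n X x) {\<omega> x} = carrier (local_homology_group n X x)) \<and>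
     (\<forall>x\<in>topspace X. \<exists>U. openin X U \<and> x \<in> U \<and>
        (\<exists>\<mu>\<in>carrier (relative_homology_group (int n) X (topspace X - U)).
           \<forall>y\<in>U. hom_induced (int n) X (topspace X - U) X (topspace X - {y}) id \<mu> = \<omega> y))"

definition neighbourhood_of :: "'a topology \<Rightarrow> 'a \<Rightarrow> 'a set \<Rightarrow> bool" where
  "neighbourhood_of X x V \<longleftrightarrow> V \<subseteq> topspace X \<and> (\<exists>U. openin X U \<and> x \<in> U \<and> U \<subseteq> V)"

definition isolating_neighbourhood :: "'a topology \<Rightarrow> ('a \<Rightarrow> 'b) \<Rightarrow> 'a \<Rightarrow> 'a set \<Rightarrow> bool" where
  "isolating_neighbourhood X f x V \<longleftrightarrow> neighbourhood_of X x V \<and> (\<forall>x'\<in>V - {x}. f x' \<noteq> f x)"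

definition discrete_at :: "'a topology \<Rightarrow> ('a \<Rightarrow> 'b) \<Rightarrow> 'a \<Rightarrow> bool" where
  "discrete_at X f x \<longleftrightarrow> (\<exists>V. isolating_neighbourhood X f x V)"

text \<open>The orientation class at \<open>x\<close> in \<open>H\<^sub>n(V, V - {x})\<close> is the class corresponding to \<open>\<omega> x\<close> under the
  excision isomorphism onto \<open>H\<^sub>n(X, X - {x})\<close>.\<close>

definition orientation_class_in ::
  "nat \<Rightarrow> 'a topology \<Rightarrow> ('a \<Rightarrow> 'a chain set) \<Rightarrow> 'a set \<Rightarrow> 'a \<Rightarrow> 'a chain set" where
  "orientation_class_in n X \<omega> V x =
     (THE a. a \<in> carrier (relative_homology_group (int n) (subtopology X V) (V - {x})) \<and>
        hom_induced (int n) (subtopology X V) (V - {x}) X (topspace X - {x}) id a = \<omega> x)"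

text \<open>The local degree does not depend on the choice of the isolating neighbourhood \<open>V\<close>; that is
  why its defining equation can be imposed for all \<open>V\<close> at once.\<close>

definition local_degree ::
  "nat \<Rightarrow> 'a topology \<Rightarrow> ('a \<Rightarrow> 'a chain set) \<Rightarrow> 'b topology \<Rightarrow> ('b \<Rightarrow> 'b chain set)
     \<Rightarrow> ('a \<Rightarrow> 'b) \<Rightarrow> 'a \<Rightarrow> int" where
  "local_degree n X \<omega> Y \<eta> f x =
     (if discrete_at X f x
      then THE d::int. \<forall>V. isolating_neighbourhood X f x V \<longrightarrow>
             hom_induced (int n) (subtopology X V) (V - {x}) Y (topspace Y - {f x}) f
               (orientation_class_in n X \<omega> V x)
             = \<eta> (f x) [^]\<^bsub>local_homology_group n Y (f x)\<^esub> d
      else 0)"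

end

theory Submission
  imports Defs
begin

text \<open>
  Suppose that no local degree vanishes. Then \<open>f\<close> is discrete and, since a local degree can be computed
  over any nearby value, open. Let \<open>K\<close> be the frontier of the set of points of positive degree. By Baire's
  theorem there are a point of \<open>K\<close> and an open neighbourhood \<open>W\<close> of it such that densely many \<open>k \<in> W \<inter> K\<close>
  are the only preimages of \<open>f k\<close> in \<open>W\<close>; as \<open>f\<close> is open, this then holds for all \<open>k \<in> W \<inter> K\<close>. So, locally,
  \<open>f\<close> is a proper map \<open>P \<rightarrow> Y\<close> of some total degree \<open>d \<noteq> 0\<close>, it is injective on the closed set \<open>K\<close>, every
  point of \<open>K\<close> has degree \<open>d\<close>, and \<open>K\<close> is the full preimage of \<open>f(K)\<close>.

  Let \<open>O\<close> be a component of \<open>Y - f(K)\<close> that contains the image of a point whose degree has the sign opposite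
  to \<open>d\<close>, and split the preimage of \<open>O\<close> into the part \<open>U\<close> of opposite sign and the part \<open>V\<close> of the sign of \<open>d\<close>.
  They are mapped to \<open>O\<close> with constant degrees \<open>a\<close> and \<open>b\<close>, where \<open>a + b = d\<close> and \<open>a, b \<noteq> 0\<close>, and both
  accumulate at some point \<open>k\<close> of \<open>K\<close> over the frontier of \<open>O\<close>. The class \<open>b [U] - a [V]\<close> is mapped to \<open>0\<close>, hence
  so is its boundary, which lies near \<open>K\<close>. There a continuous extension \<open>g\<close> of \<open>(f|K)\<inverse>\<close> satisfies
  \<open>g \<circ> f \<approx> id\<close>, so the boundary itself vanishes near \<open>k\<close>. Therefore the multiplicity of \<open>b [U] - a [V]\<close> is
  constant near \<open>k\<close>; being \<open>b\<close> on \<open>U\<close> and \<open>- a\<close> on \<open>V\<close>, this gives \<open>a + b = 0\<close>, a contradiction.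
\<close>

section \<open>Homology classes supported in a closed set\<close>

text \<open>The frontier \<open>K\<close> can be wild: neither it nor its image need have a collar
  or any manifold structure, so the two sides cannot be compared by a local model. Injectivity on
  \<open>K\<close> is the substitute. The left inverse comes from a Tietze extension in chart
  coordinates; off \<open>K\<close> it inverts \<open>f\<close> only approximately, so margins are
  arranged that keep the straight-line homotopy away from two test points and from a small cell
  \<open>E\<close>. The coefficients \<open>b\<close> and \<open>-a\<close> are forced: over
  \<open>O\<close> the degrees then add up to b * a - a * b = 0. The multiplicities are read off at
  just two points of \<open>E\<close>, one in \<open>U\<close> and one in \<open>V\<close>, because
  a class of H_n(M, M - E) is determined by its value at any single point of \<open>E\<close>. What
  has to be shown is thus that the combination extends over \<open>E\<close>, that is, that its
  boundary vanishes relative to M - E. No global fundamental class is used: degrees are computed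
  from a class \<mu> on a small open \<open>G\<close>, and the vanishing of classes in H_n(X, X - C)
  is tested at points. That test is proved for finite unions of boxes and carried over by charts,
  which is why compact sets get thickened.\<close>

declare one_relative_homology_group [simp del]

section \<open>Induced homomorphisms, exactness for triples and excision, in elementwise
  form\<close>

lemma hom_induced_one [simp]:
  "hom_induced p X S Y T f \<one>\<^bsub>relative_homology_group p X S\<^esub> = \<one>\<^bsub>relative_homology_group p Y T\<^esub>"
  by (meson group_relative_homology_group hom_induced_hom hom_one)

lemma hom_induced_mult:
  assumes "c \<in> carrier (relative_homology_group p X S)" "d \<in> carrier (relative_homology_group p X S)"
  shows "hom_induced p X S Y T f (c \<otimes>\<^bsub>relative_homology_group p X S\<^esub> d)
       = hom_induced p X S Y T f c \<otimes>\<^bsub>relative_homology_group p Y T\<^esub> hom_induced p X S Y T f d"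
  by (rule hom_mult [OF hom_induced_hom assms])

lemma hom_induced_int_pow:
  fixes k :: int
  assumes "c \<in> carrier (relative_homology_group p X S)"
  shows "hom_induced p X S Y T f (c [^]\<^bsub>relative_homology_group p X S\<^esub> k)
       = hom_induced p X S Y T f c [^]\<^bsub>relative_homology_group p Y T\<^esub> k"
  by (rule hom_int_pow [OF hom_induced_hom assms]) auto

lemma hom_induced_inv:
  assumes "c \<in> carrier (relative_homology_group p X S)"
  shows "hom_induced p X S Y T f (inv\<^bsub>relative_homology_group p X S\<^esub> c)
       = inv\<^bsub>relative_homology_group p Y T\<^esub> hom_induced p X S Y T f c"
  using assms by (intro group_hom.hom_inv group_hom.intro group_hom_axioms.intro)
    (auto simp: hom_induced_hom)

lemma iso_eq_oneD:
  assumes "h \<in> iso G H" "group G" "group H" "x \<in> carrier G" "h x = \<one>\<^bsub>H\<^esub>"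
  shows "x = \<one>\<^bsub>G\<^esub>"
proof -
  have h: "h \<in> hom G H" "inj_on h (carrier G)"
    using assms(1) by (auto simp: iso_iff iso_imp_homomorphism)
  have "h x = h \<one>\<^bsub>G\<^esub>"
    using assms hom_one [OF h(1)] by simp
  then show ?thesis
    by (rule inj_onD [OF h(2)]) (simp_all add: assms group.is_monoid monoid.one_closed)
qed

lemma iso_ex_preimage:
  assumes "h \<in> iso G H" "y \<in> carrier H"
  obtains x where "x \<in> carrier G" "h x = y"
proof -
  have "y \<in> h ` carrier G"
    using assms by (simp add: iso_iff)
  then show thesis
    using that by (elim imageE) simp
qed

lemma relative_homology_lift_triple:
  assumes "T \<subseteq> S" "c \<in> carrier (relative_homology_group p X S)"
    and "hom_relboundary p X S T c = \<one>\<^bsub>relative_homology_group (p-1) (subtopology X S) T\<^esub>"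
  obtains w where "w \<in> carrier (relative_homology_group p X T)" "hom_induced p X T X S id w = c"
  using homology_exactness_triple_1 [OF assms(1), of p X] assms(2,3)
  by (auto simp: kernel_def set_eq_iff image_iff) metis

lemma relative_homology_lift_subspace:
  assumes "T \<subseteq> S" "u \<in> carrier (relative_homology_group p X T)"
    and "hom_induced p X T X S id u = \<one>\<^bsub>relative_homology_group p X S\<^esub>"
  obtains v where "v \<in> carrier (relative_homology_group p (subtopology X S) T)"
    "hom_induced p (subtopology X S) T X T id v = u"
  using homology_exactness_triple_3 [OF assms(1), of p X] assms(2,3)
  by (auto simp: kernel_def set_eq_iff image_iff) metis

lemma relative_homology_lift_relboundary:
  assumes "T \<subseteq> S" "v \<in> carrier (relative_homology_group (p-1) (subtopology X S) T)"
    and "hom_induced (p-1) (subtopology X S) T X T id v = \<one>\<^bsub>relative_homology_group (p-1) X T\<^esub>"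
  obtains c where "c \<in> carrier (relative_homology_group p X S)" "hom_relboundary p X S T c = v"
  using homology_exactness_triple_2 [OF assms(1), of p X] assms(2,3)
  by (auto simp: kernel_def set_eq_iff image_iff) metis

lemma hom_relboundary_one:
  "hom_relboundary p X S T \<one>\<^bsub>relative_homology_group p X S\<^esub>
   = \<one>\<^bsub>relative_homology_group (p-1) (subtopology X S) T\<^esub>"
  by (meson group_homomorphism_hom_relboundary group_relative_homology_group hom_one)

lemma hom_relboundary_natural:
  assumes "continuous_map X Y f" "f \<in> S \<rightarrow> U" "f \<in> T \<rightarrow> V"
  shows "hom_relboundary p Y U V (hom_induced p X S Y U f c)
       = hom_induced (p-1) (subtopology X S) T (subtopology Y U) V f (hom_relboundary p X S T c)"
  using naturality_hom_induced_relboundary [OF assms, of p] by (simp add: fun_eq_iff)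

text \<open>Excises \<open>R - P\<close>, which is closed in the union and contained in the open set
  \<open>R\<close>.\<close>

lemma excision_open:
  assumes "openin X P" "openin X R"
  shows "hom_induced p (subtopology X P) (P \<inter> R) (subtopology X (P \<union> R)) R id
         \<in> iso (relative_homology_group p (subtopology X P) (P \<inter> R))
               (relative_homology_group p (subtopology X (P \<union> R)) R)"
proof -
  let ?Z = "subtopology X (P \<union> R)"
  have sub: "P \<subseteq> topspace X" "R \<subseteq> topspace X"
    using assms openin_subset by auto
  have "openin ?Z P" "openin ?Z R"
    using assms by (auto simp: openin_open_subtopology openin_Un)
  then have "closedin ?Z (R - P)"
  proof -
    have "topspace ?Z - P = R - P" using sub by auto
    then show ?thesis using \<open>openin ?Z P\<close> by (metis closedin_diff closedin_topspace)
  qed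
  then have "?Z closure_of (R - P) \<subseteq> ?Z interior_of R"
    using \<open>openin ?Z R\<close> by (auto simp: closure_of_closedin interior_of_openin)
  from homology_excision_axiom [OF this, of "P \<union> R" p]
  have "hom_induced p (subtopology ?Z (P \<union> R - (R - P))) (R - (R - P)) (subtopology ?Z (P \<union> R)) R id
    \<in> iso (relative_homology_group p (subtopology ?Z (P \<union> R - (R - P))) (R - (R - P)))
          (relative_homology_group p (subtopology ?Z (P \<union> R)) R)"
    by auto
  moreover have "P \<union> R - (R - P) = P" "R - (R - P) = P \<inter> R" by auto
  ultimately show ?thesis
    by (simp add: subtopology_subtopology Int_absorb1 Int_absorb)
qed

text \<open>The local homology of \<open>X\<close> along \<open>C\<close>, often written H_p(X | C).
  Smaller sets \<open>C\<close> mean larger complements, so classes restrict from \<open>C\<close>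
  to its subsets; at a point this is \<open>local_homology_group\<close>.\<close>

abbreviation supp_homology :: "int \<Rightarrow> 'a topology \<Rightarrow> 'a set \<Rightarrow> 'a chain set monoid"
  where "supp_homology p X C \<equiv> relative_homology_group p X (topspace X - C)"

abbreviation supp_restrict :: "int \<Rightarrow> 'a topology \<Rightarrow> 'a set \<Rightarrow> 'a set \<Rightarrow> 'a chain set \<Rightarrow> 'a chain set"
  where "supp_restrict p X C D \<equiv> hom_induced p X (topspace X - C) X (topspace X - D) id"

lemma supp_restrict_restrict:
  assumes "D \<subseteq> C" "E \<subseteq> D"
  shows "supp_restrict p X D E (supp_restrict p X C D c) = supp_restrict p X C E c"
  using assms by (subst hom_induced_compose') auto

lemma excision_supp:
  assumes "openin X Q" "closedin X C" "C \<subseteq> Q"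
  shows "hom_induced p (subtopology X Q) (Q - C) X (topspace X - C) id
         \<in> iso (relative_homology_group p (subtopology X Q) (Q - C)) (supp_homology p X C)"
proof -
  have "Q \<subseteq> topspace X" using assms openin_subset by blast
  then have "Q \<inter> (topspace X - C) = Q - C" "Q \<union> (topspace X - C) = topspace X"
    using assms by auto
  with excision_open [OF assms(1), of "topspace X - C" p] assms(2) show ?thesis
    by (simp add: openin_diff)
qed

lemma trivial_group_relative_homologyI:
  assumes "\<And>c. c \<in> carrier (relative_homology_group i X S) \<Longrightarrow> c = \<one>\<^bsub>relative_homology_group i X S\<^esub>"
  shows "trivial_group (relative_homology_group i X S)"
  unfolding trivial_group_def
  using assms by (auto intro!: group.is_monoid monoid.one_closed)

lemma trivial_group_oneD: "\<lbrakk>trivial_group G; x \<in> carrier G\<rbrakk> \<Longrightarrow> x = \<one>\<^bsub>G\<^esub>"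
  unfolding trivial_group_def by auto

text \<open>The injectivity part of the relative Mayer-Vietoris sequence. Vanishing on
  \<open>A\<close> moves \<open>c\<close> into the complement of \<open>A\<close>; by excision it
  may be viewed in the complement of the intersection, relative to that of \<open>B\<close>.
  Vanishing on \<open>B\<close> makes it there a boundary of a class from the trivial group of
  degree p + 1.\<close>

lemma Mayer_Vietoris_supp:
  assumes A: "closedin X A" and B: "closedin X B"
    and triv: "trivial_group (supp_homology (p+1) X (A \<inter> B))"
    and c: "c \<in> carrier (supp_homology p X (A \<union> B))"
    and cA: "supp_restrict p X (A \<union> B) A c = \<one>\<^bsub>supp_homology p X A\<^esub>"
    and cB: "supp_restrict p X (A \<union> B) B c = \<one>\<^bsub>supp_homology p X B\<^esub>"
  shows "c = \<one>\<^bsub>supp_homology p X (A \<union> B)\<^esub>"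
proof -
  let ?T = "topspace X - (A \<union> B)" and ?S = "topspace X - A" and ?Z = "topspace X - A \<inter> B"
    and ?R = "topspace X - B"
  have "?T \<subseteq> ?S" by auto
  then obtain v where v: "v \<in> carrier (relative_homology_group p (subtopology X ?S) ?T)"
    and vc: "hom_induced p (subtopology X ?S) ?T X ?T id v = c"
    using relative_homology_lift_subspace [OF _ c cA] by metis
  define v' where "v' = hom_induced p (subtopology X ?S) ?T (subtopology X ?Z) ?R id v"
  have v': "v' \<in> carrier (relative_homology_group p (subtopology X ?Z) ?R)"
    by (simp add: v'_def hom_induced_carrier)
  have cont: "continuous_map (subtopology X ?S) (subtopology X ?Z) id"
    by (auto simp: continuous_map_in_subtopology continuous_map_from_subtopology)
  have "hom_induced p (subtopology X ?Z) ?R X ?R id v'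
      = hom_induced p (subtopology X ?S) ?T X ?R id v"
    unfolding v'_def using cont
    by (subst hom_induced_compose') (auto simp: continuous_map_from_subtopology)
  also have "\<dots> = hom_induced p X ?T X ?R id (hom_induced p (subtopology X ?S) ?T X ?T id v)"
    by (subst hom_induced_compose') (auto simp: continuous_map_from_subtopology)
  also have "\<dots> = \<one>\<^bsub>relative_homology_group p X ?R\<^esub>"
    using vc cB by simp
  finally have v'1: "hom_induced p (subtopology X ?Z) ?R X ?R id v' = \<one>\<^bsub>relative_homology_group p X ?R\<^esub>" .
  have RZ: "?R \<subseteq> ?Z" by auto
  obtain e where e: "e \<in> carrier (relative_homology_group (p+1) X ?Z)"
    and "hom_relboundary (p+1) X ?Z ?R e = v'"
    using relative_homology_lift_relboundary [OF RZ, of v' "p+1" X] v' v'1 by auto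
  moreover have "e = \<one>\<^bsub>relative_homology_group (p+1) X ?Z\<^esub>"
    by (rule trivial_group_oneD [OF triv e])
  ultimately have v'one: "v' = \<one>\<^bsub>relative_homology_group p (subtopology X ?Z) ?R\<^esub>"
    using hom_relboundary_one [of "p+1" X ?Z ?R] by simp
  have "?S \<inter> ?R = ?T" "?S \<union> ?R = ?Z" by auto
  with excision_open [of X ?S ?R p] A B
  have "hom_induced p (subtopology X ?S) ?T (subtopology X ?Z) ?R id
    \<in> iso (relative_homology_group p (subtopology X ?S) ?T)
          (relative_homology_group p (subtopology X ?Z) ?R)"
    by (simp add: openin_diff)
  then have "v = \<one>\<^bsub>relative_homology_group p (subtopology X ?S) ?T\<^esub>"
    by (rule iso_eq_oneD) (use v v'one in \<open>simp_all add: v'_def\<close>)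
  then show ?thesis using vc by simp
qed

section \<open>Unions of boxes in Euclidean space\<close>

text \<open>Degenerate and empty boxes are allowed, so that boxes are closed under
  intersection.\<close>

definition ebox :: "nat \<Rightarrow> (nat \<Rightarrow> real) \<Rightarrow> (nat \<Rightarrow> real) \<Rightarrow> (nat \<Rightarrow> real) set" where
  "ebox n a b = {x \<in> topspace (Euclidean_space n). \<forall>i<n. a i \<le> x i \<and> x i \<le> b i}"

lemma continuous_map_Euclidean_coordinate:
  "continuous_map X (Euclidean_space n) f \<Longrightarrow> continuous_map X euclideanreal (\<lambda>x. f x i)"
  by (auto simp: Euclidean_space_def continuous_map_in_subtopology continuous_map_componentwise_UNIV)

lemma ebox_eq_image:
  "ebox n a b = (\<lambda>x i. if i < n then x i else 0) ` Pi\<^sub>E {..<n} (\<lambda>i. {a i..b i})"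
proof
  show "ebox n a b \<subseteq> (\<lambda>x i. if i < n then x i else 0) ` Pi\<^sub>E {..<n} (\<lambda>i. {a i..b i})"
  proof
    fix x assume "x \<in> ebox n a b"
    then show "x \<in> (\<lambda>x i. if i < n then x i else 0) ` Pi\<^sub>E {..<n} (\<lambda>i. {a i..b i})"
      by (intro image_eqI [where x = "restrict x {..<n}"])
        (auto simp: ebox_def topspace_Euclidean_space fun_eq_iff)
  qed
qed (fastforce simp: ebox_def topspace_Euclidean_space PiE_iff)

lemma compactin_ebox: "compactin (Euclidean_space n) (ebox n a b)"
  unfolding ebox_eq_image
proof (rule image_compactin)
  show "compactin (product_topology (\<lambda>i. euclideanreal) {..<n}) (Pi\<^sub>E {..<n} (\<lambda>i. {a i..b i}))"
    by (simp add: compactin_PiE)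
  show "continuous_map (product_topology (\<lambda>i. euclideanreal) {..<n}) (Euclidean_space n)
     (\<lambda>x i. if i < n then x i else 0)"
    by (auto simp: continuous_map_componentwise_Euclidean_space intro: continuous_map_product_projection)
qed

lemma Hausdorff_Euclidean_space: "Hausdorff_space (Euclidean_space n)"
  by (simp add: Euclidean_space_def Hausdorff_space_subtopology euclidean_product_topology)

lemma closedin_ebox: "closedin (Euclidean_space n) (ebox n a b)"
  by (simp add: Hausdorff_Euclidean_space compactin_ebox compactin_imp_closedin)

lemma ebox_Int: "ebox n a b \<inter> ebox n c d = ebox n (\<lambda>i. max (a i) (c i)) (\<lambda>i. min (b i) (d i))"
  by (auto simp: ebox_def)

text \<open>Starting from the one-point space of dimension 0, each complement step raises dimension
  and degree by one, which reaches the origin. Any other point gives the same group, since the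
  homology relative to the complement of a closed set depends only on the homeomorphism type of that
  set.\<close>

lemma supp_homology_Euclidean_point:
  assumes "p \<in> topspace (Euclidean_space n)"
  shows "supp_homology i (Euclidean_space n) {p}
       \<cong> homology_group (i - int n) (Euclidean_space 0)"
proof -
  let ?z = "\<lambda>_::nat. 0::real"
  have top0: "topspace (Euclidean_space 0) = {?z}"
    by (auto simp: topspace_Euclidean_space)
  have z: "?z \<in> topspace (Euclidean_space n)"
    by (auto simp: topspace_Euclidean_space)
  have cl: "closedin (Euclidean_space n) {x}" if "x \<in> topspace (Euclidean_space n)" for x n
    using that by (simp add: closedin_Hausdorff_sing_eq Hausdorff_Euclidean_space)
  have "homology_group (i - int n) (Euclidean_space 0)
    \<cong> relative_homology_group (i - int n + int n) (Euclidean_space (0+n))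
          (topspace (Euclidean_space (0+n)) - {?z})"
    using relative_homology_group_Euclidean_complement_step [of 0 "{?z}" "i - int n" n] cl [of ?z 0]
    by (simp add: top0)
  also have "\<dots> \<cong> supp_homology i (Euclidean_space n) {p}"
  proof -
    have "subtopology (Euclidean_space n) {?z} homeomorphic_space subtopology (Euclidean_space n) {p}"
      unfolding homeomorphic_space_def homeomorphic_maps_def
      using z assms by (intro exI [of _ "\<lambda>_. p"] exI [of _ "\<lambda>_. ?z"]) auto
    from isomorphic_relative_homology_groups_Euclidean_complements [OF cl [OF z] cl [OF assms] this, of i]
    show ?thesis by simp
  qed
  finally show ?thesis
    by (rule group.iso_sym [rotated]) simp
qed

lemma supp_homology_Euclidean_point_trivial:
  assumes "p \<in> topspace (Euclidean_space n)" "i \<noteq> int n"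
  shows "trivial_group (supp_homology i (Euclidean_space n) {p})"
proof -
  have "topspace (Euclidean_space 0) = {\<lambda>_. 0}"
    by (auto simp: topspace_Euclidean_space)
  then have "trivial_group (homology_group (i - int n) (Euclidean_space 0))"
    using assms(2) by (intro homology_dimension_axiom) auto
  then show ?thesis
    using isomorphic_group_triviality [OF supp_homology_Euclidean_point [OF assms(1), of i]] by simp
qed

lemma supp_homology_Euclidean_point_cyclic:
  assumes "p \<in> topspace (Euclidean_space n)"
  shows "supp_homology (int n) (Euclidean_space n) {p} \<cong> integer_group"
proof -
  have "topspace (Euclidean_space 0) = {\<lambda>_. 0}"
    by (auto simp: topspace_Euclidean_space)
  then have "homology_group 0 (Euclidean_space 0) \<cong> integer_group"
    by (rule homology_coefficients)
  then show ?thesis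
    using supp_homology_Euclidean_point [OF assms, of "int n"] iso_trans by fastforce
qed

text \<open>The boundary of \<open>c\<close> lives on the complement of the box and dies in the
  complement of \<open>p\<close>. Pushing radially away from \<open>p\<close> brings it back
  unchanged, so it was already trivial; then \<open>c\<close> comes from the absolute homology of
  Euclidean space, which vanishes because i >= 1.\<close>

lemma ebox_restrict_point_eq_oneD:
  assumes p: "p \<in> ebox n a b" and i: "i \<ge> 1"
    and c: "c \<in> carrier (supp_homology i (Euclidean_space n) (ebox n a b))"
    and one: "supp_restrict i (Euclidean_space n) (ebox n a b) {p} c
              = \<one>\<^bsub>supp_homology i (Euclidean_space n) {p}\<^esub>"
  shows "c = \<one>\<^bsub>supp_homology i (Euclidean_space n) (ebox n a b)\<^esub>"
proof -
  let ?E = "Euclidean_space n" and ?D = "ebox n a b"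
  let ?S = "topspace ?E - ?D" and ?P = "topspace ?E - {p}"
  have pE: "p \<in> topspace ?E" and SP: "?S \<subseteq> ?P"
    using p by (auto simp: ebox_def)
  \<comment> \<open>\<open>N\<close> is the l1 distance from \<open>p\<close>, and \<open>R\<close>
    bounds it on the box. Adding R + 1 to this distance therefore leaves the box.\<close>
  define N where "N = (\<lambda>v. \<Sum>i<n. \<bar>v i - p i\<bar>)"
  define R where "R = (\<Sum>i<n. b i - a i)"
  have R0: "R \<ge> 0"
    unfolding R_def using p by (intro sum_nonneg) (force simp: ebox_def)
  \<comment> \<open>The radial push away from \<open>p\<close> by more than the size of the box is a homotopy inverse of the
    inclusion of the complement of the box into the complement of \<open>p\<close>.\<close>
  define r where "r = (\<lambda>(t::real, v) i. if i < n then p i + (v i - p i) * (1 + t * (R + 1) / N v) else 0)"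
  have N_pos: "N v > 0" if "v \<in> ?P" for v
  proof -
    have "v \<noteq> p" using that by auto
    then obtain j where "v j \<noteq> p j" by (auto simp: fun_eq_iff)
    then have "j < n"
      using that pE by (cases "j < n") (auto simp: topspace_Euclidean_space)
    have "0 < \<bar>v j - p j\<bar>" using \<open>v j \<noteq> p j\<close> by simp
    also have "\<dots> \<le> N v"
      unfolding N_def using \<open>j < n\<close> by (intro member_le_sum) auto
    finally show ?thesis .
  qed
  have N_ebox: "N v \<le> R" if "v \<in> ?D" for v
    unfolding N_def R_def using that p
    by (intro sum_mono) (force simp: ebox_def abs_le_iff)
  have N_r: "N (r (1, v)) = N v + (R + 1)" if "v \<in> ?P" for v
  proof -
    have "N (r (1, v)) = (\<Sum>i<n. \<bar>r (1, v) i - p i\<bar>)"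
      by (simp add: N_def)
    also have "\<dots> = (\<Sum>i<n. \<bar>v i - p i\<bar> * (1 + (R + 1) / N v))"
      unfolding r_def using N_pos [OF that] R0
      by (intro sum.cong) (auto simp: abs_mult)
    also have "\<dots> = N v * (1 + (R + 1) / N v)"
      by (simp add: N_def sum_distrib_right)
    also have "\<dots> = N v + (R + 1)"
      using N_pos [OF that] by (simp add: field_simps)
    finally show ?thesis .
  qed
  have r_top: "r tv \<in> topspace ?E" for tv
    by (auto simp: r_def topspace_Euclidean_space split: prod.splits)
  \<comment> \<open>Stretching by s >= 1 about a point of an interval cannot carry an outside point
    into the interval. Hence the push never enters the box from its complement.\<close>
  have shrink: "x \<le> w \<and> w \<le> y"
    if "1 \<le> s" "x \<le> u" "u \<le> y" "x \<le> u + (w - u) * s" "u + (w - u) * s \<le> y" for s u w x y :: real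
  proof -
    define P where "P = (w - u) * s"
    have "w - u \<le> P" if "w \<ge> u"
      using mult_left_mono [of 1 s "w - u"] that \<open>1 \<le> s\<close> by (simp add: P_def)
    moreover have "P \<le> w - u" if "w \<le> u"
      using mult_left_mono_neg [of 1 s "w - u"] that \<open>1 \<le> s\<close> by (simp add: P_def)
    moreover have "x \<le> u + P" "u + P \<le> y"
      using that by (simp_all add: P_def)
    ultimately show ?thesis
      using that(2,3) by linarith
  qed
  have r_S: "r (t, v) \<in> ?S" if "v \<in> ?S" "t \<in> {0..1}" for t v
  proof -
    have vP: "v \<in> ?P" using that SP by auto
    have s: "1 + t * (R + 1) / N v \<ge> 1" using N_pos [OF vP] R0 that by simp
    have "r (t, v) \<notin> ?D"
    proof
      assume rD: "r (t, v) \<in> ?D"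
      have "a i \<le> v i \<and> v i \<le> b i" if "i < n" for i
        by (rule shrink [where u = "p i", OF s]) (use rD p that in \<open>auto simp: ebox_def r_def\<close>)
      then show False using that by (auto simp: ebox_def)
    qed
    then show ?thesis using r_top by auto
  qed
  have r1: "r (1, v) \<in> ?S" if "v \<in> ?P" for v
    using N_r [OF that] N_ebox [of "r (1, v)"] N_pos [OF that] r_top by fastforce
  have cont_r: "continuous_map (prod_topology (top_of_set {0..1}) (subtopology ?E ?P)) ?E r"
  proof -
    let ?X = "prod_topology (top_of_set {0..1::real}) (subtopology ?E ?P)"
    have c1: "continuous_map ?X euclideanreal fst"
      by (rule continuous_map_into_fulltopology [OF continuous_map_fst])
    have c2: "continuous_map ?X euclideanreal (\<lambda>x. snd x i)" for i
      by (intro continuous_map_Euclidean_coordinate [of _ n] continuous_map_into_fulltopology [OF continuous_map_snd])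
    have N0: "x \<in> topspace ?X \<Longrightarrow> N (snd x) \<noteq> 0" for x
      using N_pos [of "snd x"] by auto
    have "continuous_map ?X euclideanreal (\<lambda>x. N (snd x))"
      unfolding N_def by (auto intro!: continuous_intros c2)
    then have "continuous_map ?X euclideanreal
        (\<lambda>x. p i + (snd x i - p i) * (1 + fst x * (R + 1) / N (snd x)))" for i
      using N0 by (auto intro!: continuous_intros c1 c2)
    then show ?thesis
      unfolding r_def case_prod_unfold by (simp add: continuous_map_componentwise_Euclidean_space)
  qed
  have cont_r1: "continuous_map (subtopology ?E ?P) (subtopology ?E ?S) (\<lambda>v. r (1, v))"
  proof -
    have "continuous_map (subtopology ?E ?P) (prod_topology (top_of_set {0..1}) (subtopology ?E ?P)) (\<lambda>v. (1::real, v))"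
      by (auto simp: continuous_map_pairwise o_def)
    from continuous_map_compose [OF this cont_r]
    have "continuous_map (subtopology ?E ?P) ?E (\<lambda>v. r (1, v))"
      by (simp add: o_def)
    with r1 show ?thesis by (auto simp: continuous_map_in_subtopology)
  qed
  have hom: "homotopic_with (\<lambda>h. True) (subtopology ?E ?S) (subtopology ?E ?S) (\<lambda>v. r (0, v)) (\<lambda>v. r (1, v))"
  proof -
    have "subtopology (prod_topology (top_of_set {0..1}) (subtopology ?E ?P)) ({0..1} \<times> ?S)
        = prod_topology (top_of_set {0..1::real}) (subtopology ?E ?S)"
      using SP by (simp add: subtopology_Times [symmetric] subtopology_subtopology Times_Int_Times Int_absorb1)
    then have "continuous_map (prod_topology (top_of_set {0..1}) (subtopology ?E ?S)) ?E r"
      by (metis cont_r continuous_map_from_subtopology)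
    then have "continuous_map (prod_topology (top_of_set {0..1}) (subtopology ?E ?S)) (subtopology ?E ?S) r"
      using r_S by (auto simp: continuous_map_in_subtopology)
    then show ?thesis unfolding homotopic_with_def by blast
  qed
  let ?b = "hom_relboundary i ?E ?S {} c"
  have b: "?b \<in> carrier (homology_group (i-1) (subtopology ?E ?S))"
    by (rule hom_relboundary)
  have idSP: "continuous_map (subtopology ?E ?S) (subtopology ?E ?P) id"
    using SP by (auto simp: continuous_map_in_subtopology continuous_map_from_subtopology)
  have b1: "hom_induced (i-1) (subtopology ?E ?S) {} (subtopology ?E ?P) {} id ?b
      = \<one>\<^bsub>homology_group (i-1) (subtopology ?E ?P)\<^esub>"
    using SP one by (subst hom_relboundary_natural [symmetric]) (auto simp: hom_relboundary_one)
  have r0: "r (0, v) = v" if "v \<in> topspace (subtopology ?E ?S)" for v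
    using that by (auto simp: r_def topspace_Euclidean_space fun_eq_iff)
  have "?b = hom_induced (i-1) (subtopology ?E ?S) {} (subtopology ?E ?S) {} id ?b"
    using b by (simp add: hom_induced_id)
  also have "hom_induced (i-1) (subtopology ?E ?S) {} (subtopology ?E ?S) {} id
     = hom_induced (i-1) (subtopology ?E ?S) {} (subtopology ?E ?S) {} (\<lambda>v. r (0, v))"
    by (rule hom_induced_eq) (simp add: r0)
  also have "\<dots> = hom_induced (i-1) (subtopology ?E ?S) {} (subtopology ?E ?S) {} (\<lambda>v. r (1, v))"
    using hom by (rule homology_homotopy_empty)
  also have "\<dots> ?b = hom_induced (i-1) (subtopology ?E ?P) {} (subtopology ?E ?S) {} (\<lambda>v. r (1, v))
      (hom_induced (i-1) (subtopology ?E ?S) {} (subtopology ?E ?P) {} id ?b)"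
    using cont_r1 idSP by (subst hom_induced_compose') (auto simp: o_def)
  also have "\<dots> = \<one>\<^bsub>homology_group (i-1) (subtopology ?E ?S)\<^esub>"
    using b1 by simp
  finally have "?b = \<one>\<^bsub>homology_group (i-1) (subtopology ?E ?S)\<^esub>" .
  then obtain w where w: "w \<in> carrier (homology_group i ?E)" "hom_induced i ?E {} ?E ?S id w = c"
    using relative_homology_lift_triple [OF empty_subsetI c] by metis
  have "trivial_group (homology_group i ?E)"
    using i by (metis contractible_Euclidean_space not_one_le_zero trivial_reduced_homology_group_contractible_space un_reduced_homology_group)
  then have "w = \<one>\<^bsub>homology_group i ?E\<^esub>"
    using w(1) by (rule trivial_group_oneD)
  then show ?thesis using w(2) by simp
qed

lemma supp_homology_empty: "trivial_group (supp_homology i X {})"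
  using trivial_relative_homology_group_topspace [of i X] by simp

lemma supp_homology_ebox_trivial:
  assumes "i > int n"
  shows "trivial_group (supp_homology i (Euclidean_space n) (ebox n a b))"
proof (cases "ebox n a b = {}")
  case True
  then show ?thesis by (simp only: supp_homology_empty)
next
  case False
  then obtain p where p: "p \<in> ebox n a b" by auto
  then have triv: "trivial_group (supp_homology i (Euclidean_space n) {p})"
    using assms by (intro supp_homology_Euclidean_point_trivial) (auto simp: ebox_def)
  show ?thesis
  proof (rule trivial_group_relative_homologyI)
    fix c assume "c \<in> carrier (supp_homology i (Euclidean_space n) (ebox n a b))"
    moreover have "supp_restrict i (Euclidean_space n) (ebox n a b) {p} c
        = \<one>\<^bsub>supp_homology i (Euclidean_space n) {p}\<^esub>"
      by (rule trivial_group_oneD [OF triv hom_induced_carrier])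
    ultimately show "c = \<one>\<^bsub>supp_homology i (Euclidean_space n) (ebox n a b)\<^esub>"
      using assms by (intro ebox_restrict_point_eq_oneD [OF p]) simp_all
  qed
qed

text \<open>The uniqueness half of the usual statement on fundamental classes along compact sets:
  the values at the points determine the class.\<close>

definition point_detected :: "nat \<Rightarrow> 'a topology \<Rightarrow> 'a set \<Rightarrow> bool" where
  "point_detected n X D \<longleftrightarrow> (\<forall>c \<in> carrier (supp_homology (int n) X D).
     (\<forall>y\<in>D. supp_restrict (int n) X D {y} c = \<one>\<^bsub>supp_homology (int n) X {y}\<^esub>)
     \<longrightarrow> c = \<one>\<^bsub>supp_homology (int n) X D\<^esub>)"

lemma point_detectedD:
  assumes "point_detected n X D" "c \<in> carrier (supp_homology (int n) X D)"
    and "\<And>y. y \<in> D \<Longrightarrow> supp_restrict (int n) X D {y} c = \<one>\<^bsub>supp_homology (int n) X {y}\<^esub>"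
  shows "c = \<one>\<^bsub>supp_homology (int n) X D\<^esub>"
  using assms unfolding point_detected_def by blast

lemma point_detected_empty: "point_detected n X {}"
  unfolding point_detected_def
  by (intro ballI impI) (rule trivial_group_oneD [OF supp_homology_empty])

text \<open>Splitting off one box \<open>B\<close>, Mayer-Vietoris applies to the remaining boxes
  and \<open>B\<close>. Their intersection is again a union of at most \<open>m\<close> boxes, and
  detection in degree \<open>n\<close> requires its homology in degree n + 1 to vanish; hence the
  two claims are proved together, by induction on a bound for the number of boxes.\<close>

lemma supp_homology_ebox_Union:
  assumes "n \<ge> 1"
  shows "\<lbrakk>finite \<B>; card \<B> \<le> m; \<B> \<subseteq> range (case_prod (ebox n))\<rbrakk>
    \<Longrightarrow> (\<forall>i > int n. trivial_group (supp_homology i (Euclidean_space n) (\<Union>\<B>)))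
      \<and> point_detected n (Euclidean_space n) (\<Union>\<B>)"
proof (induction m arbitrary: \<B>)
  case 0
  then have "\<B> = {}" by simp
  then show ?case
    by (simp only: Union_empty point_detected_empty supp_homology_empty) simp
next
  case (Suc m)
  let ?E = "Euclidean_space n"
  show ?case
  proof (cases "\<B> = {}")
    case True
    then show ?thesis
      by (simp only: Union_empty point_detected_empty supp_homology_empty) simp
  next
    case False
    then obtain B where B: "B \<in> \<B>" by auto
    then obtain a b where Bab: "B = ebox n a b" using Suc.prems by auto
    define \<A> where "\<A> = \<B> - {B}"
    define \<C> where "\<C> = (\<lambda>C. C \<inter> B) ` \<A>"
    have \<A>: "finite \<A>" "card \<A> \<le> m" "\<A> \<subseteq> range (case_prod (ebox n))"
      using Suc.prems B by (auto simp: \<A>_def)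
    have "\<C> \<subseteq> range (case_prod (ebox n))"
      using \<A>(3) by (fastforce simp: \<C>_def Bab ebox_Int)
    moreover have "finite \<C>" "card \<C> \<le> m"
      using \<A> card_image_le [of \<A> "\<lambda>C. C \<inter> B"] by (auto simp: \<C>_def)
    ultimately have ICoH: "\<forall>i > int n. trivial_group (supp_homology i ?E (\<Union>\<C>))"
      using Suc.IH by blast
    have AB: "\<Union>\<B> = \<Union>\<A> \<union> B" "\<Union>\<A> \<inter> B = \<Union>\<C>"
      using B by (auto simp: \<A>_def \<C>_def)
    note IA = Suc.IH [OF \<A>]
    have clA: "closedin ?E (\<Union>\<A>)" and clB: "closedin ?E B"
      using \<A> by (auto simp: Bab closedin_ebox intro!: closedin_Union)
    have MV: "c = \<one>\<^bsub>supp_homology i ?E (\<Union>\<B>)\<^esub>"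
      if "c \<in> carrier (supp_homology i ?E (\<Union>\<B>))" "i \<ge> int n"
        "supp_restrict i ?E (\<Union>\<B>) (\<Union>\<A>) c = \<one>\<^bsub>supp_homology i ?E (\<Union>\<A>)\<^esub>"
        "supp_restrict i ?E (\<Union>\<B>) B c = \<one>\<^bsub>supp_homology i ?E B\<^esub>" for i c
      using Mayer_Vietoris_supp [OF clA clB, of i c] ICoH that by (simp add: AB)
    show ?thesis
    proof
      show "\<forall>i>int n. trivial_group (supp_homology i ?E (\<Union>\<B>))"
      proof (intro allI impI trivial_group_relative_homologyI)
        fix i c
        assume i: "i > int n" and c: "c \<in> carrier (supp_homology i ?E (\<Union>\<B>))"
        have A: "trivial_group (supp_homology i ?E (\<Union>\<A>))"
          using IA i by blast
        have B: "trivial_group (supp_homology i ?E B)"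
          using supp_homology_ebox_trivial [OF i] by (simp only: Bab)
        show "c = \<one>\<^bsub>supp_homology i ?E (\<Union>\<B>)\<^esub>"
          using i by (intro MV [OF c] trivial_group_oneD [OF A] trivial_group_oneD [OF B]
            hom_induced_carrier) simp
      qed
      show "point_detected n ?E (\<Union>\<B>)"
        unfolding point_detected_def
      proof (intro ballI impI)
        fix c
        assume c: "c \<in> carrier (supp_homology (int n) ?E (\<Union>\<B>))"
          and pt: "\<forall>y\<in>\<Union>\<B>. supp_restrict (int n) ?E (\<Union>\<B>) {y} c = \<one>\<^bsub>supp_homology (int n) ?E {y}\<^esub>"
        have pt': "supp_restrict (int n) ?E C {y} (supp_restrict (int n) ?E (\<Union>\<B>) C c)
            = \<one>\<^bsub>supp_homology (int n) ?E {y}\<^esub>" if "C \<subseteq> \<Union>\<B>" "y \<in> C" for C y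
          using that pt by (subst supp_restrict_restrict) auto
        show "c = \<one>\<^bsub>supp_homology (int n) ?E (\<Union>\<B>)\<^esub>"
        proof (rule MV [OF c])
          show "supp_restrict (int n) ?E (\<Union>\<B>) (\<Union>\<A>) c = \<one>\<^bsub>supp_homology (int n) ?E (\<Union>\<A>)\<^esub>"
            by (rule point_detectedD [OF conjunct2 [OF IA] hom_induced_carrier], rule pt') (use AB(1) in blast)+
          show "supp_restrict (int n) ?E (\<Union>\<B>) B c = \<one>\<^bsub>supp_homology (int n) ?E B\<^esub>"
          proof (cases "B = {}")
            case True
            then show ?thesis
              using trivial_group_oneD [OF supp_homology_empty hom_induced_carrier] by metis
          next
            case False
            then obtain p where "p \<in> B" by auto
            show ?thesis
              unfolding Bab
            proof (rule ebox_restrict_point_eq_oneD)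
              show "p \<in> ebox n a b" using \<open>p \<in> B\<close> Bab by simp
              show "supp_restrict (int n) ?E (ebox n a b) {p}
                  (supp_restrict (int n) ?E (\<Union>\<B>) (ebox n a b) c) = \<one>\<^bsub>supp_homology (int n) ?E {p}\<^esub>"
                unfolding Bab [symmetric] by (rule pt') (use \<open>p \<in> B\<close> AB(1) in blast)+
            qed (use assms in \<open>simp_all add: hom_induced_carrier\<close>)
          qed
        qed simp
      qed
    qed
  qed
qed

corollary point_detected_ebox_Union:
  assumes "n \<ge> 1" "finite \<B>" "\<B> \<subseteq> range (case_prod (ebox n))"
  shows "point_detected n (Euclidean_space n) (\<Union>\<B>)"
  using supp_homology_ebox_Union [OF assms(1,2) order_refl assms(3)] by blast

section \<open>Charts and local homology of manifolds\<close>

text \<open>Stronger than detection for nonempty sets: one point suffices. This is the property of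
  cells that propagates multiplicities from one point to another.\<close>

definition point_faithful :: "nat \<Rightarrow> 'a topology \<Rightarrow> 'a set \<Rightarrow> bool" where
  "point_faithful n X D \<longleftrightarrow> (\<forall>p\<in>D. \<forall>c \<in> carrier (supp_homology (int n) X D).
     supp_restrict (int n) X D {p} c = \<one>\<^bsub>supp_homology (int n) X {p}\<^esub>
     \<longrightarrow> c = \<one>\<^bsub>supp_homology (int n) X D\<^esub>)"

lemma point_faithful_ebox: "n \<ge> 1 \<Longrightarrow> point_faithful n (Euclidean_space n) (ebox n a b)"
  unfolding point_faithful_def by (intro ballI impI ebox_restrict_point_eq_oneD) auto

text \<open>The chart domain, relative to the complement of \<open>C\<close>, is the middle term of
  a zigzag of excision isomorphisms between the local homologies of \<open>X\<close> and
  \<open>Y\<close>.\<close>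

lemma chart_supp_iso:
  assumes U: "openin X U" and W: "openin Y W"
    and \<eta>: "homeomorphic_map (subtopology X U) (subtopology Y W) \<eta>"
    and C: "C \<subseteq> U" "closedin X C" "closedin Y (\<eta> ` C)"
  shows "hom_induced k (subtopology X U) (U - C) X (topspace X - C) id
          \<in> iso (relative_homology_group k (subtopology X U) (U - C)) (supp_homology k X C)" (is ?th1)
    and "hom_induced k (subtopology X U) (U - C) Y (topspace Y - \<eta> ` C) \<eta>
          \<in> iso (relative_homology_group k (subtopology X U) (U - C)) (supp_homology k Y (\<eta> ` C))" (is ?th2)
proof -
  show ?th1
    using excision_supp [OF U C(2,1)] .
  have top: "topspace (subtopology X U) = U" "topspace (subtopology Y W) = W"
    using openin_subset [OF U] openin_subset [OF W] by auto
  have inj: "inj_on \<eta> U" and im: "\<eta> ` U = W"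
    using homeomorphic_imp_injective_map [OF \<eta>] homeomorphic_imp_surjective_map [OF \<eta>] top by simp_all
  have img: "\<eta> ` (U - C) = W - \<eta> ` C"
    using inj im C(1) by (simp add: inj_on_image_set_diff)
  have "\<eta> ` C \<subseteq> W"
    using im C(1) by auto
  have cont: "continuous_map (subtopology X U) (subtopology Y W) \<eta>"
    using \<eta> homeomorphic_imp_continuous_map by blast
  have "hom_induced k (subtopology X U) (U - C) (subtopology Y W) (W - \<eta> ` C) \<eta>
      \<in> iso (relative_homology_group k (subtopology X U) (U - C))
             (relative_homology_group k (subtopology Y W) (W - \<eta> ` C))"
    by (rule homeomorphic_map_relative_homology_iso [OF \<eta> _ img]) (use top in auto)
  from iso_set_trans [OF this excision_supp [OF W C(3) \<open>\<eta> ` C \<subseteq> W\<close>]]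
  show ?th2
    using cont img openin_subset [OF W]
    by (subst (asm) hom_induced_compose [symmetric]) (auto simp: continuous_map_from_subtopology)
qed

text \<open>The witness is the image of \<open>c\<close> under the zigzag of
  \<open>chart_supp_iso\<close>. The implications for units are stated exactly in the directions
  that carry detection and faithfulness from \<open>Y\<close> back to \<open>X\<close>.\<close>

lemma chart_transfer:
  assumes X: "Hausdorff_space X" and Y: "Hausdorff_space Y"
    and U: "openin X U" and W: "openin Y W"
    and \<eta>: "homeomorphic_map (subtopology X U) (subtopology Y W) \<eta>"
    and C: "C \<subseteq> U" "closedin X C" "closedin Y (\<eta> ` C)"
    and c: "c \<in> carrier (supp_homology k X C)"
  shows "\<exists>e \<in> carrier (supp_homology k Y (\<eta> ` C)).
    (e = \<one>\<^bsub>supp_homology k Y (\<eta> ` C)\<^esub> \<longrightarrow> c = \<one>\<^bsub>supp_homology k X C\<^esub>) \<and>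
    (\<forall>x\<in>C. supp_restrict k X C {x} c = \<one>\<^bsub>supp_homology k X {x}\<^esub>
       \<longrightarrow> supp_restrict k Y (\<eta> ` C) {\<eta> x} e = \<one>\<^bsub>supp_homology k Y {\<eta> x}\<^esub>)"
proof -
  let ?XU = "subtopology X U"
  note isos = chart_supp_iso [OF U W \<eta>, of _ k]
  have top: "topspace ?XU = U"
    using openin_subset [OF U] by auto
  have cont: "continuous_map ?XU Y \<eta>"
    using homeomorphic_imp_continuous_map [OF \<eta>] continuous_map_into_fulltopology by blast
  have inj: "inj_on \<eta> U"
    using homeomorphic_imp_injective_map [OF \<eta>] top by simp
  obtain c' where c': "c' \<in> carrier (relative_homology_group k ?XU (U - C))"
    and cc': "hom_induced k ?XU (U - C) X (topspace X - C) id c' = c"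
    using iso_ex_preimage [OF isos(1) [OF C] c] .
  let ?e = "hom_induced k ?XU (U - C) Y (topspace Y - \<eta> ` C) \<eta> c'"
  show ?thesis
  proof (intro bexI [of _ ?e] conjI ballI impI)
    show "?e \<in> carrier (supp_homology k Y (\<eta> ` C))"
      by (rule hom_induced_carrier)
    show "c = \<one>\<^bsub>supp_homology k X C\<^esub>" if "?e = \<one>\<^bsub>supp_homology k Y (\<eta> ` C)\<^esub>"
      using iso_eq_oneD [OF isos(2) [OF C] _ _ c' that] cc' by simp
  next
    fix x
    assume x: "x \<in> C" and one: "supp_restrict k X C {x} c = \<one>\<^bsub>supp_homology k X {x}\<^esub>"
    have xU: "{x} \<subseteq> U" using x C by auto
    have x': "x \<in> topspace X" "\<eta> x \<in> topspace Y"
      using x closedin_subset [OF C(2)] closedin_subset [OF C(3)] by auto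
    then have clx: "closedin X {x}" "closedin Y (\<eta> ` {x})"
      using X Y by (simp_all add: closedin_Hausdorff_sing_eq)
    define cx where "cx = hom_induced k ?XU (U - C) ?XU (U - {x}) id c'"
    have cx: "cx \<in> carrier (relative_homology_group k ?XU (U - {x}))"
      by (simp add: cx_def hom_induced_carrier)
    have "hom_induced k ?XU (U - {x}) X (topspace X - {x}) id cx
        = hom_induced k ?XU (U - C) X (topspace X - {x}) id c'"
      unfolding cx_def using x openin_subset [OF U] by (subst hom_induced_compose') (auto simp: continuous_map_from_subtopology)
    also have "\<dots> = supp_restrict k X C {x} c"
      unfolding cc' [symmetric] using x openin_subset [OF U] by (subst hom_induced_compose') (auto simp: continuous_map_from_subtopology)
    finally have "cx = \<one>\<^bsub>relative_homology_group k ?XU (U - {x})\<^esub>"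
      using iso_eq_oneD [OF isos(1) [OF xU clx] _ _ cx] one by simp
    then have "hom_induced k ?XU (U - {x}) Y (topspace Y - {\<eta> x}) \<eta> cx = \<one>\<^bsub>supp_homology k Y {\<eta> x}\<^esub>"
      by simp
    moreover have "hom_induced k ?XU (U - {x}) Y (topspace Y - {\<eta> x}) \<eta> cx
        = hom_induced k ?XU (U - C) Y (topspace Y - {\<eta> x}) \<eta> c'"
    proof -
      have "\<eta> \<in> (U - {x}) \<rightarrow> topspace Y - {\<eta> x}"
        using inj xU cont top by (auto simp: inj_on_def continuous_map_def)
      then show ?thesis
        unfolding cx_def using x cont by (subst hom_induced_compose') auto
    qed
    moreover have "supp_restrict k Y (\<eta> ` C) {\<eta> x} ?e
        = hom_induced k ?XU (U - C) Y (topspace Y - {\<eta> x}) \<eta> c'"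
    proof -
      have "\<eta> \<in> (U - C) \<rightarrow> topspace Y - \<eta> ` C"
        using inj C(1) cont top by (auto simp: inj_on_def continuous_map_def)
      then show ?thesis
        using x cont by (subst hom_induced_compose') auto
    qed
    ultimately show "supp_restrict k Y (\<eta> ` C) {\<eta> x} ?e = \<one>\<^bsub>supp_homology k Y {\<eta> x}\<^esub>"
      by simp
  qed
qed

lemma point_detected_chart:
  assumes "Hausdorff_space X" "Hausdorff_space Y" "openin X U" "openin Y W"
    "homeomorphic_map (subtopology X U) (subtopology Y W) \<eta>"
    "C \<subseteq> U" "closedin X C" "closedin Y (\<eta> ` C)"
    and "point_detected n Y (\<eta> ` C)"
  shows "point_detected n X C"
  unfolding point_detected_def
proof (intro ballI impI)
  fix c
  assume c: "c \<in> carrier (supp_homology (int n) X C)"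
    and one: "\<forall>x\<in>C. supp_restrict (int n) X C {x} c = \<one>\<^bsub>supp_homology (int n) X {x}\<^esub>"
  obtain e where e: "e \<in> carrier (supp_homology (int n) Y (\<eta> ` C))"
    "e = \<one>\<^bsub>supp_homology (int n) Y (\<eta> ` C)\<^esub> \<Longrightarrow> c = \<one>\<^bsub>supp_homology (int n) X C\<^esub>"
    "\<And>x. \<lbrakk>x \<in> C; supp_restrict (int n) X C {x} c = \<one>\<^bsub>supp_homology (int n) X {x}\<^esub>\<rbrakk>
       \<Longrightarrow> supp_restrict (int n) Y (\<eta> ` C) {\<eta> x} e = \<one>\<^bsub>supp_homology (int n) Y {\<eta> x}\<^esub>"
    using chart_transfer [OF assms(1-8) c] by blast
  show "c = \<one>\<^bsub>supp_homology (int n) X C\<^esub>"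
    by (rule e(2), rule point_detectedD [OF assms(9) e(1)]) (use e(3) one in blast)
qed

lemma point_faithfulD:
  assumes "point_faithful n X D" "p \<in> D" "c \<in> carrier (supp_homology (int n) X D)"
    and "supp_restrict (int n) X D {p} c = \<one>\<^bsub>supp_homology (int n) X {p}\<^esub>"
  shows "c = \<one>\<^bsub>supp_homology (int n) X D\<^esub>"
  using assms unfolding point_faithful_def by blast

lemma point_faithful_chart:
  assumes "Hausdorff_space X" "Hausdorff_space Y" "openin X U" "openin Y W"
    "homeomorphic_map (subtopology X U) (subtopology Y W) \<eta>"
    "C \<subseteq> U" "closedin X C" "closedin Y (\<eta> ` C)"
    and "point_faithful n Y (\<eta> ` C)"
  shows "point_faithful n X C"
  unfolding point_faithful_def
proof (intro ballI impI)
  fix p c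
  assume p: "p \<in> C" and c: "c \<in> carrier (supp_homology (int n) X C)"
    and one: "supp_restrict (int n) X C {p} c = \<one>\<^bsub>supp_homology (int n) X {p}\<^esub>"
  obtain e where e: "e \<in> carrier (supp_homology (int n) Y (\<eta> ` C))"
    "e = \<one>\<^bsub>supp_homology (int n) Y (\<eta> ` C)\<^esub> \<Longrightarrow> c = \<one>\<^bsub>supp_homology (int n) X C\<^esub>"
    "\<And>x. \<lbrakk>x \<in> C; supp_restrict (int n) X C {x} c = \<one>\<^bsub>supp_homology (int n) X {x}\<^esub>\<rbrakk>
       \<Longrightarrow> supp_restrict (int n) Y (\<eta> ` C) {\<eta> x} e = \<one>\<^bsub>supp_homology (int n) Y {\<eta> x}\<^esub>"
    using chart_transfer [OF assms(1-8) c] by blast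
  show "c = \<one>\<^bsub>supp_homology (int n) X C\<^esub>"
    by (rule e(2), rule point_faithfulD [OF assms(9) _ e(1) e(3) [OF p one]]) (use p in blast)
qed

section \<open>Cubes in charts and good compact sets in manifolds\<close>

lemma openin_Euclidean_cube:
  "openin (Euclidean_space n) {v \<in> topspace (Euclidean_space n). \<forall>i<n. \<bar>v i - x i\<bar> < r}"
proof -
  have "openin (Euclidean_space n) {v \<in> topspace (Euclidean_space n). \<forall>i\<in>{..<m}. \<bar>v i - x i\<bar> < r}" for m
  proof (induction m)
    case (Suc m)
    have "openin (Euclidean_space n) {v \<in> topspace (Euclidean_space n). v m \<in> {x m - r<..<x m + r}}"
      by (rule openin_continuous_map_preimage [of _ euclideanreal])
        (auto intro: continuous_map_Euclidean_coordinate [of _ n])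
    from openin_Int [OF this Suc]
    show ?case
      by (rule back_subst [of "openin (Euclidean_space n)"]) (auto simp: lessThan_Suc abs_less_iff)
  qed simp
  from this [of n] show ?thesis by (simp add: Ball_def)
qed

lemma Euclidean_cube_in_open:
  assumes "openin (Euclidean_space n) O'" "x \<in> O'"
  obtains r where "r > 0" "ebox n (\<lambda>i. x i - r) (\<lambda>i. x i + r) \<subseteq> O'"
proof -
  obtain T where T: "openin (powertop_real UNIV) T" "O' = T \<inter> {x. \<forall>i\<ge>n. x i = 0}"
    using assms by (auto simp: Euclidean_space_def openin_subtopology)
  obtain B where B: "x \<in> Pi\<^sub>E UNIV B" "\<And>i. openin euclideanreal (B i)" "Pi\<^sub>E UNIV B \<subseteq> T"
    using product_topology_open_contains_basis [OF T(1), of x] assms(2) T(2) by auto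
  have "\<exists>r>0. \<forall>y. \<bar>y - x i\<bar> \<le> r \<longrightarrow> y \<in> B i" for i
  proof -
    have "open (B i)" "x i \<in> B i" using B by auto
    then obtain e where "e > 0" "cball (x i) e \<subseteq> B i" using open_contains_cball by blast
    then show ?thesis by (auto simp: subset_iff dist_real_def abs_minus_commute)
  qed
  then obtain e where e: "\<And>i. e i > 0" "\<And>i y. \<bar>y - x i\<bar> \<le> e i \<Longrightarrow> y \<in> B i" by metis
  \<comment> \<open>Finitely many coordinates matter, since those from \<open>n\<close> on are 0;
    the element 1 keeps the set nonempty for n = 0.\<close>
  define r where "r = Min (insert 1 (e ` {..<n}))"
  have "r > 0" using e(1) by (auto simp: r_def)
  have re: "r \<le> e i" if "i < n" for i
    unfolding r_def using that by (intro Min_le) auto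
  have "ebox n (\<lambda>i. x i - r) (\<lambda>i. x i + r) \<subseteq> O'"
  proof
    fix y assume y: "y \<in> ebox n (\<lambda>i. x i - r) (\<lambda>i. x i + r)"
    have "y i \<in> B i" for i
    proof (cases "i < n")
      case True
      then have "\<bar>y i - x i\<bar> \<le> e i" using y re [of i] by (fastforce simp: ebox_def abs_le_iff)
      then show ?thesis by (rule e(2))
    next
      case False
      then have "y i = x i"
        using y assms(2) T(2) by (auto simp: ebox_def topspace_Euclidean_space)
      then show ?thesis using e(1) [of i] e(2) [of "x i" i] by simp
    qed
    then show "y \<in> O'"
      using y B(3) by (auto simp: T(2) ebox_def topspace_Euclidean_space PiE_iff)
  qed
  then show thesis using that \<open>r > 0\<close> by blast
qed

lemma locally_Euclidean_chart:
  assumes "locally_Euclidean_space n X" "x \<in> topspace X"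
  obtains U W \<eta> where "openin X U" "x \<in> U" "openin (Euclidean_space n) W"
    "homeomorphic_map (subtopology X U) (subtopology (Euclidean_space n) W) \<eta>"
  using assms unfolding locally_Euclidean_space_def homeomorphic_space by metis

lemma chart_preimage_ebox:
  assumes U: "openin X U" and W: "openin (Euclidean_space n) W" and X: "Hausdorff_space X"
    and \<eta>: "homeomorphic_map (subtopology X U) (subtopology (Euclidean_space n) W) \<eta>"
    and D: "compactin (Euclidean_space n) D" "D \<subseteq> W"
  shows "compactin X {x \<in> U. \<eta> x \<in> D}" "\<eta> ` {x \<in> U. \<eta> x \<in> D} = D"
proof -
  have top: "topspace (subtopology X U) = U" "topspace (subtopology (Euclidean_space n) W) = W"
    using openin_subset [OF U] openin_subset [OF W] by auto
  show im: "\<eta> ` {x \<in> U. \<eta> x \<in> D} = D"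
  proof
    show "D \<subseteq> \<eta> ` {x \<in> U. \<eta> x \<in> D}"
    proof
      fix y assume "y \<in> D"
      moreover then have "y \<in> \<eta> ` U"
        using homeomorphic_imp_surjective_map [OF \<eta>] D(2) top by auto
      ultimately show "y \<in> \<eta> ` {x \<in> U. \<eta> x \<in> D}" by blast
    qed
  qed blast
  have "compactin (subtopology (Euclidean_space n) W) D"
    using D by (simp add: compactin_subtopology)
  then have "compactin (subtopology X U) {x \<in> U. \<eta> x \<in> D}"
    using homeomorphic_map_compactness [OF \<eta>, of "{x \<in> U. \<eta> x \<in> D}"] top im by auto
  then show "compactin X {x \<in> U. \<eta> x \<in> D}"
    by (simp add: compactin_subtopology)
qed

lemma chart_preimage_open:
  assumes U: "openin X U" and \<eta>: "continuous_map (subtopology X U) Y \<eta>" and T: "openin Y T"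
  shows "openin X {x \<in> U. \<eta> x \<in> T}"
proof -
  have "openin (subtopology X U) {x \<in> topspace (subtopology X U). \<eta> x \<in> T}"
    by (rule openin_continuous_map_preimage [OF \<eta> T])
  then show ?thesis
    using U openin_subset [OF U] openin_trans_full by (fastforce simp: Int_absorb1)
qed

lemma chart_cube_in_open:
  assumes U: "openin X U" and W: "openin (Euclidean_space n) W"
    and \<eta>: "homeomorphic_map (subtopology X U) (subtopology (Euclidean_space n) W) \<eta>"
    and O': "openin X O'" "O' \<subseteq> U" "x \<in> O'"
  obtains r where "r > 0" "ebox n (\<lambda>i. \<eta> x i - r) (\<lambda>i. \<eta> x i + r) \<subseteq> W"
    "{z \<in> U. \<eta> z \<in> ebox n (\<lambda>i. \<eta> x i - r) (\<lambda>i. \<eta> x i + r)} \<subseteq> O'"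
proof -
  let ?E = "Euclidean_space n"
  have top: "topspace (subtopology X U) = U" "topspace (subtopology ?E W) = W"
    using openin_subset [OF U] openin_subset [OF W] by auto
  have inj: "inj_on \<eta> U" and im: "\<eta> ` U = W"
    using homeomorphic_imp_injective_map [OF \<eta>] homeomorphic_imp_surjective_map [OF \<eta>] top by simp_all
  have "openin (subtopology X U) O'" using O' U by (simp add: openin_open_subtopology)
  then have "openin (subtopology ?E W) (\<eta> ` O')"
    using homeomorphic_map_openness_eq [OF \<eta>] top by (metis openin_subset)
  then have "openin ?E (\<eta> ` O')" using W openin_trans_full by blast
  then obtain r where r: "r > 0" "ebox n (\<lambda>i. \<eta> x i - r) (\<lambda>i. \<eta> x i + r) \<subseteq> \<eta> ` O'"
    using Euclidean_cube_in_open [of n _ "\<eta> x"] O'(3) by (metis imageI)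
  show thesis
  proof
    show "ebox n (\<lambda>i. \<eta> x i - r) (\<lambda>i. \<eta> x i + r) \<subseteq> W"
      using r(2) im O'(2) by blast
    show "{z \<in> U. \<eta> z \<in> ebox n (\<lambda>i. \<eta> x i - r) (\<lambda>i. \<eta> x i + r)} \<subseteq> O'"
      using r(2) inj O'(2) by (auto simp: inj_on_def subset_iff image_iff)
  qed (rule r)
qed

text \<open>Detection has been established for finite unions of boxes, so \<open>K\<close> is
  thickened to one: open cubes cover \<open>K\<close>, and the corresponding closed cubes still lie
  in \<open>O'\<close>.\<close>

lemma chart_compact_cover:
  assumes n: "n \<ge> 1" and X: "Hausdorff_space X"
    and U: "openin X U" and W: "openin (Euclidean_space n) W"
    and \<eta>: "homeomorphic_map (subtopology X U) (subtopology (Euclidean_space n) W) \<eta>"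
    and K: "compactin X K" "K \<subseteq> O'" and O': "openin X O'" "O' \<subseteq> U"
  obtains D where "K \<subseteq> D" "D \<subseteq> O'" "compactin X D" "point_detected n X D"
proof -
  let ?E = "Euclidean_space n"
  have top: "topspace (subtopology X U) = U"
    using openin_subset [OF U] by auto
  have cont: "continuous_map (subtopology X U) ?E \<eta>"
    using homeomorphic_imp_continuous_map [OF \<eta>] continuous_map_into_fulltopology by blast
  have "\<forall>x\<in>K. \<exists>r. r > 0 \<and> ebox n (\<lambda>i. \<eta> x i - r) (\<lambda>i. \<eta> x i + r) \<subseteq> W \<and>
      {z \<in> U. \<eta> z \<in> ebox n (\<lambda>i. \<eta> x i - r) (\<lambda>i. \<eta> x i + r)} \<subseteq> O'"
  proof
    fix x assume "x \<in> K"
    show "\<exists>r. r > 0 \<and> ebox n (\<lambda>i. \<eta> x i - r) (\<lambda>i. \<eta> x i + r) \<subseteq> W \<and>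
        {z \<in> U. \<eta> z \<in> ebox n (\<lambda>i. \<eta> x i - r) (\<lambda>i. \<eta> x i + r)} \<subseteq> O'"
      by (rule chart_cube_in_open [OF U W \<eta> O' subsetD [OF K(2) \<open>x \<in> K\<close>]]) blast
  qed
  from bchoice [OF this] obtain r where r: "\<forall>x\<in>K. r x > 0 \<and>
      ebox n (\<lambda>i. \<eta> x i - r x) (\<lambda>i. \<eta> x i + r x) \<subseteq> W \<and>
      {z \<in> U. \<eta> z \<in> ebox n (\<lambda>i. \<eta> x i - r x) (\<lambda>i. \<eta> x i + r x)} \<subseteq> O'" ..
  define V where "V x = {z \<in> U. \<eta> z \<in> {v \<in> topspace ?E. \<forall>i<n. \<bar>v i - \<eta> x i\<bar> < r x}}" for x
  have oV: "openin X (V x)" for x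
    unfolding V_def by (rule chart_preimage_open [OF U cont openin_Euclidean_cube])
  have "K \<subseteq> \<Union>(V ` K)"
  proof
    fix x assume "x \<in> K"
    then have "x \<in> U" using K O' by auto
    then have "\<eta> x \<in> topspace ?E" using cont top by (auto simp: continuous_map_def)
    then have "x \<in> V x" using \<open>x \<in> U\<close> r \<open>x \<in> K\<close> by (auto simp: V_def)
    then show "x \<in> \<Union>(V ` K)" using \<open>x \<in> K\<close> by auto
  qed
  then obtain \<F> where "finite \<F>" "\<F> \<subseteq> V ` K" "K \<subseteq> \<Union>\<F>"
    using compactinD [OF K(1), of "V ` K"] oV by auto
  then obtain F where F: "finite F" "F \<subseteq> K" "K \<subseteq> \<Union>(V ` F)"
    using finite_subset_image [of \<F> V K] by auto
  define \<B> where "\<B> = (\<lambda>x. ebox n (\<lambda>i. \<eta> x i - r x) (\<lambda>i. \<eta> x i + r x)) ` F"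
  have \<B>: "finite \<B>" "\<B> \<subseteq> range (case_prod (ebox n))"
    using F by (auto simp: \<B>_def)
  have BW: "\<Union>\<B> \<subseteq> W" using r F(2) by (fastforce simp: \<B>_def)
  have cB: "compactin ?E (\<Union>\<B>)"
    using \<B> by (intro compactin_Union) (auto simp: \<B>_def compactin_ebox)
  let ?D = "{x \<in> U. \<eta> x \<in> \<Union>\<B>}"
  note D = chart_preimage_ebox [OF U W X \<eta> cB BW]
  show thesis
  proof
    show "K \<subseteq> ?D"
    proof
      fix z assume "z \<in> K"
      then obtain x where "x \<in> F" "z \<in> V x" using F by auto
      then have "\<eta> z \<in> ebox n (\<lambda>i. \<eta> x i - r x) (\<lambda>i. \<eta> x i + r x)"
        by (fastforce simp: V_def ebox_def abs_less_iff)
      then show "z \<in> ?D" using \<open>x \<in> F\<close> \<open>z \<in> V x\<close> by (auto simp: V_def \<B>_def)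
    qed
    show "?D \<subseteq> O'"
      using r F(2) by (fastforce simp: \<B>_def)
    show "compactin X ?D" by (rule D)
    have cl: "closedin X ?D" "closedin ?E (\<eta> ` ?D)"
      using D X cB by (simp_all add: compactin_imp_closedin Hausdorff_Euclidean_space)
    have "point_detected n ?E (\<eta> ` ?D)"
      unfolding D(2) by (rule point_detected_ebox_Union [OF n \<B>])
    then show "point_detected n X ?D"
      by (intro point_detected_chart [OF X Hausdorff_Euclidean_space U W \<eta> _ cl]) auto
  qed
qed

lemma chart_cube:
  assumes n: "n \<ge> 1" and X: "Hausdorff_space X"
    and U: "openin X U" and W: "openin (Euclidean_space n) W"
    and \<eta>: "homeomorphic_map (subtopology X U) (subtopology (Euclidean_space n) W) \<eta>"
    and D: "ebox n a b \<subseteq> W"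
  shows "compactin X {x \<in> U. \<eta> x \<in> ebox n a b}" "point_faithful n X {x \<in> U. \<eta> x \<in> ebox n a b}"
proof -
  note D = chart_preimage_ebox [OF U W X \<eta> compactin_ebox D]
  show "compactin X {x \<in> U. \<eta> x \<in> ebox n a b}" by (rule D)
  let ?D = "{x \<in> U. \<eta> x \<in> ebox n a b}"
  have cl: "closedin X ?D" "closedin (Euclidean_space n) (\<eta> ` ?D)"
    using D X by (simp_all add: compactin_imp_closedin closedin_ebox)
  have "point_faithful n (Euclidean_space n) (\<eta> ` ?D)"
    unfolding D(2) by (rule point_faithful_ebox [OF n])
  then show "point_faithful n X ?D"
    by (intro point_faithful_chart [OF X Hausdorff_Euclidean_space U W \<eta> _ cl]) auto
qed

text \<open>\<open>D\<close> is a closed cube in a chart and \<open>V\<close> its open interior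
  cube. This gives compact faithful neighbourhoods inside any given open set.\<close>

lemma manifold_cell:
  assumes n: "n \<ge> 1" and X: "Hausdorff_space X" "locally_Euclidean_space n X"
    and x: "openin X O'" "x \<in> O'"
  obtains V D where "openin X V" "x \<in> V" "V \<subseteq> D" "D \<subseteq> O'" "compactin X D" "point_faithful n X D"
proof -
  have "x \<in> topspace X" using x openin_subset by blast
  then obtain U W \<eta> where U: "openin X U" "x \<in> U" and W: "openin (Euclidean_space n) W"
    and \<eta>: "homeomorphic_map (subtopology X U) (subtopology (Euclidean_space n) W) \<eta>"
    using locally_Euclidean_chart [OF X(2)] by metis
  let ?E = "Euclidean_space n"
  have top: "topspace (subtopology X U) = U"
    using openin_subset [OF U(1)] by auto
  have cont: "continuous_map (subtopology X U) ?E \<eta>"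
    using homeomorphic_imp_continuous_map [OF \<eta>] continuous_map_into_fulltopology by blast
  have O'U: "openin X (O' \<inter> U)" "O' \<inter> U \<subseteq> U" "x \<in> O' \<inter> U" using x U by auto
  obtain r where r: "r > 0" "ebox n (\<lambda>i. \<eta> x i - r) (\<lambda>i. \<eta> x i + r) \<subseteq> W"
    "{z \<in> U. \<eta> z \<in> ebox n (\<lambda>i. \<eta> x i - r) (\<lambda>i. \<eta> x i + r)} \<subseteq> O' \<inter> U"
    by (rule chart_cube_in_open [OF U(1) W \<eta> O'U])
  show thesis
  proof
    show "openin X {z \<in> U. \<eta> z \<in> {v \<in> topspace ?E. \<forall>i<n. \<bar>v i - \<eta> x i\<bar> < r}}"
      by (rule chart_preimage_open [OF U(1) cont openin_Euclidean_cube])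
    show "x \<in> {z \<in> U. \<eta> z \<in> {v \<in> topspace ?E. \<forall>i<n. \<bar>v i - \<eta> x i\<bar> < r}}"
      using U(2) r(1) cont top by (auto simp: continuous_map_def)
    show "{z \<in> U. \<eta> z \<in> {v \<in> topspace ?E. \<forall>i<n. \<bar>v i - \<eta> x i\<bar> < r}}
      \<subseteq> {z \<in> U. \<eta> z \<in> ebox n (\<lambda>i. \<eta> x i - r) (\<lambda>i. \<eta> x i + r)}"
      by (fastforce simp: ebox_def abs_less_iff)
    show "{z \<in> U. \<eta> z \<in> ebox n (\<lambda>i. \<eta> x i - r) (\<lambda>i. \<eta> x i + r)} \<subseteq> O'"
      using r(3) by blast
  qed (rule chart_cube [OF n X(1) U(1) W \<eta> r(2)])+
qed

lemma local_homology_cyclic: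
  assumes X: "Hausdorff_space X" "locally_Euclidean_space n X" and x: "x \<in> topspace X"
  shows "supp_homology (int n) X {x} \<cong> integer_group"
proof -
  obtain U W \<eta> where U: "openin X U" "x \<in> U" and W: "openin (Euclidean_space n) W"
    and \<eta>: "homeomorphic_map (subtopology X U) (subtopology (Euclidean_space n) W) \<eta>"
    using locally_Euclidean_chart [OF X(2) x] by metis
  have \<eta>x: "\<eta> x \<in> topspace (Euclidean_space n)"
    using homeomorphic_imp_continuous_map [OF \<eta>] U x by (auto simp: continuous_map_def)
  have "closedin X {x}" "closedin (Euclidean_space n) (\<eta> ` {x})"
    using X x \<eta>x by (simp_all add: closedin_Hausdorff_sing_eq Hausdorff_Euclidean_space)
  note isos = chart_supp_iso [OF U(1) W \<eta> _ this, of "int n"]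
  have "supp_homology (int n) X {x} \<cong> relative_homology_group (int n) (subtopology X U) (U - {x})"
    by (rule group.iso_sym [OF _ is_isoI [OF isos(1)]]) (use U(2) in auto)
  also have "\<dots> \<cong> supp_homology (int n) (Euclidean_space n) {\<eta> x}"
    using is_isoI [OF isos(2)] U(2) by simp
  also have "\<dots> \<cong> integer_group"
    by (rule supp_homology_Euclidean_point_cyclic [OF \<eta>x])
  finally show ?thesis .
qed

lemma orientation_ex_int_pow:
  assumes x: "x \<in> topspace X" and \<omega>: "orientation n X \<omega>"
    and "c \<in> carrier (local_homology_group n X x)"
  obtains k :: int where "c = \<omega> x [^]\<^bsub>local_homology_group n X x\<^esub> k"
proof -
  have \<omega>x: "\<omega> x \<in> carrier (local_homology_group n X x)"
    "generate (local_homology_group n X x) {\<omega> x} = carrier (local_homology_group n X x)"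
    using \<omega> x by (auto simp: orientation_def)
  then have "c \<in> {\<omega> x [^]\<^bsub>local_homology_group n X x\<^esub> k | k::int. k \<in> UNIV}"
    using assms(3) by (simp add: group.generate_pow)
  then show thesis using that by auto
qed

text \<open>The local group is infinite cyclic, so an isomorphism to the integers sends the
  generator to a divisor of 1, in particular not to 0.\<close>

lemma orientation_int_pow_inject:
  assumes X: "Hausdorff_space X" "locally_Euclidean_space n X" and x: "x \<in> topspace X"
    and \<omega>: "orientation n X \<omega>"
  shows "\<omega> x [^]\<^bsub>local_homology_group n X x\<^esub> (j::int) = \<omega> x [^]\<^bsub>local_homology_group n X x\<^esub> (k::int)
         \<longleftrightarrow> j = k"
proof
  let ?G = "local_homology_group n X x"
  assume eq: "\<omega> x [^]\<^bsub>?G\<^esub> j = \<omega> x [^]\<^bsub>?G\<^esub> k"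
  obtain h where h: "h \<in> iso ?G integer_group"
    using local_homology_cyclic [OF X x] by (auto simp: is_iso_def)
  have \<omega>x: "\<omega> x \<in> carrier ?G" "generate ?G {\<omega> x} = carrier ?G"
    using \<omega> x by (auto simp: orientation_def)
  have pow: "h (\<omega> x [^]\<^bsub>?G\<^esub> i) = i * h (\<omega> x)" for i :: int
    using hom_int_pow [OF iso_imp_homomorphism [OF h] \<omega>x(1)] by simp
  obtain c where "c \<in> carrier ?G" "h c = 1"
    using iso_ex_preimage [OF h, of 1] by auto
  moreover then obtain i :: int where "c = \<omega> x [^]\<^bsub>?G\<^esub> i"
    using orientation_ex_int_pow [OF x \<omega>] by blast
  ultimately have "i * h (\<omega> x) = 1" using pow by metis
  then have "h (\<omega> x) \<noteq> 0" by auto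
  moreover have "j * h (\<omega> x) = k * h (\<omega> x)" using pow eq by metis
  ultimately show "j = k" by simp
qed simp

section \<open>Degree of a map over a point\<close>

locale oriented_map =
  fixes n :: nat and M :: "'a topology" and \<alpha> :: "'a \<Rightarrow> 'a chain set"
    and N :: "'b topology" and \<beta> :: "'b \<Rightarrow> 'b chain set" and f :: "'a \<Rightarrow> 'b"
  assumes n: "n \<ge> 1"
    and M: "Hausdorff_space M" "locally_Euclidean_space n M" "orientation n M \<alpha>"
    and N: "Hausdorff_space N" "locally_Euclidean_space n N" "orientation n N \<beta>"
    and f: "continuous_map M N f"

text \<open>The definition of an orientation provides such a class around every point. One such
  \<open>G\<close> is enough for each local argument below.\<close>

locale local_class = oriented_map +
  fixes G :: "'a set" and \<mu> :: "'a chain set"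
  assumes G: "openin M G"
    and \<mu>: "\<mu> \<in> carrier (supp_homology (int n) M G)"
      "\<And>p. p \<in> G \<Longrightarrow> supp_restrict (int n) M G {p} \<mu> = \<alpha> p"
begin

section \<open>Orientation classes of open sets along closed subsets\<close>

lemma f_top: "p \<in> topspace M \<Longrightarrow> f p \<in> topspace N"
  using f by (auto simp: continuous_map_def)

lemma f_sub: "continuous_map (subtopology M Q) N f"
  by (simp add: continuous_map_from_subtopology f)

text \<open>The orientation class of the open set \<open>Q\<close> along \<open>C\<close>, living in
  H_n(Q, Q - C). For admissible pairs, excision makes the choice exist and be unique.\<close>

definition fclass :: "'a set \<Rightarrow> 'a set \<Rightarrow> 'a chain set" where
  "fclass Q C = (SOME c. c \<in> carrier (relative_homology_group (int n) (subtopology M Q) (Q - C)) \<and>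
     hom_induced (int n) (subtopology M Q) (Q - C) M (topspace M - C) id c = supp_restrict (int n) M G C \<mu>)"

definition admissible :: "'a set \<Rightarrow> 'a set \<Rightarrow> bool" where
  "admissible Q C \<longleftrightarrow> openin M Q \<and> Q \<subseteq> G \<and> closedin M C \<and> C \<subseteq> Q"

lemma admissible_subset: "admissible Q C \<Longrightarrow> Q \<subseteq> topspace M" "admissible Q C \<Longrightarrow> C \<subseteq> G"
  unfolding admissible_def using openin_subset by blast+

lemma admissible_iso:
  assumes "admissible Q C"
  shows "hom_induced (int n) (subtopology M Q) (Q - C) M (topspace M - C) id
    \<in> iso (relative_homology_group (int n) (subtopology M Q) (Q - C)) (supp_homology (int n) M C)"
  using assms by (intro excision_supp) (auto simp: admissible_def)

lemma fclass:
  assumes "admissible Q C"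
  shows "fclass Q C \<in> carrier (relative_homology_group (int n) (subtopology M Q) (Q - C))"
    and "hom_induced (int n) (subtopology M Q) (Q - C) M (topspace M - C) id (fclass Q C)
       = supp_restrict (int n) M G C \<mu>"
proof -
  have "\<exists>c. c \<in> carrier (relative_homology_group (int n) (subtopology M Q) (Q - C)) \<and>
     hom_induced (int n) (subtopology M Q) (Q - C) M (topspace M - C) id c = supp_restrict (int n) M G C \<mu>"
    using iso_ex_preimage [OF admissible_iso [OF assms] hom_induced_carrier] by metis
  from someI_ex [OF this]
  show "fclass Q C \<in> carrier (relative_homology_group (int n) (subtopology M Q) (Q - C))"
    and "hom_induced (int n) (subtopology M Q) (Q - C) M (topspace M - C) id (fclass Q C)
       = supp_restrict (int n) M G C \<mu>"
    by (simp_all add: fclass_def)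
qed

lemma fclass_unique:
  assumes "admissible Q C" "c \<in> carrier (relative_homology_group (int n) (subtopology M Q) (Q - C))"
    and "hom_induced (int n) (subtopology M Q) (Q - C) M (topspace M - C) id c
       = supp_restrict (int n) M G C \<mu>"
  shows "c = fclass Q C"
proof -
  have "inj_on (hom_induced (int n) (subtopology M Q) (Q - C) M (topspace M - C) id)
      (carrier (relative_homology_group (int n) (subtopology M Q) (Q - C)))"
    using admissible_iso [OF assms(1)] by (simp add: iso_iff)
  then show ?thesis
    by (rule inj_onD) (use assms fclass [OF assms(1)] in simp_all)
qed

lemma fclass_natural:
  assumes "admissible Q' C'" "admissible Q C" "Q' \<subseteq> Q" "C \<subseteq> C'"
  shows "hom_induced (int n) (subtopology M Q') (Q' - C') (subtopology M Q) (Q - C) id (fclass Q' C')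
       = fclass Q C"
proof (rule fclass_unique [OF assms(2) hom_induced_carrier])
  have QM: "Q \<subseteq> topspace M" and CG: "C' \<subseteq> G"
    using assms admissible_subset by blast+
  have cont: "continuous_map (subtopology M Q') (subtopology M Q) id"
    using assms(3) by (auto simp: continuous_map_in_subtopology continuous_map_from_subtopology)
  have "hom_induced (int n) (subtopology M Q) (Q - C) M (topspace M - C) id
         (hom_induced (int n) (subtopology M Q') (Q' - C') (subtopology M Q) (Q - C) id (fclass Q' C'))
      = hom_induced (int n) (subtopology M Q') (Q' - C') M (topspace M - C) id (fclass Q' C')"
    using cont assms(3,4) QM
    by (subst hom_induced_compose') (auto simp: continuous_map_from_subtopology)
  also have "\<dots> = supp_restrict (int n) M C' C
      (hom_induced (int n) (subtopology M Q') (Q' - C') M (topspace M - C') id (fclass Q' C'))"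
    using assms(3,4) QM by (subst hom_induced_compose') (auto simp: continuous_map_from_subtopology)
  also have "\<dots> = supp_restrict (int n) M G C \<mu>"
    using fclass(2) [OF assms(1)] supp_restrict_restrict [OF CG assms(4)] by simp
  finally show "hom_induced (int n) (subtopology M Q) (Q - C) M (topspace M - C) id
         (hom_induced (int n) (subtopology M Q') (Q' - C') (subtopology M Q) (Q - C) id (fclass Q' C'))
     = supp_restrict (int n) M G C \<mu>" .
qed

lemma fclass_point:
  assumes "admissible Q C" "p \<in> C"
  shows "hom_induced (int n) (subtopology M Q) (Q - C) M (topspace M - {p}) id (fclass Q C) = \<alpha> p"
proof -
  have QM: "Q \<subseteq> topspace M" and CG: "C \<subseteq> G"
    using assms admissible_subset by blast+
  have "hom_induced (int n) (subtopology M Q) (Q - C) M (topspace M - {p}) id (fclass Q C)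
     = supp_restrict (int n) M C {p} (hom_induced (int n) (subtopology M Q) (Q - C) M (topspace M - C) id (fclass Q C))"
    using assms QM by (subst hom_induced_compose') (auto simp: continuous_map_from_subtopology)
  also have "\<dots> = supp_restrict (int n) M G {p} \<mu>"
    using fclass(2) [OF assms(1)] supp_restrict_restrict [OF CG, of "{p}"] assms(2) by simp
  finally show ?thesis using \<mu>(2) assms(2) CG by auto
qed

text \<open>The map factors through H_n(Q, Q) = 0. Outside the carrier, the default value of
  \<open>hom_induced\<close> is the unit anyway.\<close>

lemma fclass_disjoint:
  assumes "admissible Q C" "closedin M C'" "C' \<inter> Q = {}"
  shows "hom_induced (int n) (subtopology M Q) (Q - C) M (topspace M - C') id c
       = \<one>\<^bsub>supp_homology (int n) M C'\<^esub>"
proof (cases "c \<in> carrier (relative_homology_group (int n) (subtopology M Q) (Q - C))")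
  case True
  have QM: "Q \<subseteq> topspace M" and CG: "C \<subseteq> G"
    using assms admissible_subset by blast+
  have "hom_induced (int n) (subtopology M Q) Q M (topspace M - C') id
         (hom_induced (int n) (subtopology M Q) (Q - C) (subtopology M Q) Q id c)
    = hom_induced (int n) (subtopology M Q) (Q - C) M (topspace M - C') id c"
    using assms QM by (subst hom_induced_compose') (auto simp: continuous_map_from_subtopology)
  moreover have "trivial_group (relative_homology_group (int n) (subtopology M Q) Q)"
    using trivial_relative_homology_group_topspace [of "int n" "subtopology M Q"] QM
    by (simp add: Int_absorb1)
  then have "hom_induced (int n) (subtopology M Q) (Q - C) (subtopology M Q) Q id c
     = \<one>\<^bsub>relative_homology_group (int n) (subtopology M Q) Q\<^esub>"
    by (rule trivial_group_oneD [OF _ hom_induced_carrier])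
  ultimately show ?thesis by simp
qed (simp add: hom_induced_default)

text \<open>In H_n(M, M - C) the two sides can be compared along \<open>C\<^sub>1\<close> and
  \<open>C\<^sub>2\<close> separately, by Mayer-Vietoris with empty intersection. Each summand
  restricts correctly to its own part and, by \<open>fclass_disjoint\<close>, trivially to the other
  one.\<close>

lemma fclass_Un:
  assumes 1: "admissible Q\<^sub>1 C\<^sub>1" and 2: "admissible Q\<^sub>2 C\<^sub>2" and disj: "Q\<^sub>1 \<inter> Q\<^sub>2 = {}"
  defines "Q \<equiv> Q\<^sub>1 \<union> Q\<^sub>2" and "C \<equiv> C\<^sub>1 \<union> C\<^sub>2"
  shows "fclass Q C
       = hom_induced (int n) (subtopology M Q\<^sub>1) (Q\<^sub>1 - C\<^sub>1) (subtopology M Q) (Q - C) id (fclass Q\<^sub>1 C\<^sub>1)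
         \<otimes>\<^bsub>relative_homology_group (int n) (subtopology M Q) (Q - C)\<^esub>
         hom_induced (int n) (subtopology M Q\<^sub>2) (Q\<^sub>2 - C\<^sub>2) (subtopology M Q) (Q - C) id (fclass Q\<^sub>2 C\<^sub>2)"
    (is "_ = ?i1 \<otimes>\<^bsub>?R\<^esub> ?i2")
proof -
  let ?H = "supp_homology (int n) M C"
  let ?j = "hom_induced (int n) (subtopology M Q) (Q - C) M (topspace M - C) id"
  have admissible: "admissible Q C"
    using 1 2 by (auto simp: admissible_def Q_def C_def openin_Un closedin_Un)
  have CG: "C \<subseteq> G" and QM: "Q \<subseteq> topspace M"
    using admissible admissible_subset by blast+
  have cl: "closedin M C\<^sub>1" "closedin M C\<^sub>2" using 1 2 by (auto simp: admissible_def)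
  let ?m = "supp_restrict (int n) M G C \<mu>"
  let ?j1 = "hom_induced (int n) (subtopology M Q\<^sub>1) (Q\<^sub>1 - C\<^sub>1) M (topspace M - C) id (fclass Q\<^sub>1 C\<^sub>1)"
  let ?j2 = "hom_induced (int n) (subtopology M Q\<^sub>2) (Q\<^sub>2 - C\<^sub>2) M (topspace M - C) id (fclass Q\<^sub>2 C\<^sub>2)"
  have sub: "Q\<^sub>1 - C\<^sub>1 \<subseteq> Q - C" "Q\<^sub>2 - C\<^sub>2 \<subseteq> Q - C"
    using disj 1 2 by (auto simp: Q_def C_def admissible_def)
  have j1: "?j ?i1 = ?j1" and j2: "?j ?i2 = ?j2"
    using sub QM by (subst hom_induced_compose'; fastforce simp: Q_def continuous_map_in_subtopology continuous_map_from_subtopology)+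
  have [simp]: "?j1 \<in> carrier ?H" "?j2 \<in> carrier ?H" "?m \<in> carrier ?H"
    by (rule hom_induced_carrier)+
  interpret H: comm_group ?H by simp
  have r1: "supp_restrict (int n) M C C\<^sub>1 ?j1 = supp_restrict (int n) M G C\<^sub>1 \<mu>"
    "supp_restrict (int n) M C C\<^sub>2 ?j1 = \<one>\<^bsub>supp_homology (int n) M C\<^sub>2\<^esub>"
  proof -
    have *: "supp_restrict (int n) M C D ?j1
        = hom_induced (int n) (subtopology M Q\<^sub>1) (Q\<^sub>1 - C\<^sub>1) M (topspace M - D) id (fclass Q\<^sub>1 C\<^sub>1)" if "D \<subseteq> C" for D
      using sub QM that by (subst hom_induced_compose') (auto simp: continuous_map_from_subtopology)
    show "supp_restrict (int n) M C C\<^sub>1 ?j1 = supp_restrict (int n) M G C\<^sub>1 \<mu>"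
      using * [of C\<^sub>1] fclass(2) [OF 1] by (simp add: C_def)
    have "C\<^sub>2 \<inter> Q\<^sub>1 = {}" using 2 disj by (auto simp: admissible_def)
    from fclass_disjoint [OF 1 cl(2) this]
    show "supp_restrict (int n) M C C\<^sub>2 ?j1 = \<one>\<^bsub>supp_homology (int n) M C\<^sub>2\<^esub>"
      using * [of C\<^sub>2] by (simp add: C_def)
  qed
  have r2: "supp_restrict (int n) M C C\<^sub>2 ?j2 = supp_restrict (int n) M G C\<^sub>2 \<mu>"
    "supp_restrict (int n) M C C\<^sub>1 ?j2 = \<one>\<^bsub>supp_homology (int n) M C\<^sub>1\<^esub>"
  proof -
    have *: "supp_restrict (int n) M C D ?j2
        = hom_induced (int n) (subtopology M Q\<^sub>2) (Q\<^sub>2 - C\<^sub>2) M (topspace M - D) id (fclass Q\<^sub>2 C\<^sub>2)" if "D \<subseteq> C" for D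
      using sub QM that by (subst hom_induced_compose') (auto simp: continuous_map_from_subtopology)
    show "supp_restrict (int n) M C C\<^sub>2 ?j2 = supp_restrict (int n) M G C\<^sub>2 \<mu>"
      using * [of C\<^sub>2] fclass(2) [OF 2] by (simp add: C_def)
    have "C\<^sub>1 \<inter> Q\<^sub>2 = {}" using 1 disj by (auto simp: admissible_def)
    from fclass_disjoint [OF 2 cl(1) this]
    show "supp_restrict (int n) M C C\<^sub>1 ?j2 = \<one>\<^bsub>supp_homology (int n) M C\<^sub>1\<^esub>"
      using * [of C\<^sub>1] by (simp add: C_def)
  qed
  have rm: "supp_restrict (int n) M C D ?m = supp_restrict (int n) M G D \<mu>" if "D \<subseteq> C" for D
    using supp_restrict_restrict [OF CG that] by simp
  have rr: "supp_restrict (int n) M C D (?j1 \<otimes>\<^bsub>?H\<^esub> ?j2 \<otimes>\<^bsub>?H\<^esub> inv\<^bsub>?H\<^esub> ?m)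
     = supp_restrict (int n) M C D ?j1 \<otimes>\<^bsub>supp_homology (int n) M D\<^esub>
       supp_restrict (int n) M C D ?j2 \<otimes>\<^bsub>supp_homology (int n) M D\<^esub>
       inv\<^bsub>supp_homology (int n) M D\<^esub> supp_restrict (int n) M G D \<mu>" if "D \<subseteq> C" for D
    using rm [OF that] by (simp add: hom_induced_mult hom_induced_inv)
  have "?j1 \<otimes>\<^bsub>?H\<^esub> ?j2 \<otimes>\<^bsub>?H\<^esub> inv\<^bsub>?H\<^esub> ?m = \<one>\<^bsub>?H\<^esub>"
    unfolding C_def
  proof (rule Mayer_Vietoris_supp [OF cl], unfold C_def [symmetric])
    have "C\<^sub>1 \<inter> C\<^sub>2 = {}" using 1 2 disj by (auto simp: admissible_def)
    then show "trivial_group (supp_homology (int n + 1) M (C\<^sub>1 \<inter> C\<^sub>2))"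
      by (simp only: supp_homology_empty)
    show "?j1 \<otimes>\<^bsub>?H\<^esub> ?j2 \<otimes>\<^bsub>?H\<^esub> inv\<^bsub>?H\<^esub> ?m \<in> carrier ?H" by simp
    interpret H1: comm_group "supp_homology (int n) M C\<^sub>1" by simp
    interpret H2: comm_group "supp_homology (int n) M C\<^sub>2" by simp
    have [simp]: "supp_restrict (int n) M G D \<mu> \<in> carrier (supp_homology (int n) M D)" for D
      by (rule hom_induced_carrier)
    show "supp_restrict (int n) M C C\<^sub>1 (?j1 \<otimes>\<^bsub>?H\<^esub> ?j2 \<otimes>\<^bsub>?H\<^esub> inv\<^bsub>?H\<^esub> ?m) = \<one>\<^bsub>supp_homology (int n) M C\<^sub>1\<^esub>"
      using rr [of C\<^sub>1] r1(1) r2(2) by (simp add: C_def)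
    show "supp_restrict (int n) M C C\<^sub>2 (?j1 \<otimes>\<^bsub>?H\<^esub> ?j2 \<otimes>\<^bsub>?H\<^esub> inv\<^bsub>?H\<^esub> ?m) = \<one>\<^bsub>supp_homology (int n) M C\<^sub>2\<^esub>"
      using rr [of C\<^sub>2] r1(2) r2(1) by (simp add: C_def)
  qed
  then have "?j1 \<otimes>\<^bsub>?H\<^esub> ?j2 = ?m"
    by (metis H.inv_closed H.inv_equality H.inv_inv H.m_closed \<open>?j1 \<in> carrier ?H\<close> \<open>?j2 \<in> carrier ?H\<close> \<open>?m \<in> carrier ?H\<close>)
  moreover have "?j (?i1 \<otimes>\<^bsub>?R\<^esub> ?i2) = ?j ?i1 \<otimes>\<^bsub>?H\<^esub> ?j ?i2"
    by (rule hom_induced_mult [OF hom_induced_carrier hom_induced_carrier])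
  ultimately have "?j (?i1 \<otimes>\<^bsub>?R\<^esub> ?i2) = ?m"
    using j1 j2 by simp
  moreover have "?i1 \<otimes>\<^bsub>?R\<^esub> ?i2 \<in> carrier ?R"
    by (intro monoid.m_closed group.is_monoid hom_induced_carrier) simp
  ultimately show ?thesis
    using fclass_unique [OF admissible] by metis
qed

section \<open>Pushing orientation classes forward: the degree over a point\<close>

abbreviation admissible_fibre :: "'a set \<Rightarrow> 'b set \<Rightarrow> bool" where
  "admissible_fibre Q B \<equiv> admissible Q (Q \<inter> f -` B)"

text \<open>Its intended use is with \<open>admissible_fibre Q B\<close>: closedness of the preimage
  in \<open>M\<close> is the weak form of properness that keeps preimages of \<open>B\<close> from
  escaping through the edge of \<open>Q\<close>.\<close>

definition push :: "'a set \<Rightarrow> 'b set \<Rightarrow> 'b chain set" where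
  "push Q B = hom_induced (int n) (subtopology M Q) (Q - f -` B) N (topspace N - B) f
     (fclass Q (Q \<inter> f -` B))"

lemma push_carrier: "push Q B \<in> carrier (supp_homology (int n) N B)"
  unfolding push_def by (rule hom_induced_carrier)

lemma f_compl:
  "Q \<subseteq> topspace M \<Longrightarrow> f \<in> (Q - f -` B) \<rightarrow> topspace N - B"
  using f_top by auto

lemma fclass_natural_fibre:
  assumes "admissible_fibre Q' B'" "admissible Q C" "Q' \<subseteq> Q" "C \<subseteq> Q' \<inter> f -` B'"
  shows "hom_induced (int n) (subtopology M Q') (Q' - f -` B') (subtopology M Q) (Q - C) id
    (fclass Q' (Q' \<inter> f -` B')) = fclass Q C"
proof -
  have "Q' - (Q' \<inter> f -` B') = Q' - f -` B'" by auto
  with fclass_natural [OF assms] show ?thesis by simp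
qed

lemma push_natural:
  assumes "admissible_fibre Q B" "admissible Q (Q \<inter> f -` B')" "B' \<subseteq> B"
  shows "supp_restrict (int n) N B B' (push Q B) = push Q B'"
proof -
  have Q: "Q \<subseteq> topspace M" using assms admissible_subset by blast
  have "supp_restrict (int n) N B B' (push Q B)
    = hom_induced (int n) (subtopology M Q) (Q - f -` B) N (topspace N - B') f (fclass Q (Q \<inter> f -` B))"
    unfolding push_def using f_compl [OF Q, of B] assms(3) f_sub
    by (subst hom_induced_compose') auto
  also have "\<dots> = hom_induced (int n) (subtopology M Q) (Q - f -` B') N (topspace N - B') f
      (hom_induced (int n) (subtopology M Q) (Q - f -` B) (subtopology M Q) (Q - f -` B') id (fclass Q (Q \<inter> f -` B)))"
    using f_compl [OF Q, of B'] assms(3) f_sub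
    by (subst hom_induced_compose') auto
  also have "\<dots> = push Q B'"
  proof -
    have "Q - Q \<inter> f -` B' = Q - f -` B'" by auto
    moreover have "Q \<inter> f -` B' \<subseteq> Q \<inter> f -` B" using assms(3) by auto
    ultimately show ?thesis
      using fclass_natural_fibre [OF assms(1,2) subset_refl] by (simp only: push_def)
  qed
  finally show ?thesis .
qed

lemma push_shrink:
  assumes "admissible_fibre Q B" "openin M Q'" "Q' \<subseteq> Q" "Q \<inter> f -` B \<subseteq> Q'"
  shows "push Q' B = push Q B"
proof -
  have Q: "Q \<subseteq> topspace M" using assms admissible_subset by blast
  have eq: "Q' \<inter> f -` B = Q \<inter> f -` B" using assms by auto
  have admissible': "admissible_fibre Q' B"
    using assms unfolding admissible_def eq by auto
  have cont: "continuous_map (subtopology M Q') (subtopology M Q) id"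
    using assms(3) by (auto simp: continuous_map_in_subtopology continuous_map_from_subtopology)
  have "Q - Q \<inter> f -` B = Q - f -` B" by auto
  then have "hom_induced (int n) (subtopology M Q') (Q' - f -` B) (subtopology M Q) (Q - f -` B) id
    (fclass Q' (Q' \<inter> f -` B)) = fclass Q (Q \<inter> f -` B)"
    using fclass_natural_fibre [OF admissible' assms(1,3)] eq by simp
  then have "push Q B = hom_induced (int n) (subtopology M Q) (Q - f -` B) N (topspace N - B) f
    (hom_induced (int n) (subtopology M Q') (Q' - f -` B) (subtopology M Q) (Q - f -` B) id
    (fclass Q' (Q' \<inter> f -` B)))"
    by (simp add: push_def)
  also have "\<dots> = push Q' B"
    unfolding push_def using f_compl [OF Q, of B] assms(3) f_sub cont
    by (subst hom_induced_compose') auto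
  finally show ?thesis by simp
qed

lemma push_Un:
  assumes "admissible_fibre Q\<^sub>1 B" "admissible_fibre Q\<^sub>2 B" "Q\<^sub>1 \<inter> Q\<^sub>2 = {}"
  shows "push (Q\<^sub>1 \<union> Q\<^sub>2) B = push Q\<^sub>1 B \<otimes>\<^bsub>supp_homology (int n) N B\<^esub> push Q\<^sub>2 B"
proof -
  let ?Q = "Q\<^sub>1 \<union> Q\<^sub>2"
  have Q: "Q\<^sub>1 \<subseteq> topspace M" "Q\<^sub>2 \<subseteq> topspace M" "?Q \<subseteq> topspace M"
    using assms admissible_subset by blast+
  have eq: "?Q \<inter> f -` B = (Q\<^sub>1 \<inter> f -` B) \<union> (Q\<^sub>2 \<inter> f -` B)" by auto
  have compl: "?Q - ((Q\<^sub>1 \<inter> f -` B) \<union> (Q\<^sub>2 \<inter> f -` B)) = ?Q - f -` B"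
    "Q\<^sub>1 - Q\<^sub>1 \<inter> f -` B = Q\<^sub>1 - f -` B" "Q\<^sub>2 - Q\<^sub>2 \<inter> f -` B = Q\<^sub>2 - f -` B" by auto
  let ?F = "hom_induced (int n) (subtopology M ?Q) (?Q - f -` B) N (topspace N - B) f"
  let ?i1 = "hom_induced (int n) (subtopology M Q\<^sub>1) (Q\<^sub>1 - f -` B) (subtopology M ?Q) (?Q - f -` B) id (fclass Q\<^sub>1 (Q\<^sub>1 \<inter> f -` B))"
  let ?i2 = "hom_induced (int n) (subtopology M Q\<^sub>2) (Q\<^sub>2 - f -` B) (subtopology M ?Q) (?Q - f -` B) id (fclass Q\<^sub>2 (Q\<^sub>2 \<inter> f -` B))"
  have cont: "continuous_map (subtopology M Q\<^sub>1) (subtopology M ?Q) id" "continuous_map (subtopology M Q\<^sub>2) (subtopology M ?Q) id"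
    by (auto simp: continuous_map_in_subtopology continuous_map_from_subtopology)
  have "push ?Q B = ?F (?i1 \<otimes>\<^bsub>relative_homology_group (int n) (subtopology M ?Q) (?Q - f -` B)\<^esub> ?i2)"
    unfolding push_def eq fclass_Un [OF assms] compl ..
  also have "\<dots> = ?F ?i1 \<otimes>\<^bsub>supp_homology (int n) N B\<^esub> ?F ?i2"
    by (rule hom_induced_mult [OF hom_induced_carrier hom_induced_carrier])
  also have "?F ?i1 = push Q\<^sub>1 B"
    unfolding push_def using f_compl [OF Q(3), of B] f_sub cont
    by (subst hom_induced_compose') auto
  also have "?F ?i2 = push Q\<^sub>2 B"
    unfolding push_def using f_compl [OF Q(3), of B] f_sub cont
    by (subst hom_induced_compose') auto
  finally show ?thesis .
qed

lemma push_empty: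
  assumes "openin M Q" "Q \<subseteq> G" "Q \<inter> f -` B = {}"
  shows "push Q B = \<one>\<^bsub>supp_homology (int n) N B\<^esub>"
proof -
  have admissible: "admissible_fibre Q B" using assms by (auto simp: admissible_def)
  have QM: "Q \<subseteq> topspace M" using assms openin_subset by blast
  have "Q - f -` B = Q" using assms(3) by auto
  moreover have "trivial_group (relative_homology_group (int n) (subtopology M Q) Q)"
    using trivial_relative_homology_group_topspace [of "int n" "subtopology M Q"] QM
    by (simp add: Int_absorb1)
  ultimately have "fclass Q (Q \<inter> f -` B) = \<one>\<^bsub>relative_homology_group (int n) (subtopology M Q) (Q - f -` B)\<^esub>"
    using trivial_group_oneD fclass(1) [OF admissible] by (metis Diff_Int2 Diff_Int_distrib2 Diff_empty assms(3))
  then show ?thesis by (simp add: push_def)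
qed

text \<open>The degree over \<open>y\<close> of \<open>f\<close> restricted to \<open>Q\<close>,
  counting all preimages in \<open>Q\<close> together. The description is proper because \<beta> y
  freely generates the local group.\<close>

definition map_degree :: "'a set \<Rightarrow> 'b \<Rightarrow> int" where
  "map_degree Q y = (THE d. push Q {y} = \<beta> y [^]\<^bsub>local_homology_group n N y\<^esub> d)"

lemma \<beta>_inject:
  "y \<in> topspace N \<Longrightarrow> \<beta> y [^]\<^bsub>local_homology_group n N y\<^esub> (j::int) = \<beta> y [^]\<^bsub>local_homology_group n N y\<^esub> (k::int)
    \<longleftrightarrow> j = k"
  by (rule orientation_int_pow_inject [OF N(1,2) _ N(3)])

lemma \<beta>_carrier: "y \<in> topspace N \<Longrightarrow> \<beta> y \<in> carrier (local_homology_group n N y)"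
  using N(3) by (auto simp: orientation_def)

lemma map_degree_unique:
  assumes "y \<in> topspace N" "push Q {y} = \<beta> y [^]\<^bsub>local_homology_group n N y\<^esub> d"
  shows "map_degree Q y = d"
  unfolding map_degree_def using assms \<beta>_inject [OF assms(1)] by (intro the_equality) auto

lemma push_point:
  assumes "y \<in> topspace N"
  shows "push Q {y} = \<beta> y [^]\<^bsub>local_homology_group n N y\<^esub> map_degree Q y"
  using orientation_ex_int_pow [OF assms N(3) push_carrier] map_degree_unique [OF assms] by metis

lemma map_degree_shrink:
  assumes "admissible_fibre Q {y}" "openin M Q'" "Q' \<subseteq> Q" "Q \<inter> f -` {y} \<subseteq> Q'"
  shows "map_degree Q' y = map_degree Q y"
  using push_shrink [OF assms] by (simp add: map_degree_def)

lemma map_degree_Un: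
  assumes "y \<in> topspace N" "admissible_fibre Q\<^sub>1 {y}" "admissible_fibre Q\<^sub>2 {y}" "Q\<^sub>1 \<inter> Q\<^sub>2 = {}"
  shows "map_degree (Q\<^sub>1 \<union> Q\<^sub>2) y = map_degree Q\<^sub>1 y + map_degree Q\<^sub>2 y"
proof (rule map_degree_unique [OF assms(1)])
  interpret G: group "local_homology_group n N y" by simp
  show "push (Q\<^sub>1 \<union> Q\<^sub>2) {y} = \<beta> y [^]\<^bsub>local_homology_group n N y\<^esub> (map_degree Q\<^sub>1 y + map_degree Q\<^sub>2 y)"
    using push_Un [OF assms(2-4)] assms(1)
    by (simp add: push_point G.int_pow_mult \<beta>_carrier)
qed

lemma map_degree_empty:
  assumes "y \<in> topspace N" "openin M Q" "Q \<subseteq> G" "Q \<inter> f -` {y} = {}"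
  shows "map_degree Q y = 0"
  by (rule map_degree_unique [OF assms(1)]) (simp add: push_empty [OF assms(2-4)])

text \<open>Compare \<open>push Q D\<close> with the multiple of the orientation class of
  \<open>N\<close> along \<open>D\<close> given by the degree over \<open>y\<close>. The quotient
  vanishes at \<open>y\<close>, hence along the faithful set \<open>D\<close>, hence at
  \<open>y'\<close>.\<close>

lemma map_degree_const_cell:
  assumes D: "point_faithful n N D" "closedin M (Q \<inter> f -` D)" "D \<subseteq> topspace N"
    and Q: "openin M Q" "Q \<subseteq> G"
    and H: "D \<subseteq> H" "\<nu> \<in> carrier (supp_homology (int n) N H)"
      "\<And>y. y \<in> H \<Longrightarrow> supp_restrict (int n) N H {y} \<nu> = \<beta> y"
    and y: "y \<in> D" "y' \<in> D"
  shows "map_degree Q y = map_degree Q y'"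
proof -
  let ?A = "supp_homology (int n) N D"
  have admissible: "admissible_fibre Q D" using D Q by (auto simp: admissible_def)
  have admissible': "admissible_fibre Q {z}" if "z \<in> D" for z
  proof -
    have "closedin N {z}" using N(1) D(3) that by (auto simp: closedin_Hausdorff_sing_eq)
    then have "closedin M {x \<in> topspace M. f x \<in> {z}}"
      by (rule closedin_continuous_map_preimage [OF f])
    then have "closedin M ({x \<in> topspace M. f x \<in> {z}} \<inter> (Q \<inter> f -` D))"
      using D(2) by blast
    moreover have "{x \<in> topspace M. f x \<in> {z}} \<inter> (Q \<inter> f -` D) = Q \<inter> f -` {z}"
      using that openin_subset [OF Q(1)] by auto
    ultimately show ?thesis using Q by (auto simp: admissible_def)
  qed
  let ?\<nu> = "supp_restrict (int n) N H D \<nu>"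
  have \<nu>: "?\<nu> \<in> carrier ?A" by (rule hom_induced_carrier)
  have \<nu>z: "supp_restrict (int n) N D {z} ?\<nu> = \<beta> z" if "z \<in> D" for z
    using supp_restrict_restrict [OF H(1), of "{z}"] H(3) [of z] H(1) that by auto
  have pz: "supp_restrict (int n) N D {z} (push Q D) = \<beta> z [^]\<^bsub>local_homology_group n N z\<^esub> map_degree Q z"
    if "z \<in> D" for z
    using push_natural [OF admissible admissible' [OF that]] push_point [of z Q] D(3) that by auto
  interpret A: comm_group ?A by simp
  define c where "c = push Q D \<otimes>\<^bsub>?A\<^esub> inv\<^bsub>?A\<^esub> (?\<nu> [^]\<^bsub>?A\<^esub> map_degree Q y)"
  have c: "c \<in> carrier ?A"
    unfolding c_def using push_carrier \<nu> by (intro A.m_closed A.inv_closed A.int_pow_closed)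
  have cz: "supp_restrict (int n) N D {z} c = \<beta> z [^]\<^bsub>local_homology_group n N z\<^esub> (map_degree Q z - map_degree Q y)"
    if "z \<in> D" for z
  proof -
    interpret Z: comm_group "local_homology_group n N z" by simp
    show ?thesis
      unfolding c_def using push_carrier \<nu> that D(3) \<beta>_carrier
      by (subst hom_induced_mult)
        (auto simp: hom_induced_inv hom_induced_int_pow \<nu>z pz Z.int_pow_diff subset_iff)
  qed
  have "supp_restrict (int n) N D {y} c = \<one>\<^bsub>local_homology_group n N y\<^esub>"
    using cz [OF y(1)] by simp
  then have "c = \<one>\<^bsub>?A\<^esub>"
    by (rule point_faithfulD [OF D(1) y(1) c])
  then have "\<beta> y' [^]\<^bsub>local_homology_group n N y'\<^esub> (map_degree Q y' - map_degree Q y)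
      = \<beta> y' [^]\<^bsub>local_homology_group n N y'\<^esub> (0::int)"
    using cz [OF y(2)] by simp
  then show ?thesis
    using \<beta>_inject [of y' "map_degree Q y' - map_degree Q y" 0] D(3) y(2) by auto
qed

text \<open>The last assumption is properness over \<open>O'\<close>; it is applied to a cell around
  \<open>y\<close> on which the orientation of \<open>N\<close> comes from one class.\<close>

lemma map_degree_locally_const:
  assumes O': "openin N O'" "y \<in> O'" and Q: "openin M Q" "Q \<subseteq> G"
    and cl: "\<And>D. \<lbrakk>compactin N D; D \<subseteq> O'\<rbrakk> \<Longrightarrow> closedin M (Q \<inter> f -` D)"
  shows "\<exists>V. openin N V \<and> y \<in> V \<and> V \<subseteq> O' \<and> (\<forall>y'\<in>V. map_degree Q y' = map_degree Q y)"
proof -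
  have "y \<in> topspace N" using O' openin_subset by blast
  then obtain H \<nu> where H: "openin N H" "y \<in> H" "\<nu> \<in> carrier (supp_homology (int n) N H)"
    "\<And>y. y \<in> H \<Longrightarrow> supp_restrict (int n) N H {y} \<nu> = \<beta> y"
    using N(3) unfolding orientation_def by metis
  have "openin N (O' \<inter> H)" "y \<in> O' \<inter> H" using O' H by auto
  then obtain V D where V: "openin N V" "y \<in> V" "V \<subseteq> D" "D \<subseteq> O' \<inter> H" "compactin N D" "point_faithful n N D"
    using manifold_cell [OF n N(1,2)] by metis
  have "map_degree Q y' = map_degree Q y" if "y' \<in> V" for y'
    by (rule map_degree_const_cell [OF V(6) _ _ Q _ H(3,4)])
      (use V that cl compactin_subset_topspace [OF V(5)] in auto)
  then show ?thesis using V by blast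
qed

lemma map_degree_const:
  assumes O': "openin N O'" "connectedin N O'" and Q: "openin M Q" "Q \<subseteq> G"
    and cl: "\<And>D. \<lbrakk>compactin N D; D \<subseteq> O'\<rbrakk> \<Longrightarrow> closedin M (Q \<inter> f -` D)"
    and y: "y \<in> O'" "y' \<in> O'"
  shows "map_degree Q y = map_degree Q y'"
proof (rule ccontr)
  assume neq: "map_degree Q y \<noteq> map_degree Q y'"
  have op: "openin N {z \<in> O'. P (map_degree Q z)}" for P
  proof (subst openin_subopen, intro ballI)
    fix z assume "z \<in> {z \<in> O'. P (map_degree Q z)}"
    then have z: "z \<in> O'" "P (map_degree Q z)" by auto
    have "\<exists>V. openin N V \<and> z \<in> V \<and> V \<subseteq> O' \<and> (\<forall>y'\<in>V. map_degree Q y' = map_degree Q z)"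
      by (rule map_degree_locally_const [OF O'(1) z(1) Q]) (rule cl)
    then obtain V where "openin N V" "z \<in> V" "V \<subseteq> O'" "\<forall>y'\<in>V. map_degree Q y' = map_degree Q z"
      by blast
    moreover have "P (map_degree Q w)" if "w \<in> V" for w
      using bspec [OF \<open>\<forall>y'\<in>V. map_degree Q y' = map_degree Q z\<close> that] z(2) by metis
    ultimately show "\<exists>T. openin N T \<and> z \<in> T \<and> T \<subseteq> {z \<in> O'. P (map_degree Q z)}"
      by blast
  qed
  show False
  proof (rule connectedinD [OF O'(2) op [of "\<lambda>d. d = map_degree Q y"] op [of "\<lambda>d. d \<noteq> map_degree Q y"]])
    show "{z \<in> O'. map_degree Q z = map_degree Q y} \<inter> O' \<noteq> {}" using y by blast
    have "y' \<in> {z \<in> O'. map_degree Q z \<noteq> map_degree Q y} \<inter> O'" using y neq by simp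
    then show "{z \<in> O'. map_degree Q z \<noteq> map_degree Q y} \<inter> O' \<noteq> {}" by blast
  qed auto
qed

section \<open>Comparison of the degree over a point with the local degree\<close>

lemma admissible_fibre_isolated:
  assumes "openin M Q" "Q \<subseteq> G" "Q \<inter> f -` {y} = {x}"
  shows "admissible_fibre Q {y}"
proof -
  have "x \<in> topspace M" using assms openin_subset by blast
  then show ?thesis
    using assms M(1) by (auto simp: admissible_def closedin_Hausdorff_sing_eq)
qed

text \<open>The neighbourhoods in the definition of the local degree need not be open, so the
  closure of the complement of \<open>V\<close> is kept away from \<open>x\<close> by means of the
  open set \<open>U\<close>.\<close>

lemma excision_neighbourhood:
  assumes "neighbourhood_of M x V"
  shows "hom_induced (int n) (subtopology M V) (V - {x}) M (topspace M - {x}) id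
    \<in> iso (relative_homology_group (int n) (subtopology M V) (V - {x})) (supp_homology (int n) M {x})"
proof -
  obtain U where V: "V \<subseteq> topspace M" and U: "openin M U" "x \<in> U" "U \<subseteq> V"
    using assms by (auto simp: neighbourhood_of_def)
  have "openin M (topspace M - {x})"
    using M(1) U openin_subset by (fastforce simp: closedin_Hausdorff_sing_eq intro: openin_diff)
  then have int: "M interior_of (topspace M - {x}) = topspace M - {x}"
    by (simp add: interior_of_openin)
  have "M closure_of (topspace M - V) \<subseteq> topspace M - U"
    using U by (intro closure_of_minimal) auto
  then have "M closure_of (topspace M - V) \<subseteq> M interior_of (topspace M - {x})"
    using int U(2) by auto
  from homology_excision_axiom [OF this, of "topspace M" "int n"]
  have "hom_induced (int n) (subtopology M (topspace M - (topspace M - V))) (topspace M - {x} - (topspace M - V)) M (topspace M - {x}) id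
    \<in> iso (relative_homology_group (int n) (subtopology M (topspace M - (topspace M - V))) (topspace M - {x} - (topspace M - V))) (supp_homology (int n) M {x})"
    by simp
  moreover have "topspace M - (topspace M - V) = V" "topspace M - {x} - (topspace M - V) = V - {x}"
    using V by auto
  ultimately show ?thesis by simp
qed

text \<open>Both sides come from the smaller open set \<open>W\<close>: the class of
  \<open>V\<close> at \<open>x\<close> is the image of \<open>fclass W {x}\<close>, and shrinking
  \<open>Q\<close> to \<open>W\<close> does not change \<open>push\<close>. As \<open>V\<close> is
  arbitrary, the equation defining the local degree holds for all \<open>V\<close> at once.\<close>

lemma push_orientation_class:
  assumes V: "isolating_neighbourhood M f x V"
    and Q: "openin M Q" "Q \<subseteq> G" "Q \<inter> f -` {f x} = {x}"
  shows "hom_induced (int n) (subtopology M V) (V - {x}) N (topspace N - {f x}) f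
      (orientation_class_in n M \<alpha> V x) = push Q {f x}"
proof -
  have nV: "neighbourhood_of M x V" and iV: "\<And>x'. x' \<in> V - {x} \<Longrightarrow> f x' \<noteq> f x"
    using V by (auto simp: isolating_neighbourhood_def)
  obtain U where VM: "V \<subseteq> topspace M" and U: "openin M U" "x \<in> U" "U \<subseteq> V"
    using nV by (auto simp: neighbourhood_of_def)
  define W where "W = U \<inter> Q"
  have W: "openin M W" "W \<subseteq> V" "W \<subseteq> Q" "W \<subseteq> G" "x \<in> W"
    using U Q by (auto simp: W_def)
  have Wf: "W \<inter> f -` {f x} = {x}" using W Q by auto
  have admW: "admissible_fibre W {f x}"
    by (rule admissible_fibre_isolated [OF W(1,4) Wf])
  have admWx: "admissible W {x}" using admW Wf by simp
  have WM: "W \<subseteq> topspace M" using W openin_subset by blast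
  define a where "a = hom_induced (int n) (subtopology M W) (W - {x}) (subtopology M V) (V - {x}) id (fclass W {x})"
  have cont: "continuous_map (subtopology M W) (subtopology M V) id"
    using W by (auto simp: continuous_map_in_subtopology continuous_map_from_subtopology)
  let ?R = "relative_homology_group (int n) (subtopology M V) (V - {x})"
  let ?j = "hom_induced (int n) (subtopology M V) (V - {x}) M (topspace M - {x}) id"
  have a: "a \<in> carrier ?R" by (simp add: a_def hom_induced_carrier)
  have "?j a = hom_induced (int n) (subtopology M W) (W - {x}) M (topspace M - {x}) id (fclass W {x})"
    unfolding a_def using cont W VM by (subst hom_induced_compose') (auto simp: continuous_map_from_subtopology)
  also have "\<dots> = \<alpha> x" using fclass_point [OF admWx] by simp
  finally have ja: "?j a = \<alpha> x" .
  have inj: "inj_on ?j (carrier ?R)"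
    using excision_neighbourhood [OF nV] by (simp add: iso_iff)
  have "orientation_class_in n M \<alpha> V x = a"
    unfolding orientation_class_in_def
    by (rule the_equality) (use a ja inj in \<open>auto simp: inj_on_def\<close>)
  moreover have "hom_induced (int n) (subtopology M V) (V - {x}) N (topspace N - {f x}) f a
      = hom_induced (int n) (subtopology M W) (W - {x}) N (topspace N - {f x}) f (fclass W {x})"
    unfolding a_def using cont W VM iV f_sub f_top
    by (subst hom_induced_compose') auto
  moreover have "\<dots> = push W {f x}"
  proof -
    have "W - f -` {f x} = W - {x}" using Wf by auto
    then show ?thesis by (simp only: push_def Wf)
  qed
  moreover have "push W {f x} = push Q {f x}"
    using W Q by (intro push_shrink admissible_fibre_isolated [OF Q]) auto
  ultimately show ?thesis by simp
qed

lemma local_degree_eq_dg: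
  assumes Q: "openin M Q" "Q \<subseteq> G" "Q \<inter> f -` {f x} = {x}"
  shows "local_degree n M \<alpha> N \<beta> f x = map_degree Q (f x)"
proof -
  have x: "x \<in> Q" "x \<in> topspace M" using Q openin_subset by blast+
  have iso: "isolating_neighbourhood M f x Q"
    using Q x openin_subset [OF Q(1)] by (auto simp: isolating_neighbourhood_def neighbourhood_of_def)
  have "(THE d::int. \<forall>V. isolating_neighbourhood M f x V \<longrightarrow>
             hom_induced (int n) (subtopology M V) (V - {x}) N (topspace N - {f x}) f
               (orientation_class_in n M \<alpha> V x)
             = \<beta> (f x) [^]\<^bsub>local_homology_group n N (f x)\<^esub> d) = map_degree Q (f x)"
  proof (rule the_equality)
    show "\<forall>V. isolating_neighbourhood M f x V \<longrightarrow>
             hom_induced (int n) (subtopology M V) (V - {x}) N (topspace N - {f x}) f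
               (orientation_class_in n M \<alpha> V x)
             = \<beta> (f x) [^]\<^bsub>local_homology_group n N (f x)\<^esub> map_degree Q (f x)"
      using push_orientation_class [OF _ Q] push_point [OF f_top [OF x(2)]] by simp
    show "d = map_degree Q (f x)" if "\<forall>V. isolating_neighbourhood M f x V \<longrightarrow>
             hom_induced (int n) (subtopology M V) (V - {x}) N (topspace N - {f x}) f
               (orientation_class_in n M \<alpha> V x)
             = \<beta> (f x) [^]\<^bsub>local_homology_group n N (f x)\<^esub> d" for d
      using that iso push_orientation_class [OF iso Q] map_degree_unique [OF f_top [OF x(2)]] by metis
  qed
  then show ?thesis
    using iso by (auto simp: local_degree_def discrete_at_def)
qed

text \<open>Induction on the fibre: disjoint open sets separate one preimage from the others, and
  the degree is additive over them.\<close>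

lemma map_degree_eq_sum:
  assumes "finite F"
  shows "\<lbrakk>openin M Q; Q \<subseteq> G; Q \<inter> f -` {y} = F; y \<in> topspace N\<rbrakk>
    \<Longrightarrow> map_degree Q y = (\<Sum>p\<in>F. local_degree n M \<alpha> N \<beta> f p)"
  using assms
proof (induction F arbitrary: Q)
  case empty
  then show ?case by (simp add: map_degree_empty)
next
  case (insert p F)
  have QM: "Q \<subseteq> topspace M" using insert.prems openin_subset by blast
  have sub: "insert p F \<subseteq> topspace M" using insert.prems QM by auto
  have "compactin M {p}" "compactin M F" "disjnt {p} F"
    using sub insert.hyps by (auto intro: finite_imp_compactin)
  then obtain A B where AB: "openin M A" "openin M B" "{p} \<subseteq> A" "F \<subseteq> B" "disjnt A B"
    using Hausdorff_space_compact_separation [OF M(1)] by metis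
  have fin: "admissible_fibre Q' {y}" if "Q' \<subseteq> Q" "openin M Q'" for Q'
  proof -
    have "finite (Q' \<inter> f -` {y})" "Q' \<inter> f -` {y} \<subseteq> topspace M"
      using insert.prems insert.hyps that QM by (auto intro: finite_subset [of _ "insert p F"])
    then have "closedin M (Q' \<inter> f -` {y})"
      using M(1) by (intro compactin_imp_closedin finite_imp_compactin)
    then show ?thesis using that insert.prems by (auto simp: admissible_def)
  qed
  have Qp: "(Q \<inter> A) \<inter> f -` {y} = {p}" and QF: "(Q \<inter> B) \<inter> f -` {y} = F"
    using insert.prems insert.hyps AB by (auto simp: disjnt_def)
  have fp: "f p = y" using Qp by auto
  have op: "openin M (Q \<inter> A)" "openin M (Q \<inter> B)" "openin M (Q \<inter> A \<union> Q \<inter> B)"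
    using AB insert.prems by auto
  have "map_degree Q y = map_degree (Q \<inter> A \<union> Q \<inter> B) y"
    by (rule map_degree_shrink [symmetric, OF fin]) (use insert.prems AB op in auto)
  also have "\<dots> = map_degree (Q \<inter> A) y + map_degree (Q \<inter> B) y"
    using AB op insert.prems by (intro map_degree_Un fin) (auto simp: disjnt_def)
  also have "map_degree (Q \<inter> A) y = local_degree n M \<alpha> N \<beta> f p"
  proof -
    have "local_degree n M \<alpha> N \<beta> f p = map_degree (Q \<inter> A) (f p)"
      by (rule local_degree_eq_dg) (use Qp fp op insert.prems in auto)
    then show ?thesis by (simp only: fp)
  qed
  also have "map_degree (Q \<inter> B) y = (\<Sum>p\<in>F. local_degree n M \<alpha> N \<beta> f p)"
    by (rule insert.IH) (use QF op insert.prems in auto)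
  finally show ?case using insert.hyps by simp
qed

section \<open>A fold along which the map is injective has opposite degrees\<close>

lemma \<alpha>_inject:
  "x \<in> topspace M \<Longrightarrow> \<alpha> x [^]\<^bsub>local_homology_group n M x\<^esub> (j::int) = \<alpha> x [^]\<^bsub>local_homology_group n M x\<^esub> (k::int)
    \<longleftrightarrow> j = k"
  by (rule orientation_int_pow_inject [OF M(1,2) _ M(3)])

lemma \<alpha>_carrier: "x \<in> topspace M \<Longrightarrow> \<alpha> x \<in> carrier (local_homology_group n M x)"
  using M(3) by (auto simp: orientation_def)

text \<open>The homological core, with all geometry put into the assumptions. \<open>J\<close> is a
  tube around the image of the fold, on which \<open>h\<close> inverts \<open>f\<close> up to
  homotopy; \<open>D\<close> confines attention to a compact region; \<open>B\<close> contains the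
  part of that region outside the tube; \<open>E\<close> is the cell in which the multiplicities at
  \<open>q\<close> and \<open>q'\<close> are compared.\<close>

lemma fold_homology:
  fixes a b :: int
  assumes U: "openin M U" "U \<subseteq> G" and V: "openin M V" "V \<subseteq> G" and UV: "U \<inter> V = {}"
    and O': "openin N O'" "U \<union> V \<subseteq> f -` O'"
    and B: "closedin N B" "B \<subseteq> O'" "point_detected n N B"
      "closedin M (U \<inter> f -` B)" "closedin M (V \<inter> f -` B)"
    and ab: "\<And>y. y \<in> B \<Longrightarrow> map_degree U y = a" "\<And>y. y \<in> B \<Longrightarrow> map_degree V y = b"
    and J: "openin N J" and D: "closedin N D" "O' \<inter> D - J \<subseteq> B"
    and q: "q \<in> U" "q \<in> E" "f q \<notin> J" and q': "q' \<in> V" "q' \<in> E" "f q' \<notin> J"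
    and E: "E \<subseteq> G" "point_faithful n M E" "E \<inter> (U \<union> V) \<subseteq> f -` D"
    and h: "continuous_map (subtopology N (O' \<inter> J)) (subtopology M (topspace M - {q,q'})) h"
      "h \<in> (O' \<inter> J - D) \<rightarrow> topspace M - E"
    and hom: "homotopic_with (\<lambda>k. k \<in> ((U \<union> V) \<inter> f -` J - f -` D) \<rightarrow> topspace M - E)
        (subtopology M ((U \<union> V) \<inter> f -` J)) (subtopology M (topspace M - {q,q'})) (h \<circ> f) id"
  shows "a + b = 0"
proof -
  define Q where "Q = U \<union> V"
  let ?MQ = "subtopology M Q" and ?NO = "subtopology N O'"
  have Q: "openin M Q" "Q \<subseteq> G" "Q \<subseteq> topspace M" "Q \<subseteq> f -` O'"
    using U V O' openin_subset [OF U(1)] openin_subset [OF V(1)] by (auto simp: Q_def)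
  have ON: "O' \<subseteq> topspace N" using O' openin_subset by auto
  have topQ: "topspace ?MQ = Q" and topO: "topspace ?NO = O'" using Q ON by auto
  have admU: "admissible_fibre U B" and admV: "admissible_fibre V B"
    using U V B by (auto simp: admissible_def)
  have subU: "U \<subseteq> Q" and subV: "V \<subseteq> Q" by (auto simp: Q_def)
  have fMQ: "continuous_map ?MQ ?NO f"
    using Q f_sub by (auto simp: continuous_map_in_subtopology)
  let ?R = "relative_homology_group (int n) ?MQ (Q - f -` B)"
  interpret R: comm_group ?R by simp
  define cU where "cU = hom_induced (int n) (subtopology M U) (U - f -` B) ?MQ (Q - f -` B) id (fclass U (U \<inter> f -` B))"
  define cV where "cV = hom_induced (int n) (subtopology M V) (V - f -` B) ?MQ (Q - f -` B) id (fclass V (V \<inter> f -` B))"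
  \<comment> \<open>The class b [U] - a [V]: over each point of \<open>B\<close> its two parts
    contribute b * a and - a * b, so its image under \<open>f\<close> is trivial.\<close>
  define z where "z = cU [^]\<^bsub>?R\<^esub> b \<otimes>\<^bsub>?R\<^esub> cV [^]\<^bsub>?R\<^esub> (- a)"
  have c: "cU \<in> carrier ?R" "cV \<in> carrier ?R"
    by (simp_all add: cU_def cV_def hom_induced_carrier)
  have z: "z \<in> carrier ?R" using c by (simp add: z_def)
  have contU: "continuous_map (subtopology M U) ?MQ id" and contV: "continuous_map (subtopology M V) ?MQ id"
    using subU subV by (auto simp: continuous_map_in_subtopology continuous_map_from_subtopology)
  have image_z: "hom_induced (int n) ?MQ (Q - f -` B) Y T k z
      = hom_induced (int n) ?MQ (Q - f -` B) Y T k cU [^]\<^bsub>relative_homology_group (int n) Y T\<^esub> b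
        \<otimes>\<^bsub>relative_homology_group (int n) Y T\<^esub>
        hom_induced (int n) ?MQ (Q - f -` B) Y T k cV [^]\<^bsub>relative_homology_group (int n) Y T\<^esub> (-a)"
    for T :: "'c set" and Y k
    using c by (simp add: z_def hom_induced_mult hom_induced_int_pow)

  have fcU: "hom_induced (int n) ?MQ (Q - f -` B) N (topspace N - B) f cU = push U B"
    unfolding cU_def push_def using contU f_sub f_compl [OF Q(3)] subU
    by (subst hom_induced_compose') auto
  have fcV: "hom_induced (int n) ?MQ (Q - f -` B) N (topspace N - B) f cV = push V B"
    unfolding cV_def push_def using contV f_sub f_compl [OF Q(3)] subV
    by (subst hom_induced_compose') auto
  have fz: "hom_induced (int n) ?MQ (Q - f -` B) N (topspace N - B) f z = \<one>\<^bsub>supp_homology (int n) N B\<^esub>"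
  proof (rule point_detectedD [OF B(3) hom_induced_carrier])
    fix y assume y: "y \<in> B"
    interpret Z: comm_group "local_homology_group n N y" by simp
    have yN: "y \<in> topspace N" using y B(1) closedin_subset by blast
    have cly: "closedin M (W \<inter> f -` {y})" if "closedin M (W \<inter> f -` B)" "W \<subseteq> topspace M" for W
    proof -
      have "closedin M {x \<in> topspace M. f x \<in> {y}}"
        by (rule closedin_continuous_map_preimage [OF f])
          (use yN N(1) in \<open>simp add: closedin_Hausdorff_sing_eq\<close>)
      with that(1) have "closedin M ((W \<inter> f -` B) \<inter> {x \<in> topspace M. f x \<in> {y}})" by blast
      moreover have "(W \<inter> f -` B) \<inter> {x \<in> topspace M. f x \<in> {y}} = W \<inter> f -` {y}"
        using y that(2) by auto
      ultimately show ?thesis by simp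
    qed
    have admissible_y: "admissible_fibre U {y}" "admissible_fibre V {y}"
      using cly [OF B(4)] cly [OF B(5)] U V openin_subset [OF U(1)] openin_subset [OF V(1)] by (auto simp: admissible_def)
    have "supp_restrict (int n) N B {y} (push U B) = \<beta> y [^]\<^bsub>local_homology_group n N y\<^esub> a"
      using push_natural [OF admU admissible_y(1)] push_point [OF yN, of U] ab(1) [OF y] y by simp
    moreover have "supp_restrict (int n) N B {y} (push V B) = \<beta> y [^]\<^bsub>local_homology_group n N y\<^esub> b"
      using push_natural [OF admV admissible_y(2)] push_point [OF yN, of V] ab(2) [OF y] y by simp
    ultimately show "supp_restrict (int n) N B {y} (hom_induced (int n) ?MQ (Q - f -` B) N (topspace N - B) f z)
        = \<one>\<^bsub>local_homology_group n N y\<^esub>"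
      unfolding image_z fcU fcV
      using push_carrier \<beta>_carrier [OF yN]
      by (simp add: hom_induced_mult hom_induced_int_pow group.int_pow_closed Z.int_pow_pow
          flip: Z.int_pow_mult)
  qed
  define z' where "z' = hom_induced (int n) ?MQ (Q - f -` B) ?NO (O' - B) f z"
  have fB: "f \<in> (Q - f -` B) \<rightarrow> O' - B" using Q by auto
  have z'1: "z' = \<one>\<^bsub>relative_homology_group (int n) ?NO (O' - B)\<^esub>"
  proof (rule iso_eq_oneD [OF excision_supp [OF O'(1) B(1,2)]])
    show "hom_induced (int n) ?NO (O' - B) N (topspace N - B) id z' = \<one>\<^bsub>supp_homology (int n) N B\<^esub>"
      unfolding z'_def fz [symmetric] using fMQ fB ON
      by (subst hom_induced_compose') (auto simp: continuous_map_from_subtopology)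
  qed (simp_all add: z'_def hom_induced_carrier)

  \<comment> \<open>\<open>I\<close> lies over the tube and \<open>T\<close> outside
    \<open>D\<close>; together they contain everything outside the preimage of \<open>B\<close>. So
    the boundary of \<open>z\<close> lies in their union, and modulo \<open>T\<close> it can be
    excised into \<open>I\<close>. Primed letters are the analogues in \<open>N\<close>.\<close>
  define I where "I = Q \<inter> f -` J"
  define J' where "J' = O' \<inter> J"
  define T where "T = Q - f -` D"
  define T' where "T' = O' - D"
  have oI: "openin M I"
  proof -
    have "openin M {x \<in> topspace M. f x \<in> J}"
      by (rule openin_continuous_map_preimage [OF f J])
    then have "openin M (Q \<inter> {x \<in> topspace M. f x \<in> J})" using Q(1) by blast
    moreover have "Q \<inter> {x \<in> topspace M. f x \<in> J} = I" using Q(3) by (auto simp: I_def)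
    ultimately show ?thesis by simp
  qed
  have oT: "openin M T"
  proof -
    have "closedin M {x \<in> topspace M. f x \<in> D}"
      by (rule closedin_continuous_map_preimage [OF f D(1)])
    then have "openin M (Q - {x \<in> topspace M. f x \<in> D})" using Q(1) by blast
    moreover have "Q - {x \<in> topspace M. f x \<in> D} = T" using Q(3) by (auto simp: T_def)
    ultimately show ?thesis by simp
  qed
  have oJ': "openin N J'" and oT': "openin N T'"
    using O' J D by (auto simp: J'_def T'_def)
  let ?S = "I \<union> T" and ?S' = "J' \<union> T'"
  have SQ: "?S \<subseteq> Q" and SO: "?S' \<subseteq> O'" by (auto simp: I_def T_def J'_def T'_def)
  have BS: "Q - f -` B \<subseteq> ?S" using D(2) Q by (auto simp: I_def T_def)
  have BS': "O' - B \<subseteq> ?S'" using D(2) by (auto simp: J'_def T'_def)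
  have fIT: "f \<in> I \<rightarrow> J'" "f \<in> T \<rightarrow> T'" "f \<in> ?S \<rightarrow> ?S'" "f \<in> (I \<inter> T) \<rightarrow> J' \<inter> T'"
    using Q by (auto simp: I_def T_def J'_def T'_def)
  have subS: "subtopology ?MQ ?S = subtopology M ?S" "subtopology ?NO ?S' = subtopology N ?S'"
    using SQ SO by (simp_all add: subtopology_subtopology Int_absorb1)
  define zS where "zS = hom_induced (int n) ?MQ (Q - f -` B) ?MQ ?S id z"
  have fzS: "hom_induced (int n) ?MQ ?S ?NO ?S' f zS = \<one>\<^bsub>relative_homology_group (int n) ?NO ?S'\<^esub>"
  proof -
    have "hom_induced (int n) ?MQ ?S ?NO ?S' f zS = hom_induced (int n) ?MQ (Q - f -` B) ?NO ?S' f z"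
      unfolding zS_def using BS fMQ fIT by (subst hom_induced_compose') auto
    also have "\<dots> = hom_induced (int n) ?NO (O' - B) ?NO ?S' id z'"
      unfolding z'_def using BS' fMQ fB by (subst hom_induced_compose') auto
    finally show ?thesis using z'1 by simp
  qed
  define dz where "dz = hom_relboundary (int n) ?MQ ?S T zS"
  have dz: "dz \<in> carrier (relative_homology_group (int n - 1) (subtopology M ?S) T)"
    unfolding dz_def subS(1) [symmetric] by (rule hom_relboundary)
  have fdz: "hom_induced (int n - 1) (subtopology M ?S) T (subtopology N ?S') T' f dz
     = \<one>\<^bsub>relative_homology_group (int n - 1) (subtopology N ?S') T'\<^esub>"
    using hom_relboundary_natural [OF fMQ fIT(3,2), of "int n" zS] hom_relboundary_one [of "int n" ?NO ?S' T']
    unfolding fzS dz_def subS by simp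
  obtain u where u: "u \<in> carrier (relative_homology_group (int n - 1) (subtopology M I) (I \<inter> T))"
    and udz: "hom_induced (int n - 1) (subtopology M I) (I \<inter> T) (subtopology M ?S) T id u = dz"
    using iso_ex_preimage [OF excision_open [OF oI oT] dz] .
  define v where "v = hom_induced (int n - 1) (subtopology M I) (I \<inter> T) (subtopology N J') (J' \<inter> T') f u"
  have contf: "continuous_map (subtopology M I) (subtopology N J') f" "continuous_map (subtopology M ?S) (subtopology N ?S') f"
    using fIT f_sub by (auto simp: continuous_map_in_subtopology Pi_iff)
  have conti: "continuous_map (subtopology M I) (subtopology M ?S) id" "continuous_map (subtopology N J') (subtopology N ?S') id"
    by (auto simp: continuous_map_in_subtopology continuous_map_from_subtopology)
  \<comment> \<open>The same excision in \<open>N\<close> shows that \<open>f\<close> kills the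
    boundary class already inside the tube, where \<open>h\<close> is defined.\<close>
  have v1: "v = \<one>\<^bsub>relative_homology_group (int n - 1) (subtopology N J') (J' \<inter> T')\<^esub>"
  proof (rule iso_eq_oneD [OF excision_open [OF oJ' oT']])
    have "hom_induced (int n - 1) (subtopology N J') (J' \<inter> T') (subtopology N ?S') T' id v
      = hom_induced (int n - 1) (subtopology M I) (I \<inter> T) (subtopology N ?S') T' f u"
      unfolding v_def using contf conti fIT by (subst hom_induced_compose') auto
    also have "\<dots> = hom_induced (int n - 1) (subtopology M ?S) T (subtopology N ?S') T' f dz"
      unfolding udz [symmetric] using contf conti fIT by (subst hom_induced_compose') auto
    finally show "hom_induced (int n - 1) (subtopology N J') (J' \<inter> T') (subtopology N ?S') T' id v
        = \<one>\<^bsub>relative_homology_group (int n - 1) (subtopology N ?S') T'\<^esub>"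
      using fdz by simp
  qed (simp_all add: v_def hom_induced_carrier)

  let ?P = "topspace M - {q,q'}" and ?ME = "topspace M - E"
  have EM: "E \<subseteq> topspace M" using E(1) openin_subset [OF G] by auto
  have qQ: "q \<in> Q" "q' \<in> Q" using q q' by (auto simp: Q_def)
  have fqD: "f q \<in> D" "f q' \<in> D" using E(3) q q' by auto
  have fqB: "f q \<in> B" "f q' \<in> B"
    using D(2) fqD q(3) q'(3) qQ Q by auto
  \<comment> \<open>The test points lie over \<open>D\<close> but not over \<open>J\<close>, hence
    neither in \<open>T\<close> nor in \<open>I\<close>: the boundary avoids them.\<close>
  have SP: "?S \<subseteq> ?P" using fqD q q' SQ Q(3) by (auto simp: I_def T_def)
  have TE: "T \<subseteq> ?ME" using E(3) Q(3) by (auto simp: T_def Q_def)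
  have EP: "?ME \<subseteq> ?P" using q q' by auto
  have ITe: "I \<inter> T = (U \<union> V) \<inter> f -` J - f -` D" "I = (U \<union> V) \<inter> f -` J"
    by (auto simp: I_def T_def Q_def)
  have h': "h \<in> J' \<inter> T' \<rightarrow> ?ME" using h(2) by (auto simp: J'_def T'_def)
  \<comment> \<open>Here the approximate inverse acts: the inclusion agrees with
    \<open>h \<circ> f\<close> on homology, and \<open>f\<close> sends \<open>u\<close> to the unit
    \<open>v\<close>.\<close>
  have "hom_induced (int n - 1) (subtopology M I) (I \<inter> T) (subtopology M ?P) ?ME id u
    = hom_induced (int n - 1) (subtopology M I) (I \<inter> T) (subtopology M ?P) ?ME (h \<circ> f) u"
    using homology_homotopy_axiom [OF hom, of "int n - 1"] unfolding ITe(1) unfolding ITe(2) by simp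
  also have "\<dots> = hom_induced (int n - 1) (subtopology N J') (J' \<inter> T') (subtopology M ?P) ?ME h v"
    unfolding v_def
    using contf fIT h(1) h' unfolding J'_def [symmetric]
    by (subst hom_induced_compose') auto
  finally have u1: "hom_induced (int n - 1) (subtopology M I) (I \<inter> T) (subtopology M ?P) ?ME id u
     = \<one>\<^bsub>relative_homology_group (int n - 1) (subtopology M ?P) ?ME\<^esub>"
    using v1 by simp
  define zM where "zM = hom_induced (int n) ?MQ ?S M ?P id zS"
  have contQ: "continuous_map ?MQ M id" by (simp add: continuous_map_from_subtopology)
  have "hom_relboundary (int n) M ?P ?ME zM
     = hom_induced (int n - 1) (subtopology M ?S) T (subtopology M ?P) ?ME id dz"
    unfolding zM_def dz_def subS(1) [symmetric]
    by (rule hom_relboundary_natural [OF contQ]) (use SP TE in auto)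
  also have "\<dots> = hom_induced (int n - 1) (subtopology M I) (I \<inter> T) (subtopology M ?P) ?ME id u"
    unfolding udz [symmetric] using conti SP TE
    by (subst hom_induced_compose') (auto simp: continuous_map_in_subtopology continuous_map_from_subtopology)
  finally have "hom_relboundary (int n) M ?P ?ME zM = \<one>\<^bsub>relative_homology_group (int n - 1) (subtopology M ?P) ?ME\<^esub>"
    using u1 by simp
  \<comment> \<open>With trivial boundary modulo the complement of \<open>E\<close>, the class
    extends over the cell. At \<open>q\<close> and \<open>q'\<close> the extension has the
    multiplicities \<open>b\<close> and \<open>- a\<close> of \<open>z\<close>.\<close>
  then obtain w where w: "w \<in> carrier (supp_homology (int n) M E)"
    and wz: "hom_induced (int n) M ?ME M ?P id w = zM"
    using relative_homology_lift_triple [OF EP, of zM "int n"] hom_induced_carrier zM_def by metis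

  have w_res: "supp_restrict (int n) M E {p} w
      = hom_induced (int n) ?MQ (Q - f -` B) M (topspace M - {p}) id z" if "p \<in> {q,q'}" for p
  proof -
    have pE: "p \<in> E" and pB: "p \<in> f -` B" using that q q' fqB by auto
    have "supp_restrict (int n) M E {p} w = hom_induced (int n) M ?P M (topspace M - {p}) id zM"
      unfolding wz [symmetric] using that EP pE by (subst hom_induced_compose') auto
    also have "\<dots> = hom_induced (int n) ?MQ ?S M (topspace M - {p}) id zS"
      unfolding zM_def using SP contQ that by (subst hom_induced_compose') auto
    also have "\<dots> = hom_induced (int n) ?MQ (Q - f -` B) M (topspace M - {p}) id z"
      unfolding zS_def using SP BS contQ that pB Q(3) by (subst hom_induced_compose') auto
    finally show ?thesis .
  qed
  have cU_res: "hom_induced (int n) ?MQ (Q - f -` B) M (topspace M - {p}) id cU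
      = hom_induced (int n) (subtopology M U) (U - U \<inter> f -` B) M (topspace M - {p}) id (fclass U (U \<inter> f -` B))"
    if "p \<in> {q,q'}" for p
  proof -
    have "U - U \<inter> f -` B = U - f -` B" by auto
    then show ?thesis
      unfolding cU_def using contU contQ subU that fqB Q(3) by (subst hom_induced_compose') auto
  qed
  have cV_res: "hom_induced (int n) ?MQ (Q - f -` B) M (topspace M - {p}) id cV
      = hom_induced (int n) (subtopology M V) (V - V \<inter> f -` B) M (topspace M - {p}) id (fclass V (V \<inter> f -` B))"
    if "p \<in> {q,q'}" for p
  proof -
    have "V - V \<inter> f -` B = V - f -` B" by auto
    then show ?thesis
      unfolding cV_def using contV contQ subV that fqB Q(3) by (subst hom_induced_compose') auto
  qed
  have qM: "q \<in> topspace M" "q' \<in> topspace M" using qQ Q by auto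
  have clq: "closedin M {q}" "closedin M {q'}" using qM M(1) by (simp_all add: closedin_Hausdorff_sing_eq)
  have "{q} \<inter> V = {}" "{q'} \<inter> U = {}" using q q' UV by auto
  note dis = fclass_disjoint [OF admV clq(1) this(1)] fclass_disjoint [OF admU clq(2) this(2)]
  interpret Gq: comm_group "local_homology_group n M q" by simp
  interpret Gq': comm_group "local_homology_group n M q'" by simp
  have wq: "supp_restrict (int n) M E {q} w = \<alpha> q [^]\<^bsub>local_homology_group n M q\<^esub> b"
    using w_res [of q] cU_res [of q] cV_res [of q] dis(1) fclass_point [OF admU, of q] q(1) fqB(1) \<alpha>_carrier [OF qM(1)]
    by (simp add: image_z)
  have wq': "supp_restrict (int n) M E {q'} w = \<alpha> q' [^]\<^bsub>local_homology_group n M q'\<^esub> (-a)"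
    using w_res [of q'] cU_res [of q'] cV_res [of q'] dis(2) fclass_point [OF admV, of q'] q'(1) fqB(2) \<alpha>_carrier [OF qM(2)]
    by (simp add: image_z)
  let ?H = "supp_homology (int n) M E"
  interpret H: comm_group ?H by simp
  let ?m = "supp_restrict (int n) M G E \<mu>"
  have m: "?m \<in> carrier ?H" by (rule hom_induced_carrier)
  have m_res: "supp_restrict (int n) M E {p} ?m = \<alpha> p" if "p \<in> E" for p
    using supp_restrict_restrict [OF E(1), of "{p}"] \<mu>(2) [of p] E(1) that by auto
  \<comment> \<open>\<open>w\<close> agrees with \<open>b\<close> times the orientation at
    \<open>q\<close>, so by faithfulness on all of \<open>E\<close>; at \<open>q'\<close> this says
    - a = b.\<close>
  define c where "c = w \<otimes>\<^bsub>?H\<^esub> inv\<^bsub>?H\<^esub> (?m [^]\<^bsub>?H\<^esub> b)"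
  have c: "c \<in> carrier ?H" using w m by (simp add: c_def)
  have "supp_restrict (int n) M E {q} c = \<one>\<^bsub>local_homology_group n M q\<^esub>"
    unfolding c_def using w m m_res [OF q(2)] wq \<alpha>_carrier [OF qM(1)]
    by (simp add: hom_induced_mult hom_induced_inv hom_induced_int_pow)
  then have "c = \<one>\<^bsub>?H\<^esub>"
    by (rule point_faithfulD [OF E(2) q(2) c])
  moreover have "supp_restrict (int n) M E {q'} c
      = \<alpha> q' [^]\<^bsub>local_homology_group n M q'\<^esub> (- a) \<otimes>\<^bsub>local_homology_group n M q'\<^esub>
        inv\<^bsub>local_homology_group n M q'\<^esub> (\<alpha> q' [^]\<^bsub>local_homology_group n M q'\<^esub> b)"
    unfolding c_def using w m m_res [OF q'(2)] wq' \<alpha>_carrier [OF qM(2)]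
    by (simp add: hom_induced_mult hom_induced_inv hom_induced_int_pow)
  ultimately have "\<alpha> q' [^]\<^bsub>local_homology_group n M q'\<^esub> (- a - b)
     = \<alpha> q' [^]\<^bsub>local_homology_group n M q'\<^esub> (0::int)"
    using \<alpha>_carrier [OF qM(2)] by (simp add: Gq'.int_pow_diff)
  then show ?thesis
    using \<alpha>_inject [OF qM(2), of "- a - b" 0] by simp
qed

end

section \<open>Constructing the tube, the cell and the approximate inverse in charts\<close>

lemma Tietze_extension_ebox:
  assumes X: "normal_space X" "closedin X S"
    and \<phi>: "continuous_map (subtopology X S) (Euclidean_space n) \<phi>" "\<phi> ` S \<subseteq> ebox n a b"
    and ne: "ebox n a b \<noteq> {}"
  obtains g where "continuous_map X (Euclidean_space n) g" "g ` topspace X \<subseteq> ebox n a b"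
    "\<And>x. x \<in> S \<Longrightarrow> g x = \<phi> x"
proof -
  have "\<exists>g. continuous_map X euclideanreal g \<and> g ` topspace X \<subseteq> {a i..b i} \<and> (\<forall>x\<in>S. g x = \<phi> x i)"
    if "i < n" for i
  proof -
    have "{a i..b i} \<noteq> {}"
      using ne that by (force simp: ebox_def)
    moreover have "(\<lambda>x. \<phi> x i) ` S \<subseteq> {a i..b i}"
      using \<phi>(2) that by (force simp: ebox_def)
    ultimately show ?thesis
      using Tietze_extension_realinterval [OF X is_interval_cc _ continuous_map_Euclidean_coordinate [OF \<phi>(1)], of "a i" "b i" i]
      by metis
  qed
  then obtain g where g: "\<And>i. i < n \<Longrightarrow> continuous_map X euclideanreal (g i)"
    "\<And>i. i < n \<Longrightarrow> g i ` topspace X \<subseteq> {a i..b i}" "\<And>i x. \<lbrakk>i < n; x \<in> S\<rbrakk> \<Longrightarrow> g i x = \<phi> x i"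
    by metis
  let ?g = "\<lambda>x i. if i < n then g i x else 0"
  show thesis
  proof
    show "continuous_map X (Euclidean_space n) ?g"
      using g(1) by (simp add: continuous_map_componentwise_Euclidean_space)
    show "?g ` topspace X \<subseteq> ebox n a b"
      using g(2) by (fastforce simp: ebox_def topspace_Euclidean_space)
    show "?g x = \<phi> x" if "x \<in> S" for x
    proof -
      have "\<phi> x \<in> topspace (Euclidean_space n)"
        using \<phi>(2) that by (auto simp: ebox_def)
      then show ?thesis using g(3) that by (auto simp: topspace_Euclidean_space fun_eq_iff)
    qed
  qed
qed

text \<open>Provides the data for \<open>fold_homology\<close>, with h = \<zeta> \<circ> g. As
  \<open>P\<close> sits over a convex box inside the image of the chart, straight-line homotopies
  can be pulled back to \<open>M\<close>; the chart of \<open>N\<close> serves to thicken a compact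
  subset of \<open>O'\<close>.\<close>

lemma (in local_class) fold_contradiction:
  fixes a b :: int
  assumes P: "openin M P" "P \<subseteq> G" and Y: "openin N Y" "normal_space (subtopology N Y)"
    and proper: "proper_map (subtopology M P) (subtopology N Y) f"
    and chM: "openin M C" "openin (Euclidean_space n) W"
      "homeomorphic_map (subtopology M C) (subtopology (Euclidean_space n) W) \<xi>"
      "P \<subseteq> {p \<in> C. \<xi> p \<in> ebox n lo hi}" "ebox n lo hi \<subseteq> W"
    and chN: "openin N C'" "openin (Euclidean_space n) W'"
      "homeomorphic_map (subtopology N C') (subtopology (Euclidean_space n) W') \<eta>" "Y \<subseteq> C'"
    and K: "closedin (subtopology M P) K" "\<And>p k. \<lbrakk>p \<in> P; k \<in> K; f p = f k\<rbrakk> \<Longrightarrow> p = k"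
    and O': "openin N O'" "O' \<subseteq> Y" "O' \<inter> f ` K = {}" "closedin (subtopology N Y) (O' \<union> f ` K)"
    and UV: "openin M U" "openin M V" "U \<inter> V = {}" "U \<union> V = P \<inter> f -` O'" "O' \<subseteq> f ` (U \<union> V)"
    and ab: "\<And>y. y \<in> O' \<Longrightarrow> map_degree U y = a" "\<And>y. y \<in> O' \<Longrightarrow> map_degree V y = b"
    and x: "x \<in> K" "\<And>T. \<lbrakk>openin M T; x \<in> T\<rbrakk> \<Longrightarrow> T \<inter> U \<noteq> {} \<and> T \<inter> V \<noteq> {}"
  shows "a + b = 0"
proof -
  let ?E = "Euclidean_space n" and ?P = "subtopology M P" and ?Y = "subtopology N Y"
  have PM: "P \<subseteq> topspace M" and YN: "Y \<subseteq> topspace N" and CM: "C \<subseteq> topspace M"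
    and WE: "W \<subseteq> topspace ?E"
    using P Y chM openin_subset by blast+
  have topP: "topspace ?P = P" and topY: "topspace ?Y = Y" and topC: "topspace (subtopology M C) = C"
    and topW: "topspace (subtopology ?E W) = W"
    using PM YN CM WE by auto
  have fPY: "f p \<in> Y" if "p \<in> P" for p
    using proper_map_imp_subset_topspace [OF proper] that topP topY by auto
  have KP: "K \<subseteq> P" using closedin_subset [OF K(1)] topP by simp
  have clmap: "closed_map ?P ?Y f" by (rule proper_imp_closed_map [OF proper])
  have contf: "continuous_map ?P ?Y f"
    using f_sub fPY by (auto simp: continuous_map_in_subtopology PM)
  have PC: "P \<subseteq> C" using chM(4) by auto
  have cont\<xi>: "continuous_map (subtopology M C) ?E \<xi>"
    using homeomorphic_imp_continuous_map [OF chM(3)] continuous_map_into_fulltopology by blast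
  have cont\<xi>P: "continuous_map ?P ?E \<xi>"
    using continuous_map_from_subtopology [OF cont\<xi>, of P] PC by (simp add: subtopology_subtopology Int_absorb1)
  have inj\<xi>: "inj_on \<xi> C" and im\<xi>: "\<xi> ` C = W"
    using homeomorphic_imp_injective_map [OF chM(3)] homeomorphic_imp_surjective_map [OF chM(3)] topC topW by simp_all
  have \<xi>E: "\<xi> p \<in> topspace ?E" if "p \<in> C" for p using im\<xi> WE that by auto
  obtain \<zeta> where hm: "homeomorphic_maps (subtopology M C) (subtopology ?E W) \<xi> \<zeta>"
    using chM(3) homeomorphic_map_maps by blast
  have cont\<zeta>: "continuous_map (subtopology ?E W) M \<zeta>"
    using hm by (auto simp: homeomorphic_maps_def intro: continuous_map_into_fulltopology)
  have \<zeta>\<xi>: "\<zeta> (\<xi> p) = p" if "p \<in> C" for p using hm that topC by (auto simp: homeomorphic_maps_def)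
  have \<xi>\<zeta>: "\<xi> (\<zeta> w) = w" and \<zeta>C: "\<zeta> w \<in> C" if "w \<in> W" for w
    using hm that topC topW by (auto simp: homeomorphic_maps_def continuous_map_def)

  \<comment> \<open>The inverse \<open>k\<close> of \<open>f\<close> on \<open>K\<close> is continuous because \<open>f\<close> is proper; \<open>g\<close> extends it to \<open>Y\<close>.\<close>
  define L where "L = f ` K"
  have LY: "L \<subseteq> Y" using KP fPY by (auto simp: L_def)
  have clL: "closedin ?Y L"
    using clmap K(1) by (auto simp: closed_map_def L_def)
  have injK: "inj_on f K" using K(2) KP by (auto simp: inj_on_def)
  have homK: "homeomorphic_map (subtopology M K) (subtopology N L) f"
  proof (rule bijective_closed_imp_homeomorphic_map)
    have sub: "subtopology ?P K = subtopology M K" "subtopology ?Y L = subtopology N L"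
      using KP LY by (simp_all add: subtopology_subtopology Int_absorb1)
    have "{x \<in> topspace ?P. f x \<in> L} = K"
      using K(2) KP topP by (auto simp: L_def)
    then show "closed_map (subtopology M K) (subtopology N L) f"
      using closed_map_restriction [OF clmap, of L K] sub by simp
    show "continuous_map (subtopology M K) (subtopology N L) f"
      using f_sub by (auto simp: continuous_map_in_subtopology L_def)
  qed (use KP PM LY YN injK in \<open>auto simp: L_def Int_absorb1\<close>)
  then obtain k where k: "homeomorphic_maps (subtopology M K) (subtopology N L) f k"
    using homeomorphic_map_maps by blast
  have kf: "k (f p) = p" if "p \<in> K" for p
    using k that KP PM by (auto simp: homeomorphic_maps_def)
  have cont_k: "continuous_map (subtopology N L) ?P k"
    using k KP by (auto simp: homeomorphic_maps_def continuous_map_in_subtopology)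
  have KE: "\<xi> p \<in> ebox n lo hi" if "p \<in> P" for p using chM(4) that by auto
  obtain g where g: "continuous_map ?Y ?E g" "g ` topspace ?Y \<subseteq> ebox n lo hi"
    and gL: "\<And>y. y \<in> L \<Longrightarrow> g y = (\<xi> \<circ> k) y"
  proof (rule Tietze_extension_ebox [OF Y(2) clL, of n "\<xi> \<circ> k" lo hi])
    show "continuous_map (subtopology ?Y L) ?E (\<xi> \<circ> k)"
      using continuous_map_compose [OF cont_k cont\<xi>P] LY by (simp add: subtopology_subtopology Int_absorb1)
    show "(\<xi> \<circ> k) ` L \<subseteq> ebox n lo hi"
      using kf KE KP by (auto simp: L_def)
    show "ebox n lo hi \<noteq> {}" using KE KP x(1) by auto
  qed blast
  have gK: "g (f p) = \<xi> p" if "p \<in> K" for p using gL [of "f p"] kf that by (auto simp: L_def)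
  have gbox: "g y \<in> ebox n lo hi" if "y \<in> Y" for y using g(2) topY that by auto
  have gE: "g y \<in> topspace ?E" if "y \<in> Y" for y using gbox [OF that] by (simp add: ebox_def)
  have contgf: "continuous_map ?P ?E (g \<circ> f)"
    by (rule continuous_map_compose [OF contf g(1)])

  have xP: "x \<in> P" using x KP by auto
  have xC: "x \<in> C" using xP PC by auto
  obtain VY D where VY: "openin N VY" "f x \<in> VY" "VY \<subseteq> D" and D: "D \<subseteq> Y" "compactin N D"
    using manifold_cell [OF n N(1,2) Y(1) fPY [OF xP]] by metis
  have clD: "closedin N D" using D N(1) by (simp add: compactin_imp_closedin)
  have oPV: "openin M (P \<inter> f -` VY)"
  proof -
    have "openin M {x \<in> topspace M. f x \<in> VY}"
      by (rule openin_continuous_map_preimage [OF f VY(1)])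
    then have "openin M (P \<inter> {x \<in> topspace M. f x \<in> VY})" using P(1) by blast
    moreover have "P \<inter> {x \<in> topspace M. f x \<in> VY} = P \<inter> f -` VY" using PM by auto
    ultimately show ?thesis by simp
  qed
  obtain r where r: "r > 0" "ebox n (\<lambda>i. \<xi> x i - r) (\<lambda>i. \<xi> x i + r) \<subseteq> W"
    "{z \<in> C. \<xi> z \<in> ebox n (\<lambda>i. \<xi> x i - r) (\<lambda>i. \<xi> x i + r)} \<subseteq> P \<inter> f -` VY"
    using chart_cube_in_open [OF chM(1-3) oPV, of x] PC xP VY by auto
  \<comment> \<open>The cell \<open>E\<close> has half the radius of a cube whose points map into
    \<open>D\<close>. A point over the complement of \<open>D\<close> is outside the larger cube, so
    moving each coordinate by less than \<delta> cannot bring it into \<open>E\<close>.\<close>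
  define \<delta> where "\<delta> = r / 2"
  have \<delta>: "\<delta> > 0" "\<delta> < r" using r by (auto simp: \<delta>_def)
  define E where "E = {z \<in> C. \<xi> z \<in> ebox n (\<lambda>i. \<xi> x i - \<delta>) (\<lambda>i. \<xi> x i + \<delta>)}"
  have "ebox n (\<lambda>i. \<xi> x i - \<delta>) (\<lambda>i. \<xi> x i + \<delta>) \<subseteq> ebox n (\<lambda>i. \<xi> x i - r) (\<lambda>i. \<xi> x i + r)"
    using \<delta> by (fastforce simp: ebox_def)
  then have EW: "ebox n (\<lambda>i. \<xi> x i - \<delta>) (\<lambda>i. \<xi> x i + \<delta>) \<subseteq> W" and EPV: "E \<subseteq> P \<inter> f -` VY"
    using r unfolding E_def by blast+
  have faithE: "point_faithful n M E"
    unfolding E_def by (rule chart_cube [OF n M(1) chM(1-3) EW])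
  define T where "T = {z \<in> C. \<xi> z \<in> {v \<in> topspace ?E. \<forall>i<n. \<bar>v i - \<xi> x i\<bar> < \<delta>}}"
  have "openin M T"
    unfolding T_def by (rule chart_preimage_open [OF chM(1) cont\<xi> openin_Euclidean_cube])
  moreover have "x \<in> T" using xC \<xi>E \<delta> by (auto simp: T_def)
  ultimately have "T \<inter> U \<noteq> {} \<and> T \<inter> V \<noteq> {}" by (rule x(2))
  moreover have "T \<subseteq> E" by (fastforce simp: T_def E_def ebox_def abs_less_iff)
  ultimately obtain q q' where q: "q \<in> U" "q \<in> E" and q': "q' \<in> V" "q' \<in> E" by blast
  have UP: "U \<subseteq> P" and VP: "V \<subseteq> P" using UV(4) by auto
  then have UC: "U \<subseteq> C" and VC: "V \<subseteq> C" using PC by auto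
  obtain r1 where r1: "r1 > 0" "{z \<in> C. \<xi> z \<in> ebox n (\<lambda>i. \<xi> q i - r1) (\<lambda>i. \<xi> q i + r1)} \<subseteq> U"
    using chart_cube_in_open [OF chM(1-3) UV(1) UC q(1)] by metis
  obtain r2 where r2: "r2 > 0" "{z \<in> C. \<xi> z \<in> ebox n (\<lambda>i. \<xi> q' i - r2) (\<lambda>i. \<xi> q' i + r2)} \<subseteq> V"
    using chart_cube_in_open [OF chM(1-3) UV(2) VC q'(1)] by metis
  \<comment> \<open>The allowed displacement: cubes of this radius around \<open>q\<close> and
    \<open>q'\<close> stay in \<open>U\<close> and \<open>V\<close>, thus miss \<open>K\<close>, and
    the margin around \<open>E\<close> is respected.\<close>
  define e where "e = Min {r1, r2, \<delta>}"
  have e: "e > 0" "e \<le> r1" "e \<le> r2" "e \<le> \<delta>" using r1 r2 \<delta> by (auto simp: e_def)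

  define cube where "cube u = ebox n (\<lambda>i. \<xi> u i - e) (\<lambda>i. \<xi> u i + e)" for u
  \<comment> \<open>A neighbourhood of \<open>K\<close> whose points are moved by
    \<open>g \<circ> f\<close> by less than \<open>e\<close> in each coordinate, and differ from
    each of \<open>q\<close>, \<open>q'\<close> by more than \<open>e\<close> in some coordinate. So
    the homotopy never meets \<open>q\<close> or \<open>q'\<close>.\<close>
  define NK where "NK = {p \<in> P. (\<lambda>i. g (f p) i - \<xi> p i) \<in> {v \<in> topspace ?E. \<forall>i<n. \<bar>v i - 0\<bar> < e}}
      \<inter> {p \<in> P. \<xi> p \<in> topspace ?E - cube q} \<inter> {p \<in> P. \<xi> p \<in> topspace ?E - cube q'}"
  have NKD: "\<bar>g (f p) i - \<xi> p i\<bar> < e" if "p \<in> NK" "i < n" for p i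
    using that by (auto simp: NK_def)
  have far: "\<exists>i<n. \<bar>\<xi> p i - \<xi> u i\<bar> > e" if "p \<in> NK" "u \<in> {q, q'}" for p u
  proof -
    have "\<xi> p \<in> topspace ?E - cube u" using that by (auto simp: NK_def)
    then obtain i where "i < n" "\<not> (\<xi> u i - e \<le> \<xi> p i \<and> \<xi> p i \<le> \<xi> u i + e)"
      by (auto simp: cube_def ebox_def)
    then have "\<bar>\<xi> p i - \<xi> u i\<bar> > e" by linarith
    then show ?thesis using \<open>i < n\<close> by blast
  qed
  have KU: "K \<inter> (U \<union> V) = {}" using UV(4) O'(3) by auto
  have KNK: "K \<subseteq> NK"
  proof
    fix p assume p: "p \<in> K"
    have pC: "p \<in> C" "p \<in> P" using p KP PC by auto
    have "\<xi> p \<notin> cube u" if "u \<in> {q,q'}" for u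
    proof
      assume "\<xi> p \<in> cube u"
      then have "\<xi> p \<in> ebox n (\<lambda>i. \<xi> u i - r1) (\<lambda>i. \<xi> u i + r1)" "\<xi> p \<in> ebox n (\<lambda>i. \<xi> u i - r2) (\<lambda>i. \<xi> u i + r2)"
        using e unfolding cube_def ebox_def by force+
      then show False using r1(2) r2(2) KU p pC that by blast
    qed
    then show "p \<in> NK"
      using pC \<xi>E gK [OF p] e by (auto simp: NK_def topspace_Euclidean_space)
  qed
  have oNK: "openin ?P NK"
  proof -
    have "openin ?P {p \<in> topspace ?P. (\<lambda>i. (g \<circ> f) p i - \<xi> p i) \<in> {v \<in> topspace ?E. \<forall>i<n. \<bar>v i - 0\<bar> < e}}"
      using continuous_map_Euclidean_space_diff [OF contgf cont\<xi>P] openin_Euclidean_cube [of n "\<lambda>_. 0" e]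
      by (rule openin_continuous_map_preimage)
    moreover have "openin ?P {p \<in> topspace ?P. \<xi> p \<in> topspace ?E - cube u}" for u
      by (rule openin_continuous_map_preimage [OF cont\<xi>P]) (simp add: cube_def closedin_ebox openin_diff)
    ultimately show ?thesis unfolding NK_def topP by (auto simp: o_def intro!: openin_Int)
  qed
  \<comment> \<open>Since \<open>f\<close> is closed on \<open>P\<close>, this is the open set of
    values all of whose preimages in \<open>P\<close> lie in \<open>NK\<close>. It contains
    \<open>L\<close> because points of \<open>K\<close> are alone in their fibres.\<close>
  define J where "J = Y - f ` (P - NK)"
  have "closedin ?P (P - NK)" using oNK topP by (metis closedin_diff closedin_topspace)
  then have clJ: "closedin ?Y (f ` (P - NK))" using clmap by (auto simp: closed_map_def)
  then have "openin ?Y J" unfolding J_def using topY by (metis openin_diff openin_topspace)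
  then have oJ: "openin N J" using Y(1) openin_trans_full by blast
  have fJ: "p \<in> NK" if "p \<in> P" "f p \<in> J" for p
    using that by (auto simp: J_def)
  have LJ: "L \<subseteq> J"
    using LY KNK K(2) by (fastforce simp: J_def L_def)
  have qNK: "q \<notin> NK" "q' \<notin> NK" using far [of q q] far [of q' q'] e by auto
  have fq: "f q \<notin> J" "f q' \<notin> J" using fJ qNK q q' UP VP by auto

  \<comment> \<open>\<open>O' \<inter> D - J\<close> is compact since the frontier of \<open>O'\<close> in \<open>Y\<close> lies in \<open>L \<subseteq> J\<close>.\<close>
  have "closedin ?Y ((O' \<union> L) - J)"
    using O'(4) \<open>openin ?Y J\<close> by (auto simp: L_def intro: closedin_diff)
  then obtain Z where Z: "closedin N Z" "(O' \<union> L) - J = Z \<inter> Y"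
    by (auto simp: closedin_subtopology)
  have "compactin N (D \<inter> Z)" by (rule compact_Int_closedin [OF D(2) Z(1)])
  moreover have "D \<inter> Z = O' \<inter> D - J" using Z(2) D(1) O'(2) LJ by blast
  ultimately have "compactin N (O' \<inter> D - J)" by simp
  then obtain B where B: "O' \<inter> D - J \<subseteq> B" "B \<subseteq> O'" "compactin N B" "point_detected n N B"
    using chart_compact_cover [OF n N(1) chN(1-3) _ _ O'(1)] O'(2) chN(4)
    by (metis (no_types, lifting) Diff_subset Int_lower1 order_trans)
  have "compactin ?Y B" using B(2,3) O'(2) by (auto simp: compactin_subtopology)
  from compactin_proper_map_preimage [OF proper this]
  have "compactin M {p \<in> topspace ?P. f p \<in> B}" by (simp add: compactin_subtopology)
  moreover have "{p \<in> topspace ?P. f p \<in> B} = P \<inter> f -` B" using topP by auto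
  ultimately have clPB: "closedin M (P \<inter> f -` B)"
    using M(1) by (simp add: compactin_imp_closedin)
  have "U \<inter> f -` B = (P \<inter> f -` B) - V" "V \<inter> f -` B = (P \<inter> f -` B) - U"
    using UV(3,4) B(2) by auto
  then have clUB: "closedin M (U \<inter> f -` B)" "closedin M (V \<inter> f -` B)"
    using clPB UV(1,2) by (simp_all add: closedin_diff)

  let ?I = "(U \<union> V) \<inter> f -` J"
  have INK: "?I \<subseteq> NK" using fJ UP VP by auto
  have IP: "?I \<subseteq> P" using UP VP by auto
  let ?MM = "topspace M - {q,q'}"
  \<comment> \<open>The straight line from \<open>g \<circ> f\<close> to \<xi> in the box, with
    distance to \<xi> never exceeding the initial one.\<close>
  define H where "H = (\<lambda>(t::real, p) i. if i < n then (1 - t) * g (f p) i + t * \<xi> p i else 0)"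
  have H0: "H (0, p) = g (f p)" if "p \<in> P" for p
    using gE [OF fPY [OF that]] by (auto simp: H_def topspace_Euclidean_space fun_eq_iff)
  have H1: "H (1, p) = \<xi> p" if "p \<in> P" for p
    using \<xi>E [of p] that PC by (auto simp: H_def topspace_Euclidean_space fun_eq_iff)
  have Hbox: "H (t, p) \<in> ebox n lo hi" if "t \<in> {0..1}" "p \<in> P" for t p
  proof -
    have "lo i \<le> (1 - t) * u + t * w \<and> (1 - t) * u + t * w \<le> hi i"
      if "lo i \<le> u" "u \<le> hi i" "lo i \<le> w" "w \<le> hi i" for i u w
    proof -
      have "(1 - t) * u + t * w \<in> {lo i..hi i}"
        using convexD [OF convex_real_interval(5) [of "lo i" "hi i"], of u w "1 - t" t] that \<open>t \<in> {0..1}\<close> by simp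
      then show ?thesis by simp
    qed
    then show ?thesis
      using gbox [OF fPY [OF that(2)]] KE [OF that(2)]
      by (auto simp: H_def ebox_def topspace_Euclidean_space)
  qed
  have Hnear: "\<bar>H (t, p) i - \<xi> p i\<bar> < e" if "t \<in> {0..1}" "p \<in> NK" "i < n" for t p i
  proof -
    have "H (t, p) i - \<xi> p i = (1 - t) * (g (f p) i - \<xi> p i)"
      using that by (simp add: H_def algebra_simps)
    then have "\<bar>H (t, p) i - \<xi> p i\<bar> = (1 - t) * \<bar>g (f p) i - \<xi> p i\<bar>"
      using that by (simp add: abs_mult)
    also have "\<dots> \<le> 1 * \<bar>g (f p) i - \<xi> p i\<bar>"
      using that by (intro mult_right_mono) auto
    finally show ?thesis using NKD [OF that(2,3)] by simp
  qed
  have HM: "\<zeta> (H (t, p)) \<in> ?MM" if tp: "t \<in> {0..1}" "p \<in> NK" for t p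
  proof -
    have pP: "p \<in> P" using tp by (auto simp: NK_def)
    have HW: "H (t, p) \<in> W" using Hbox [OF tp(1) pP] chM(5) by auto
    have "\<zeta> (H (t, p)) \<noteq> u" if u: "u \<in> {q,q'}" for u
    proof
      assume "\<zeta> (H (t, p)) = u"
      then have "H (t, p) = \<xi> u" using \<xi>\<zeta> [OF HW] by simp
      moreover obtain i where "i < n" "\<bar>\<xi> p i - \<xi> u i\<bar> > e" using far [OF \<open>p \<in> NK\<close> u] by blast
      ultimately show False using Hnear [OF tp \<open>i < n\<close>] by simp
    qed
    then show ?thesis using \<zeta>C [OF HW] CM by auto
  qed
  have HE: "\<zeta> (H (t, p)) \<in> topspace M - E" if "t \<in> {0..1}" "p \<in> NK" "f p \<notin> D" for t p
  proof -
    have pP: "p \<in> P" using that by (auto simp: NK_def)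
    have HW: "H (t, p) \<in> W" using Hbox [OF that(1) pP] chM(5) by auto
    have "\<xi> p \<notin> ebox n (\<lambda>i. \<xi> x i - r) (\<lambda>i. \<xi> x i + r)"
      using r(3) VY(3) that(3) pP PC by auto
    then obtain i where i: "i < n" "\<not> (\<xi> x i - r \<le> \<xi> p i \<and> \<xi> p i \<le> \<xi> x i + r)"
      using \<xi>E pP PC by (auto simp: ebox_def)
    have "\<zeta> (H (t, p)) \<notin> E"
    proof
      assume "\<zeta> (H (t, p)) \<in> E"
      then have "\<xi> x i - \<delta> \<le> H (t, p) i" "H (t, p) i \<le> \<xi> x i + \<delta>"
        using \<xi>\<zeta> [OF HW] i(1) by (auto simp: E_def ebox_def)
      then show False using Hnear [OF that(1,2) i(1)] i(2) e(4) \<delta>_def by linarith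
    qed
    then show ?thesis using \<zeta>C [OF HW] CM by auto
  qed
  have contH: "continuous_map (prod_topology (top_of_set {0..1}) (subtopology M ?I)) ?E H"
  proof -
    let ?X = "prod_topology (top_of_set {0..1::real}) (subtopology M ?I)"
    have c1: "continuous_map ?X euclideanreal fst"
      by (rule continuous_map_into_fulltopology [OF continuous_map_fst])
    have "continuous_map ?X ?P snd"
      using continuous_map_snd [of "top_of_set {0..1::real}" "subtopology M ?I"] IP
      by (auto simp: continuous_map_in_subtopology)
    then have c2: "continuous_map ?X euclideanreal (\<lambda>x. g (f (snd x)) i)"
      and c3: "continuous_map ?X euclideanreal (\<lambda>x. \<xi> (snd x) i)" for i
      using continuous_map_Euclidean_coordinate [OF continuous_map_compose [OF _ contgf]]
        continuous_map_Euclidean_coordinate [OF continuous_map_compose [OF _ cont\<xi>P]]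
      by (auto simp: o_def)
    have "continuous_map ?X euclideanreal (\<lambda>x. (1 - fst x) * g (f (snd x)) i + fst x * \<xi> (snd x) i)" for i
      by (auto intro!: continuous_intros c1 c2 c3)
    then show ?thesis
      unfolding H_def case_prod_unfold by (simp add: continuous_map_componentwise_Euclidean_space)
  qed
  have cont\<zeta>H: "continuous_map (prod_topology (top_of_set {0..1}) (subtopology M ?I)) (subtopology M ?MM) (\<zeta> \<circ> H)"
  proof -
    have "continuous_map (prod_topology (top_of_set {0..1}) (subtopology M ?I)) (subtopology ?E W) H"
      using contH Hbox IP chM(5) by (fastforce simp: continuous_map_in_subtopology)
    from continuous_map_compose [OF this cont\<zeta>]
    have "continuous_map (prod_topology (top_of_set {0..1}) (subtopology M ?I)) M (\<zeta> \<circ> H)" .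
    moreover have "(\<zeta> \<circ> H) tp \<in> ?MM" if "tp \<in> topspace (prod_topology (top_of_set {0..1}) (subtopology M ?I))" for tp
      using that HM INK by (cases tp) auto
    ultimately show ?thesis by (auto simp: continuous_map_in_subtopology)
  qed
  have hom: "homotopic_with (\<lambda>k. k \<in> (?I - f -` D) \<rightarrow> topspace M - E)
      (subtopology M ?I) (subtopology M ?MM) (\<zeta> \<circ> g \<circ> f) id"
  proof -
    have "homotopic_with (\<lambda>k. k \<in> (?I - f -` D) \<rightarrow> topspace M - E)
      (subtopology M ?I) (subtopology M ?MM) (\<lambda>p. (\<zeta> \<circ> H) (0, p)) (\<lambda>p. (\<zeta> \<circ> H) (1, p))"
      unfolding homotopic_with_def
    proof (intro exI [of _ "\<zeta> \<circ> H"] conjI allI ballI)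
      show "(\<lambda>p. (\<zeta> \<circ> H) (t, p)) \<in> (?I - f -` D) \<rightarrow> topspace M - E" if "t \<in> {0..1}" for t
        using HE [OF that] INK by auto
    qed (use cont\<zeta>H in auto)
    then show ?thesis
    proof (rule homotopic_with_eq)
      show "(\<zeta> \<circ> g \<circ> f) p = (\<zeta> \<circ> H) (0, p)" if "p \<in> topspace (subtopology M ?I)" for p
        using that H0 IP by auto
      show "id p = (\<zeta> \<circ> H) (1, p)" if "p \<in> topspace (subtopology M ?I)" for p
      proof -
        have "p \<in> P" "p \<in> C" using that IP PC by auto
        then show ?thesis using H1 [of p] \<zeta>\<xi> [of p] by simp
      qed
      show "(h \<in> (?I - f -` D) \<rightarrow> topspace M - E) = (k \<in> (?I - f -` D) \<rightarrow> topspace M - E)"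
        if "\<And>p. p \<in> topspace (subtopology M ?I) \<Longrightarrow> h p = k p" for h k
      proof -
        have "h p = k p" if "p \<in> ?I - f -` D" for p
        proof -
          have "p \<in> topspace (subtopology M ?I)" using that IP PM by auto
          then show ?thesis by (rule \<open>\<And>p. p \<in> topspace (subtopology M ?I) \<Longrightarrow> h p = k p\<close>)
        qed
        then show ?thesis by (simp only: Pi_iff) simp
      qed
    qed
  qed
  \<comment> \<open>Surjectivity onto \<open>O'\<close> lets the required bounds on \<zeta> \<circ>
    g be read off from the homotopy at time 0.\<close>
  have im_g: "\<exists>p\<in>?I. f p = y" if y: "y \<in> O' \<inter> J" for y
  proof -
    obtain p where "p \<in> U \<union> V" "f p = y" using UV(5) y by blast
    then show ?thesis using y by (intro bexI [of _ p]) simp_all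
  qed
  have g0: "\<zeta> (g y) = \<zeta> (H (0, p))" if "p \<in> ?I" "f p = y" for p y
    using H0 [of p] that IP by auto
  show ?thesis
  proof (rule fold_homology [where U = U and V = V and O' = O' and B = B and J = J and D = D and E = E
        and q = q and q' = q' and h = "\<zeta> \<circ> g"])
    show "closedin N B" using B(3) N(1) by (simp add: compactin_imp_closedin)
    have OY: "O' \<inter> J \<subseteq> Y" using O'(2) by auto
    have "continuous_map (subtopology N (O' \<inter> J)) ?E g"
      using continuous_map_from_subtopology [OF g(1), of "O' \<inter> J"] OY
      by (simp add: subtopology_subtopology Int_absorb1)
    then have "continuous_map (subtopology N (O' \<inter> J)) (subtopology ?E W) g"
      using gbox OY chM(5) by (fastforce simp: continuous_map_in_subtopology)
    from continuous_map_compose [OF this cont\<zeta>]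
    have "continuous_map (subtopology N (O' \<inter> J)) M (\<zeta> \<circ> g)" .
    moreover have "(\<zeta> \<circ> g) y \<in> ?MM" if y: "y \<in> O' \<inter> J" for y
    proof -
      obtain p where p: "p \<in> ?I" "f p = y" using im_g [OF y] by blast
      then show ?thesis using HM [of 0 p] g0 [OF p] INK by auto
    qed
    ultimately show "continuous_map (subtopology N (O' \<inter> J)) (subtopology M ?MM) (\<zeta> \<circ> g)"
      by (auto simp: continuous_map_in_subtopology)
    show "\<zeta> \<circ> g \<in> O' \<inter> J - D \<rightarrow> topspace M - E"
    proof
      fix y assume y: "y \<in> O' \<inter> J - D"
      then obtain p where p: "p \<in> ?I" "f p = y" using im_g [of y] by blast
      then show "(\<zeta> \<circ> g) y \<in> topspace M - E" using HE [of 0 p] g0 [OF p] INK y by auto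
    qed
  qed (use UV UP VP P(2) O' B clUB ab oJ clD q q' fq EPV VY(3) faithE hom in auto)
qed

section \<open>Sign changes of the local degree\<close>

lemma locally_Euclidean_imp_locally_compact:
  assumes "n \<ge> 1" "Hausdorff_space X" "locally_Euclidean_space n X"
  shows "locally_compact_space X"
  unfolding locally_compact_space_def
proof
  fix x assume "x \<in> topspace X"
  then obtain V D where "openin X V" "x \<in> V" "V \<subseteq> D" "compactin X D"
    using manifold_cell [OF assms openin_topspace] by metis
  then show "\<exists>U K. openin X U \<and> compactin X K \<and> x \<in> U \<and> U \<subseteq> K" by blast
qed

lemma locally_Euclidean_imp_locally_connected:
  assumes "locally_Euclidean_space n X"
  shows "locally_connected_space X"
  unfolding locally_connected_space
proof (intro allI impI)
  fix V x assume Vx: "openin X V \<and> x \<in> V"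
  then have "x \<in> topspace X" using openin_subset by blast
  then obtain U W \<eta> where U: "openin X U" "x \<in> U" and W: "openin (Euclidean_space n) W"
    and \<eta>: "homeomorphic_map (subtopology X U) (subtopology (Euclidean_space n) W) \<eta>"
    using locally_Euclidean_chart [OF assms] by metis
  have "locally_connected_space (Euclidean_space n)"
    by (rule locally_path_connected_imp_locally_connected_space [OF locally_path_connected_Euclidean_space])
  then have "locally_connected_space (subtopology (Euclidean_space n) W)"
    using W by (rule locally_connected_space_open_subset)
  then have "locally_connected_space (subtopology X U)"
    using homeomorphic_locally_connected_space [OF homeomorphic_map_imp_homeomorphic_space [OF \<eta>]] by simp
  moreover have "openin (subtopology X U) (V \<inter> U)" "x \<in> V \<inter> U"
    using Vx U by (auto simp: openin_open_subtopology)
  ultimately obtain T where "openin (subtopology X U) T" "connectedin (subtopology X U) T" "x \<in> T" "T \<subseteq> V \<inter> U"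
    unfolding locally_connected_space by metis
  then show "\<exists>U. openin X U \<and> connectedin X U \<and> x \<in> U \<and> U \<subseteq> V"
    using U(1) by (auto simp: connectedin_subtopology openin_open_subtopology)
qed

lemma locally_Euclidean_imp_regular:
  assumes "n \<ge> 1" "Hausdorff_space X" "locally_Euclidean_space n X"
  shows "regular_space X"
  by (rule locally_compact_Hausdorff_imp_regular_space
      [OF locally_Euclidean_imp_locally_compact [OF assms] assms(2)])

text \<open>Otherwise the closures would be countably many closed sets with empty interior covering
  a nonempty Baire space.\<close>

lemma Baire_category_cover:
  assumes "locally_compact_space X" "regular_space X" "topspace X \<noteq> {}" "countable \<B>"
    and cover: "topspace X \<subseteq> (\<Union>B\<in>\<B>. A B)"
  obtains B where "B \<in> \<B>" "X interior_of (X closure_of A B) \<noteq> {}"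
proof (rule ccontr)
  assume "\<not> thesis"
  then have empty: "X interior_of (X closure_of A B) = {}" if "B \<in> \<B>" for B
    using that \<open>\<And>B. \<lbrakk>B \<in> \<B>; X interior_of (X closure_of A B) \<noteq> {}\<rbrakk> \<Longrightarrow> thesis\<close> by blast
  have "X interior_of \<Union>((\<lambda>B. X closure_of A B) ` \<B>) = {}"
    by (rule Baire_category_alt) (use assms empty in auto)
  moreover have "topspace X \<subseteq> \<Union>((\<lambda>B. X closure_of A B) ` \<B>)"
  proof
    fix z assume z: "z \<in> topspace X"
    then obtain B where "B \<in> \<B>" "z \<in> A B" using cover by blast
    then show "z \<in> \<Union>((\<lambda>B. X closure_of A B) ` \<B>)"
      using z by (auto simp: in_closure_of)
  qed
  then have "topspace X \<subseteq> X interior_of \<Union>((\<lambda>B. X closure_of A B) ` \<B>)"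
    by (simp add: interior_of_maximal)
  ultimately show False using assms(3) by auto
qed

lemma (in oriented_map) local_class_exists:
  assumes "x \<in> topspace M"
  obtains G \<mu> where "local_class n M \<alpha> N \<beta> f G \<mu>" "x \<in> G"
proof -
  obtain G \<mu> where G: "openin M G" "x \<in> G" "\<mu> \<in> carrier (supp_homology (int n) M G)"
    "\<And>y. y \<in> G \<Longrightarrow> supp_restrict (int n) M G {y} \<mu> = \<alpha> y"
    using M(3) assms unfolding orientation_def by metis
  then have "local_class n M \<alpha> N \<beta> f G \<mu>"
    by (intro local_class.intro oriented_map_axioms local_class_axioms.intro)
  then show thesis using that G(2) by blast
qed

text \<open>A normal neighbourhood of an isolated fibre point: \<open>f\<close> is proper over
  \<open>Y\<close>, and the degree of \<open>V\<close> over each value in \<open>Y\<close> is the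
  local degree at \<open>x\<close>.\<close>

lemma (in local_class) normal_neighbourhood:
  assumes O': "openin M O'" "x \<in> O'" "O' \<subseteq> G" "O' \<inter> f -` {f x} = {x}"
    and O'': "openin N O''" "f x \<in> O''"
  obtains V Y where "openin M V" "x \<in> V" "V \<subseteq> O'" "openin N Y" "connectedin N Y" "f x \<in> Y" "Y \<subseteq> O''"
    "proper_map (subtopology M (V \<inter> f -` Y)) (subtopology N Y) f"
    "\<And>y. y \<in> Y \<Longrightarrow> map_degree V y = local_degree n M \<alpha> N \<beta> f x"
proof -
  obtain V D where V: "openin M V" "x \<in> V" "V \<subseteq> D" and D: "D \<subseteq> O'" "compactin M D"
    using manifold_cell [OF n M(1,2) O'(1,2)] by metis
  have DM: "D \<subseteq> topspace M" using D(2) compactin_subset_topspace by blast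
  have clD: "closedin M D" using D M(1) by (simp add: compactin_imp_closedin)
  have "compactin M (D - V)"
  proof -
    have "compactin M (D \<inter> (topspace M - V))"
      by (rule compact_Int_closedin [OF D(2)]) (use V in auto)
    moreover have "D \<inter> (topspace M - V) = D - V" using DM by auto
    ultimately show ?thesis by simp
  qed
  then have "compactin N (f ` (D - V))" by (rule image_compactin [OF _ f])
  then have clZ: "closedin N (f ` (D - V))" using N(1) by (simp add: compactin_imp_closedin)
  have fxZ: "f x \<notin> f ` (D - V)"
  proof
    assume "f x \<in> f ` (D - V)"
    then obtain z where "z \<in> D - V" "f z = f x" by auto
    then have "z \<in> O' \<inter> f -` {f x}" using D(1) by auto
    then show False using O'(4) V(2) \<open>z \<in> D - V\<close> by auto
  qed
  \<comment> \<open>No value in \<open>Y1\<close> is attained on \<open>D - V\<close>, so over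
    \<open>Y1\<close> the open \<open>V\<close> has the same preimages as the compact
    \<open>D\<close>; this is where properness comes from.\<close>
  define Y1 where "Y1 = O'' - f ` (D - V)"
  have Y1: "openin N Y1" "f x \<in> Y1" using O'' clZ fxZ by (auto simp: Y1_def)
  have VD: "V \<inter> f -` B = D \<inter> f -` B" if "B \<subseteq> Y1" for B
    using that V(3) by (auto simp: Y1_def)
  have VG: "V \<subseteq> G" using V D O' by blast
  have cl: "closedin M (V \<inter> f -` B)" if "compactin N B" "B \<subseteq> Y1" for B
  proof -
    have "closedin M {p \<in> topspace M. f p \<in> B}"
      by (rule closedin_continuous_map_preimage [OF f]) (use that N(1) in \<open>simp add: compactin_imp_closedin\<close>)
    then have "closedin M (D \<inter> {p \<in> topspace M. f p \<in> B})" using clD by blast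
    moreover have "D \<inter> {p \<in> topspace M. f p \<in> B} = V \<inter> f -` B" using VD [OF that(2)] DM by auto
    ultimately show ?thesis by simp
  qed
  have "\<exists>V1. openin N V1 \<and> f x \<in> V1 \<and> V1 \<subseteq> Y1 \<and> (\<forall>y\<in>V1. map_degree V y = map_degree V (f x))"
    by (rule map_degree_locally_const [OF Y1 V(1) VG]) (rule cl)
  then obtain V1 where V1: "openin N V1" "f x \<in> V1" "V1 \<subseteq> Y1" "\<forall>y\<in>V1. map_degree V y = map_degree V (f x)" by blast
  obtain Y where Y: "openin N Y" "connectedin N Y" "f x \<in> Y" "Y \<subseteq> V1"
    using locally_Euclidean_imp_locally_connected [OF N(2)] V1(1,2) unfolding locally_connected_space by metis
  have "proper_map (subtopology M D) N f"
    using D(2) N(1) f_sub by (intro continuous_imp_proper_map Hausdorff_imp_kc_space)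
      (auto simp: compact_space_subtopology)
  moreover have "{p \<in> topspace (subtopology M D). f p \<in> Y} = V \<inter> f -` Y"
    using VD [of Y] Y(4) V1(3) DM by auto
  ultimately have "proper_map (subtopology (subtopology M D) (V \<inter> f -` Y)) (subtopology N Y) f"
    by (rule proper_map_restriction)
  moreover have "D \<inter> (V \<inter> f -` Y) = V \<inter> f -` Y" using V(3) by auto
  ultimately have prop_f: "proper_map (subtopology M (V \<inter> f -` Y)) (subtopology N Y) f"
    by (simp add: subtopology_subtopology)
  have "V \<inter> f -` {f x} = {x}" using O'(4) V D by auto
  then have deg: "local_degree n M \<alpha> N \<beta> f x = map_degree V (f x)"
    by (rule local_degree_eq_dg [OF V(1) VG])
  show thesis
  proof
    show "map_degree V y = local_degree n M \<alpha> N \<beta> f x" if "y \<in> Y" for y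
      using V1(4) Y(4) that deg by auto
    show "V \<subseteq> O'" using V D by blast
    show "Y \<subseteq> O''" using Y V1 by (auto simp: Y1_def)
  qed (use V Y prop_f in auto)
qed

section \<open>Maps without points of local degree zero\<close>

locale nonzero_degree_map = oriented_map +
  assumes nonzero: "p \<in> topspace M \<Longrightarrow> local_degree n M \<alpha> N \<beta> f p \<noteq> 0"
begin

lemma ex_isolating:
  assumes "x \<in> topspace M"
  obtains Q where "openin M Q" "x \<in> Q" "Q \<inter> f -` {f x} = {x}"
proof -
  have "discrete_at M f x"
    using nonzero [OF assms] by (auto simp: local_degree_def split: if_splits)
  then obtain V U where VU: "openin M U" "x \<in> U" "U \<subseteq> V" "\<forall>x'\<in>V - {x}. f x' \<noteq> f x"
    by (auto simp: discrete_at_def isolating_neighbourhood_def neighbourhood_of_def)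
  then have "U \<inter> f -` {f x} = {x}" by auto
  then show thesis using that VU by blast
qed

text \<open>Finitely many isolating neighbourhoods cover the compact set \<open>S\<close>, and each
  contains only one point of it.\<close>

lemma finite_fibre:
  assumes "compactin M S" "S \<subseteq> f -` {y}"
  shows "finite S"
proof -
  have "\<exists>Q. openin M Q \<and> x \<in> Q \<and> Q \<inter> f -` {f x} = {x}" if "x \<in> S" for x
  proof -
    have "x \<in> topspace M" using that compactin_subset_topspace [OF assms(1)] by auto
    then show ?thesis using ex_isolating by metis
  qed
  then obtain Q where Q: "\<And>x. x \<in> S \<Longrightarrow> openin M (Q x)" "\<And>x. x \<in> S \<Longrightarrow> x \<in> Q x"
    "\<And>x. x \<in> S \<Longrightarrow> Q x \<inter> f -` {f x} = {x}" by metis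
  have "S \<subseteq> \<Union>(Q ` S)" "\<And>U. U \<in> Q ` S \<Longrightarrow> openin M U" using Q by blast+
  then obtain \<F> where \<F>: "finite \<F>" "\<F> \<subseteq> Q ` S" "S \<subseteq> \<Union>\<F>"
    using compactinD [OF assms(1), of "Q ` S"] by metis
  obtain F where F: "finite F" "F \<subseteq> S" "\<F> = Q ` F"
    using finite_subset_image [OF \<F>(1,2)] by auto
  have "S \<subseteq> F"
  proof
    fix z assume z: "z \<in> S"
    then obtain x where x: "x \<in> F" "z \<in> Q x" using \<F>(3) F(3) by auto
    then have "x \<in> S" using F(2) by auto
    then have "z \<in> Q x \<inter> f -` {f x}" using x z assms(2) by auto
    then show "z \<in> F" using Q(3) [OF \<open>x \<in> S\<close>] x by auto
  qed
  then show ?thesis using F(1) finite_subset by blast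
qed

text \<open>The degree of a small neighbourhood over all nearby values equals the nonzero local
  degree, so none of those values can be missed.\<close>

lemma f_open:
  assumes "openin M O'"
  shows "openin N (f ` O')"
proof (subst openin_subopen, intro ballI)
  fix y assume "y \<in> f ` O'"
  then obtain x where x: "x \<in> O'" "y = f x" by blast
  have xM: "x \<in> topspace M" using x assms openin_subset by blast
  obtain G \<mu> where "local_class n M \<alpha> N \<beta> f G \<mu>" and xG: "x \<in> G"
    using local_class_exists [OF xM] by metis
  then interpret local_class n M \<alpha> N \<beta> f G \<mu> by simp
  obtain Q where Q: "openin M Q" "x \<in> Q" "Q \<inter> f -` {f x} = {x}"
    using ex_isolating [OF xM] by metis
  have *: "openin M (O' \<inter> Q \<inter> G)" "x \<in> O' \<inter> Q \<inter> G" "O' \<inter> Q \<inter> G \<subseteq> G" "(O' \<inter> Q \<inter> G) \<inter> f -` {f x} = {x}"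
    using assms Q G x xG by auto
  obtain V Y where V: "openin M V" "V \<subseteq> O' \<inter> Q \<inter> G" and Y: "openin N Y" "f x \<in> Y"
    and map_degree: "\<And>y. y \<in> Y \<Longrightarrow> map_degree V y = local_degree n M \<alpha> N \<beta> f x"
    using normal_neighbourhood [OF * openin_topspace f_top [OF xM]] by metis
  have "Y \<subseteq> f ` O'"
  proof
    fix y' assume y': "y' \<in> Y"
    have "y' \<in> topspace N" using y' Y openin_subset by blast
    then have "V \<inter> f -` {y'} \<noteq> {}"
      using map_degree_empty [of y' V] map_degree [OF y'] nonzero [OF xM] V by auto
    then show "y' \<in> f ` O'" using V(2) by auto
  qed
  then show "\<exists>T. openin N T \<and> y \<in> T \<and> T \<subseteq> f ` O'" using Y x by blast
qed

text \<open>For basic open \<open>B\<close>, the sets \<open>A B\<close> of points of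
  \<open>K\<close> alone in their fibre within \<open>B\<close> form a countable cover, as fibres
  are discrete. Baire makes one of them dense in a relatively open piece of \<open>K\<close>;
  openness of \<open>f\<close> then removes the restriction to a dense subset.\<close>

lemma ex_injective_open_piece:
  assumes "second_countable M" and K: "closedin M K" "K \<noteq> {}"
  obtains W where "openin M W" "W \<inter> K \<noteq> {}" "\<And>k. k \<in> W \<inter> K \<Longrightarrow> W \<inter> f -` {f k} = {k}"
proof -
  obtain \<B> where \<B>: "countable \<B>" "\<And>B. B \<in> \<B> \<Longrightarrow> openin M B"
    "\<And>U x. \<lbrakk>openin M U; x \<in> U\<rbrakk> \<Longrightarrow> \<exists>B\<in>\<B>. x \<in> B \<and> B \<subseteq> U"
    using assms(1) unfolding second_countable_def by metis
  define A where "A B = {k \<in> K \<inter> B. B \<inter> f -` {f k} = {k}}" for B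
  let ?X = "subtopology M K"
  have KM: "K \<subseteq> topspace M" using K(1) closedin_subset by blast
  then have topX: "topspace ?X = K" by auto
  have "K \<subseteq> (\<Union>B\<in>\<B>. A B)"
  proof
    fix k assume k: "k \<in> K"
    then obtain Q where Q: "openin M Q" "k \<in> Q" "Q \<inter> f -` {f k} = {k}"
      using ex_isolating KM by (metis subsetD)
    then obtain B where "B \<in> \<B>" "k \<in> B" "B \<subseteq> Q" using \<B>(3) by blast
    then have "k \<in> A B" using Q k by (auto simp: A_def)
    then show "k \<in> (\<Union>B\<in>\<B>. A B)" using \<open>B \<in> \<B>\<close> by blast
  qed
  moreover have "locally_compact_space ?X" "regular_space ?X"
    using locally_compact_space_closed_subset [OF locally_Euclidean_imp_locally_compact [OF n M(1,2)] K(1)]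
      regular_space_subtopology [OF locally_Euclidean_imp_regular [OF n M(1,2)]] by auto
  ultimately obtain B where B: "B \<in> \<B>" "?X interior_of (?X closure_of A B) \<noteq> {}"
    using Baire_category_cover [of ?X \<B> A] \<B>(1) K(2) topX by metis
  then obtain T t where T: "openin ?X T" "t \<in> T" "T \<subseteq> ?X closure_of A B"
    unfolding interior_of_def by auto
  then obtain W0 where W0: "openin M W0" "T = W0 \<inter> K"
    by (auto simp: openin_subtopology)
  have meet: "Z \<inter> A B \<noteq> {}" if "openin M Z" "k \<in> Z" "k \<in> W0 \<inter> K" for Z k
  proof -
    have "k \<in> ?X closure_of A B" using that T W0 by blast
    moreover have "openin ?X (Z \<inter> K)" using that(1) by (auto simp: openin_subtopology)
    ultimately show ?thesis using that unfolding in_closure_of by blast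
  qed
  define W where "W = W0 \<inter> B"
  have W: "openin M W" using W0 \<B>(2) B by (auto simp: W_def)
  \<comment> \<open>If \<open>p\<close> were a second preimage in \<open>B\<close>, then by openness
    all values near \<open>f k\<close> would be attained near \<open>p\<close>; so a point of
    \<open>A B\<close> close to \<open>k\<close> would not be alone in its fibre.\<close>
  have WA: "B \<inter> f -` {f k} = {k}" if k: "k \<in> W \<inter> K" for k
  proof (rule ccontr)
    assume "B \<inter> f -` {f k} \<noteq> {k}"
    then obtain p where p: "p \<in> B" "f p = f k" "p \<noteq> k" using k by (auto simp: W_def)
    have "p \<in> topspace M" "k \<in> topspace M"
      using p k \<B>(2) [OF B(1)] KM openin_subset by blast+
    then obtain Wk Wp where WW: "openin M Wk" "openin M Wp" "k \<in> Wk" "p \<in> Wp" "disjnt Wk Wp"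
      using M(1) p(3) unfolding Hausdorff_space_def by metis
    have "openin N (f ` (Wp \<inter> B))" using WW \<B>(2) [OF B(1)] by (intro f_open) auto
    then have "openin M {z \<in> topspace M. f z \<in> f ` (Wp \<inter> B)}"
      by (rule openin_continuous_map_preimage [OF f])
    then have "openin M (Wk \<inter> W \<inter> {z \<in> topspace M. f z \<in> f ` (Wp \<inter> B)})" using WW W by blast
    moreover have "f k \<in> f ` (Wp \<inter> B)" using p(1,2) WW(4) by (metis IntI imageI)
    then have "k \<in> Wk \<inter> W \<inter> {z \<in> topspace M. f z \<in> f ` (Wp \<inter> B)}"
      using WW k \<open>k \<in> topspace M\<close> by auto
    ultimately have "Wk \<inter> W \<inter> {z \<in> topspace M. f z \<in> f ` (Wp \<inter> B)} \<inter> A B \<noteq> {}"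
      by (rule meet) (use k in \<open>auto simp: W_def\<close>)
    then obtain a p' where "a \<in> Wk" "a \<in> A B" "p' \<in> Wp \<inter> B" "f a = f p'" by auto
    then have "p' \<in> B \<inter> f -` {f a}" "a \<in> Wk" "p' \<in> Wp" "B \<inter> f -` {f a} = {a}" by (auto simp: A_def)
    then show False using WW(5) by (auto simp: disjnt_iff)
  qed
  have "W \<inter> K \<noteq> {}"
  proof -
    have "W0 \<inter> A B \<noteq> {}" using meet [OF W0(1), of t] T(2) W0(2) by blast
    then show ?thesis by (auto simp: W_def A_def)
  qed
  moreover have "W \<inter> f -` {f k} = {k}" if "k \<in> W \<inter> K" for k
    using WA [OF that] that by (auto simp: W_def)
  ultimately show thesis using that W by blast
qed

text \<open>Carries out the choice of \<open>K\<close>, of the component (here \<open>O1\<close>)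
  and of the accumulation point, and checks the hypotheses of
  \<open>fold_contradiction\<close>.\<close>

lemma no_sign_change:
  assumes sc: "second_countable M" "second_countable N" and conn: "connected_space M"
    and x0: "x0 \<in> topspace M" "local_degree n M \<alpha> N \<beta> f x0 < 0"
    and x1: "x1 \<in> topspace M" "local_degree n M \<alpha> N \<beta> f x1 > 0"
  shows False
proof -
  let ?deg = "local_degree n M \<alpha> N \<beta> f"
  define pos where "pos = {x \<in> topspace M. ?deg x > 0}"
  define K where "K = M frontier_of pos"
  have posM: "pos \<subseteq> topspace M" by (auto simp: pos_def)
  have K: "closedin M K" by (simp add: K_def closedin_frontier_of)
  have "x0 \<notin> pos" "x1 \<in> pos" using x0 x1 by (auto simp: pos_def)
  then have "K \<noteq> {}"
    using connected_space_frontier_eq_empty [of M pos] conn posM x0(1) by (auto simp: K_def)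
  then obtain W x where W: "openin M W" "x \<in> W" "x \<in> K" "\<And>k. k \<in> W \<inter> K \<Longrightarrow> W \<inter> f -` {f k} = {k}"
    using ex_injective_open_piece [OF sc(1) K] by (metis disjoint_iff)
  have xM: "x \<in> topspace M" using W openin_subset by blast
  obtain G \<mu> where "local_class n M \<alpha> N \<beta> f G \<mu>" and xG: "x \<in> G"
    using local_class_exists [OF xM] by metis
  then interpret local_class n M \<alpha> N \<beta> f G \<mu> by simp

  let ?E = "Euclidean_space n"
  obtain C CW \<xi> where C: "openin M C" "x \<in> C" and CW: "openin ?E CW"
    and \<xi>: "homeomorphic_map (subtopology M C) (subtopology ?E CW) \<xi>"
    using locally_Euclidean_chart [OF M(2) xM] by metis
  obtain C' CW' \<eta> where C': "openin N C'" "f x \<in> C'" and CW': "openin ?E CW'"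
    and \<eta>: "homeomorphic_map (subtopology N C') (subtopology ?E CW') \<eta>"
    using locally_Euclidean_chart [OF N(2) f_top [OF xM]] by metis
  obtain r where r: "r > 0" "ebox n (\<lambda>i. \<xi> x i - r) (\<lambda>i. \<xi> x i + r) \<subseteq> CW"
    using chart_cube_in_open [OF C(1) CW \<xi> C(1) _ C(2)] by auto
  \<comment> \<open>Shrinking to an open cube puts \<open>P\<close> into a closed box of the chart,
    where the straight-line homotopy will take place.\<close>
  define T where "T = {z \<in> C. \<xi> z \<in> {v \<in> topspace ?E. \<forall>i<n. \<bar>v i - \<xi> x i\<bar> < r}}"
  have cont\<xi>: "continuous_map (subtopology M C) ?E \<xi>"
    using homeomorphic_imp_continuous_map [OF \<xi>] continuous_map_into_fulltopology by blast
  have "openin M T"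
    unfolding T_def by (rule chart_preimage_open [OF C(1) cont\<xi> openin_Euclidean_cube])
  moreover have "x \<in> T"
    using C xM r(1) cont\<xi> by (auto simp: T_def continuous_map_def)
  moreover have Tbox: "T \<subseteq> {p \<in> C. \<xi> p \<in> ebox n (\<lambda>i. \<xi> x i - r) (\<lambda>i. \<xi> x i + r)}"
    by (fastforce simp: T_def ebox_def abs_less_iff)
  ultimately have *: "openin M (W \<inter> G \<inter> T)" "x \<in> W \<inter> G \<inter> T" "W \<inter> G \<inter> T \<subseteq> G"
      "(W \<inter> G \<inter> T) \<inter> f -` {f x} = {x}"
    using W(1-3) W(4) [of x] G xG by auto
  obtain V Y where V: "openin M V" "x \<in> V" "V \<subseteq> W \<inter> G \<inter> T"
    and Y: "openin N Y" "connectedin N Y" "f x \<in> Y" "Y \<subseteq> C'"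
    and proper: "proper_map (subtopology M (V \<inter> f -` Y)) (subtopology N Y) f"
    and dgV: "\<And>y. y \<in> Y \<Longrightarrow> map_degree V y = ?deg x"
    using normal_neighbourhood [OF * C'] by metis
  define d where "d = ?deg x"
  have d0: "d \<noteq> 0" using nonzero [OF xM] by (simp add: d_def)
  have VG: "V \<subseteq> G" using V by auto
  define P where "P = V \<inter> f -` Y"
  have YN: "Y \<subseteq> topspace N" and VM: "V \<subseteq> topspace M" using Y V openin_subset by blast+
  then have topY: "topspace (subtopology N Y) = Y" by auto
  have pre_open: "openin M (Q \<inter> f -` O')" if "openin M Q" "openin N O'" for Q O'
  proof -
    have "openin M {z \<in> topspace M. f z \<in> O'}"
      by (rule openin_continuous_map_preimage [OF f that(2)])
    then have "openin M (Q \<inter> {z \<in> topspace M. f z \<in> O'})" using that(1) by blast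
    moreover have "Q \<inter> {z \<in> topspace M. f z \<in> O'} = Q \<inter> f -` O'"
      using openin_subset [OF that(1)] by auto
    ultimately show ?thesis by simp
  qed
  have P: "openin M P" "P \<subseteq> G" "P \<subseteq> V"
    using pre_open [OF V(1) Y(1)] VG by (auto simp: P_def)
  have PM: "P \<subseteq> topspace M" using P VM by auto
  then have topP: "topspace (subtopology M P) = P" by auto
  have proper: "proper_map (subtopology M P) (subtopology N Y) f" using proper by (simp add: P_def)
  have clmap: "closed_map (subtopology M P) (subtopology N Y) f" by (rule proper_imp_closed_map [OF proper])
  have clP: "closedin M (P \<inter> f -` D)" "compactin M (P \<inter> f -` D)" if "compactin N D" "D \<subseteq> Y" for D
  proof -
    have "compactin (subtopology N Y) D" using that by (simp add: compactin_subtopology)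
    from compactin_proper_map_preimage [OF proper this]
    have "compactin M {p \<in> topspace (subtopology M P). f p \<in> D}" by (simp add: compactin_subtopology)
    moreover have "{p \<in> topspace (subtopology M P). f p \<in> D} = P \<inter> f -` D" using topP by auto
    ultimately show "compactin M (P \<inter> f -` D)" by simp
    then show "closedin M (P \<inter> f -` D)" using M(1) by (simp add: compactin_imp_closedin)
  qed
  have xP: "x \<in> P" using V Y by (auto simp: P_def)
  define KP where "KP = K \<inter> P"
  have KPP: "KP \<subseteq> P" by (auto simp: KP_def)
  have xKP: "x \<in> KP" using W xP by (auto simp: KP_def)
  have KPinj: "p = k" if "p \<in> P" "k \<in> KP" "f p = f k" for p k
  proof -
    have "k \<in> W \<inter> K" "p \<in> W" using that P V by (auto simp: KP_def)
    then have "p \<in> W \<inter> f -` {f k}" using that by auto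
    then show ?thesis using W(4) [OF \<open>k \<in> W \<inter> K\<close>] by auto
  qed
  \<comment> \<open>The fibre in \<open>V\<close> through \<open>k\<close> is a single point, so the
    local degree there is the whole degree of \<open>V\<close> over \<open>f k\<close>.\<close>
  have degKP: "?deg k = d" if k: "k \<in> KP" for k
  proof -
    have "P \<inter> f -` {f k} = {k}" using KPinj [OF _ k] k by (auto simp: KP_def)
    then have "V \<inter> f -` {f k} = {k}" using k by (auto simp: P_def KP_def)
    from local_degree_eq_dg [OF V(1) VG this]
    show ?thesis using dgV [of "f k"] k by (auto simp: KP_def P_def d_def)
  qed
  have clKP: "closedin (subtopology M P) KP"
    using K by (auto simp: KP_def closedin_subtopology)

  \<comment> \<open>On \<open>A\<close> the degrees have the sign opposite to \<open>d\<close>.\<close>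
  define A where "A = (if d > 0 then topspace M - M closure_of pos else M interior_of pos)"
  define A' where "A' = (if d > 0 then M interior_of pos else topspace M - M closure_of pos)"
  have oA: "openin M A" "openin M A'" by (auto simp: A_def A'_def)
  have AA': "A \<inter> A' = {}" "A \<inter> K = {}" "A' \<inter> K = {}" "topspace M \<subseteq> A \<union> A' \<union> K"
    using interior_of_subset_closure_of [of M pos] by (auto simp: A_def A'_def K_def frontier_of_def)
  have Aneg: "?deg p * d < 0" if "p \<in> A" for p
  proof (cases "d > 0")
    case True
    then have "p \<in> topspace M" "p \<notin> pos"
      using that closure_of_subset [OF posM] by (auto simp: A_def)
    then have "?deg p < 0" using nonzero [of p] by (auto simp: pos_def)
    then show ?thesis using True by (simp add: mult_neg_pos)
  next
    case False
    then have "p \<in> pos" using that interior_of_subset [of M pos] by (auto simp: A_def)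
    then show ?thesis using False d0 by (simp add: pos_def mult_pos_neg)
  qed
  define U0 where "U0 = P \<inter> A"
  define V0 where "V0 = P \<inter> A'"
  have oUV: "openin M U0" "openin M V0" using P oA by (auto simp: U0_def V0_def)
  have PUV: "P = U0 \<union> V0 \<union> KP" "U0 \<inter> V0 = {}" "U0 \<inter> KP = {}" "V0 \<inter> KP = {}"
    using AA' PM by (auto simp: U0_def V0_def KP_def)
  \<comment> \<open>Near the frontier point \<open>x\<close> there are points inside and outside
    \<open>pos\<close>. One whose sign differs from that of \<open>d\<close> cannot lie in
    \<open>KP\<close>, where all degrees are \<open>d\<close>, nor in \<open>A'\<close>.\<close>
  obtain p0 where p0: "p0 \<in> U0"
  proof (cases "d > 0")
    case True
    have "x \<notin> M interior_of pos" using W(3) by (auto simp: K_def frontier_of_def)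
    then have "\<not> P \<subseteq> pos" using P(1) xP by (auto simp: interior_of_def)
    then obtain p where p: "p \<in> P" "p \<notin> pos" by blast
    then have "p \<notin> KP" using degKP True PM by (auto simp: pos_def)
    moreover have "p \<notin> A'" using p interior_of_subset [of M pos] True by (auto simp: A'_def)
    ultimately have "p \<in> U0" using PUV(1) p by (auto simp: V0_def)
    then show thesis using that by blast
  next
    case False
    have "x \<in> M closure_of pos" using W(3) by (auto simp: K_def frontier_of_def)
    then obtain p where p: "p \<in> P" "p \<in> pos" using P(1) xP unfolding in_closure_of by blast
    then have "p \<notin> KP" using degKP False by (auto simp: pos_def)
    moreover have "p \<notin> A'" using p closure_of_subset [OF posM] False by (auto simp: A'_def)
    ultimately have "p \<in> U0" using PUV(1) p by (auto simp: V0_def)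
    then show thesis using that by blast
  qed

  define L where "L = f ` KP"
  have LY: "L \<subseteq> Y" by (auto simp: L_def KP_def P_def)
  have clL: "closedin (subtopology N Y) L" using clmap clKP by (auto simp: closed_map_def L_def)
  have oYL: "openin N (Y - L)"
  proof -
    have "openin (subtopology N Y) (Y - L)" using clL topY by (metis openin_diff openin_topspace)
    then show ?thesis using Y(1) openin_trans_full by blast
  qed
  have topYL: "topspace (subtopology N (Y - L)) = Y - L" using YN by auto
  have fP: "f p \<in> Y - L" if "p \<in> P" "p \<notin> KP" for p
  proof
    show "f p \<in> Y" using that(1) by (simp add: P_def)
    show "f p \<notin> L"
    proof
      assume "f p \<in> L"
      then obtain k where "k \<in> KP" "f p = f k" by (auto simp: L_def)
      then show False using KPinj [OF that(1)] that(2) by metis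
    qed
  qed
  have p0P: "p0 \<in> P" "p0 \<notin> KP" using p0 PUV by auto
  define O1 where "O1 = connected_component_of_set (subtopology N (Y - L)) (f p0)"
  have fp0: "f p0 \<in> O1"
    using fP [OF p0P] topYL by (simp add: O1_def connected_component_of_refl)
  have O1sub: "O1 \<subseteq> Y - L"
    using connected_component_of_subset_topspace [of "subtopology N (Y - L)" "f p0"] topYL by (simp add: O1_def)
  have conO1: "connectedin N O1"
    using connectedin_connected_component_of [of "subtopology N (Y - L)" "f p0"]
    by (simp add: O1_def connectedin_subtopology)
  have oO1: "openin N O1"
    using locally_Euclidean_imp_locally_connected [OF N(2)] oYL fP [OF p0P]
    unfolding locally_connected_space_eq_open_connected_component_of O1_def by blast
  have oYLO: "openin N (Y - L - O1)"
  proof -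
    have "closedin (subtopology N (Y - L)) O1" by (simp add: O1_def closedin_connected_component_of)
    then have "openin (subtopology N (Y - L)) (Y - L - O1)" using topYL by (metis openin_diff openin_topspace)
    then show ?thesis using oYL openin_trans_full by blast
  qed

  define U where "U = U0 \<inter> f -` O1"
  define V' where "V' = V0 \<inter> f -` O1"
  have oUV': "openin M U" "openin M V'" using pre_open oUV oO1 by (auto simp: U_def V'_def)
  have UVP: "U \<union> V' = P \<inter> f -` O1"
  proof -
    have "KP \<inter> f -` O1 = {}" using O1sub by (auto simp: L_def)
    then show ?thesis using PUV(1) by (auto simp: U_def V'_def)
  qed
  have UV': "U \<inter> V' = {}" using PUV(2) by (auto simp: U_def V'_def)
  have UG: "U \<subseteq> G" "V' \<subseteq> G" using UVP P by auto
  have clUV: "closedin M (U \<inter> f -` D)" "closedin M (V' \<inter> f -` D)" if "compactin N D" "D \<subseteq> O1" for D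
  proof -
    have "closedin M (P \<inter> f -` D)" using clP [OF that(1)] that(2) O1sub by auto
    moreover have "U \<inter> f -` D = P \<inter> f -` D - V'" "V' \<inter> f -` D = P \<inter> f -` D - U"
      using UVP UV' that(2) by auto
    ultimately show "closedin M (U \<inter> f -` D)" "closedin M (V' \<inter> f -` D)"
      using oUV' by (simp_all add: closedin_diff)
  qed
  define a where "a = map_degree U (f p0)"
  define b where "b = map_degree V' (f p0)"
  have dgU: "map_degree U y = a" if "y \<in> O1" for y
    unfolding a_def by (rule map_degree_const [OF oO1 conO1 oUV'(1) UG(1) _ that fp0]) (rule clUV)
  have dgV': "map_degree V' y = b" if "y \<in> O1" for y
    unfolding b_def by (rule map_degree_const [OF oO1 conO1 oUV'(2) UG(2) _ that fp0]) (rule clUV)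
  have fp0N: "f p0 \<in> topspace N" and fp0Y: "f p0 \<in> Y" using fp0 O1sub YN by auto
  have cp: "compactin N {f p0}" using fp0N by simp
  \<comment> \<open>Over \<open>f p0\<close> all preimages in \<open>V\<close> lie in
    \<open>U\<close> or in \<open>V'\<close>, so the two degrees add up to that of
    \<open>V\<close>.\<close>
  have "a + b = d"
  proof -
    have cl: "closedin M (U \<inter> f -` {f p0})" "closedin M (V' \<inter> f -` {f p0})"
      using clUV [OF cp] fp0 by auto
    have "V \<inter> f -` {f p0} = P \<inter> f -` {f p0}" using fp0Y by (auto simp: P_def)
    moreover have "closedin M (P \<inter> f -` {f p0})" using clP(1) [OF cp] fp0Y by auto
    ultimately have "admissible_fibre V {f p0}" using V VG by (auto simp: admissible_def)
    then have "map_degree (U \<union> V') (f p0) = map_degree V (f p0)"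
    proof (rule map_degree_shrink)
      show "openin M (U \<union> V')" using oUV' by (rule openin_Un)
    qed (use UVP fp0 fp0Y in \<open>auto simp: P_def\<close>)
    moreover have "map_degree (U \<union> V') (f p0) = a + b"
      unfolding a_def b_def
      by (rule map_degree_Un [OF fp0N]) (use cl oUV' UG UV' in \<open>auto simp: admissible_def\<close>)
    ultimately show ?thesis using dgV [OF fp0Y] by (simp add: d_def)
  qed
  have "a * d < 0"
  proof -
    have "compactin M (P \<inter> f -` {f p0})" using clP(2) [OF cp] fp0Y by auto
    then have "finite (P \<inter> f -` {f p0})" by (rule finite_fibre) auto
    moreover have "U \<inter> f -` {f p0} \<subseteq> P \<inter> f -` {f p0}" using UVP by auto
    ultimately have fin: "finite (U \<inter> f -` {f p0})" by (rule rev_finite_subset)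
    \<comment> \<open>A finite sum of degrees of sign opposite to \<open>d\<close>, nonempty because
      of \<open>p0\<close>. With a + b = d this also excludes b = 0, as then a * d would be a
      square.\<close>
    have "a = (\<Sum>p\<in>U \<inter> f -` {f p0}. ?deg p)"
      unfolding a_def by (rule map_degree_eq_sum [OF fin oUV'(1) UG(1) refl fp0N])
    then have "- (a * d) = (\<Sum>p\<in>U \<inter> f -` {f p0}. - (?deg p * d))"
      by (simp add: sum_distrib_right sum_negf)
    also have "\<dots> > 0"
    proof (rule sum_pos [OF fin])
      show "U \<inter> f -` {f p0} \<noteq> {}" using p0 fp0 by (auto simp: U_def)
      show "0 < - (?deg p * d)" if "p \<in> U \<inter> f -` {f p0}" for p
        using Aneg [of p] that by (auto simp: U_def U0_def)
    qed
    finally show ?thesis by simp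
  qed
  then have a0: "a \<noteq> 0" by auto
  have b0: "b \<noteq> 0"
  proof
    assume "b = 0"
    then have "a * d = d * d" using \<open>a + b = d\<close> by simp
    then show False using \<open>a * d < 0\<close> zero_le_square [of d] by linarith
  qed
  have fib: "U \<inter> f -` {y} \<noteq> {}" "V' \<inter> f -` {y} \<noteq> {}" if "y \<in> O1" for y
  proof -
    have "y \<in> topspace N" using that O1sub YN by auto
    then show "U \<inter> f -` {y} \<noteq> {}" "V' \<inter> f -` {y} \<noteq> {}"
      using map_degree_empty [of y U] map_degree_empty [of y V'] dgU [OF that] dgV' [OF that] a0 b0 oUV' UG by auto
  qed

  \<comment> \<open>Otherwise \<open>O1\<close> would be both open and closed in the connected set
    \<open>Y\<close>, although \<open>f x\<close> lies in \<open>Y\<close> outside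
    \<open>O1\<close>.\<close>
  obtain l where l: "l \<in> L" "\<And>T. \<lbrakk>openin N T; l \<in> T\<rbrakk> \<Longrightarrow> T \<inter> O1 \<noteq> {}"
  proof (rule ccontr)
    assume "\<not> thesis"
    then have "\<forall>l\<in>L. \<exists>T. openin N T \<and> l \<in> T \<and> T \<inter> O1 = {}" using that by blast
    then obtain S where S: "\<And>l. l \<in> L \<Longrightarrow> openin N (S l) \<and> l \<in> S l \<and> S l \<inter> O1 = {}" by metis
    have "openin N ((Y - L - O1) \<union> \<Union>(S ` L))"
      using oYLO S by (intro openin_Un openin_Union) auto
    then show False
    proof (rule connectedinD [OF Y(2) oO1])
      show "Y \<subseteq> O1 \<union> (Y - L - O1 \<union> \<Union> (S ` L))" using S by blast
      show "O1 \<inter> (Y - L - O1 \<union> \<Union> (S ` L)) \<inter> Y = {}" using S by blast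
      show "O1 \<inter> Y \<noteq> {}" using fp0 fp0Y by blast
      have "f x \<in> L" using xKP by (auto simp: L_def)
      then have "f x \<in> (Y - L - O1 \<union> \<Union> (S ` L)) \<inter> Y" using S Y(3) by blast
      then show "(Y - L - O1 \<union> \<Union> (S ` L)) \<inter> Y \<noteq> {}" by blast
    qed
  qed
  then obtain k where k: "k \<in> KP" "l = f k" by (auto simp: L_def)
  \<comment> \<open>As \<open>f\<close> is closed on \<open>P\<close> and \<open>k\<close> is the
    only preimage of \<open>l\<close> there, the preimages of values near \<open>l\<close> all lie
    in \<open>S\<close>. Over such a value in \<open>O1\<close>, both parts have nonzero degree,
    hence a preimage.\<close>
  have adh: "S \<inter> U \<noteq> {} \<and> S \<inter> V' \<noteq> {}" if S: "openin M S" "k \<in> S" for S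
  proof -
    have "openin (subtopology M P) (P \<inter> S)" using S(1) by (auto simp: openin_subtopology Int_commute)
    then have "closedin (subtopology M P) (P - P \<inter> S)" using topP by (metis closedin_diff closedin_topspace)
    then have "closedin (subtopology N Y) (f ` (P - P \<inter> S))" using clmap by (auto simp: closed_map_def)
    then have "openin (subtopology N Y) (Y - f ` (P - P \<inter> S))" using topY by (metis openin_diff openin_topspace)
    then have "openin N (Y - f ` (P - P \<inter> S))" using Y(1) openin_trans_full by blast
    moreover have "l \<in> Y - f ` (P - P \<inter> S)"
    proof
      show "l \<in> Y" using LY l(1) by blast
      show "l \<notin> f ` (P - P \<inter> S)"
      proof
        assume "l \<in> f ` (P - P \<inter> S)"
        then obtain p where "p \<in> P - P \<inter> S" "l = f p" by (rule imageE)
        then have "p \<in> P" "p \<notin> S" "f p = f k" using k(2) by auto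
        then show False using KPinj [of p k] k(1) S(2) by metis
      qed
    qed
    ultimately have "(Y - f ` (P - P \<inter> S)) \<inter> O1 \<noteq> {}" by (rule l(2))
    then obtain y where y: "y \<in> O1" "y \<notin> f ` (P - P \<inter> S)" by blast
    have "P \<inter> f -` {y} \<subseteq> S" using y(2) by auto
    moreover have "U \<subseteq> P" "V' \<subseteq> P" using UVP by auto
    ultimately show ?thesis using fib [OF y(1)] by blast
  qed

  have "a + b = 0"
  proof (rule fold_contradiction [where P = P and Y = Y and C = C and W = CW and \<xi> = \<xi>
        and C' = C' and W' = CW' and \<eta> = \<eta> and K = KP and O' = O1 and U = U and V = V' and x = k])
    have "hereditarily normal_space N"
      using regular_second_countable_imp_hereditarily_normal_space
        locally_Euclidean_imp_regular [OF n N(1,2)] sc(2) by blast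
    then show "normal_space (subtopology N Y)" by (simp add: hereditarily)
    show "P \<subseteq> {p \<in> C. \<xi> p \<in> ebox n (\<lambda>i. \<xi> x i - r) (\<lambda>i. \<xi> x i + r)}"
      using Tbox P V by blast
    show "O1 \<inter> f ` KP = {}" using O1sub by (auto simp: L_def)
    have "Y - (Y - L - O1) = O1 \<union> f ` KP" using O1sub LY by (auto simp: L_def)
    moreover have "openin (subtopology N Y) (Y - L - O1)"
      using oYLO Y(1) by (simp add: openin_open_subtopology) blast
    then have "closedin (subtopology N Y) (Y - (Y - L - O1))" using topY by (metis closedin_diff closedin_topspace)
    ultimately show "closedin (subtopology N Y) (O1 \<union> f ` KP)" by simp
    show "O1 \<subseteq> f ` (U \<union> V')" using fib(1) by blast
    show "p = k" if "p \<in> P" "k \<in> KP" "f p = f k" for p k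
      using KPinj that .
  qed (use P Y proper C(1) CW \<xi> r(2) C'(1) CW' \<eta> clKP oO1 O1sub oUV' UV' UVP dgU dgV' k adh in auto)
  then show False using \<open>a + b = d\<close> d0 by simp
qed

end

theorem theorem5p1:
  fixes M :: "'a topology" and N :: "'b topology"
    and \<alpha> :: "'a \<Rightarrow> 'a chain set" and \<beta> :: "'b \<Rightarrow> 'b chain set"
    and f :: "'a \<Rightarrow> 'b" and n :: nat
  assumes "n \<ge> 1"
    and "topological_manifold n M" and "connected_space M" and "orientation n M \<alpha>"
    and "topological_manifold n N" and "connected_space N" and "orientation n N \<beta>"
    and "continuous_map M N f"
    and "x0 \<in> topspace M" and "local_degree n M \<alpha> N \<beta> f x0 < 0"
    and "x1 \<in> topspace M" and "local_degree n M \<alpha> N \<beta> f x1 > 0"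
  shows "\<exists>x2\<in>topspace M. local_degree n M \<alpha> N \<beta> f x2 = 0"
proof (rule ccontr)
  assume "\<not> ?thesis"
  then interpret nonzero_degree_map n M \<alpha> N \<beta> f
    using assms by unfold_locales (auto simp: topological_manifold_def)
  show False
    using assms no_sign_change by (auto simp: topological_manifold_def)
qed

end
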